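(* Let $\mathbb{F}\in\{\mathbb{R},\mathbb{C}\}$, let $k\in\{1,2\}$, and let $W$ be a finite-dimensional Euclidean space (if $\mathbb{F}=\mathbb{R}$) or a finite-dimensional Hermitian space (if $\mathbb{F}=\mathbb{C}$) such that $\dim_{\mathbb{F}}W\ge 2-k$. Consider the real linear representation of the group $\mathbf{O}(W)$ on the real vector space $\bigl(S(W)/(\mathbb{R}E)\bigr)\oplus\operatorname{Hom}_{\mathbb{F}}(\mathbb{F}^k,W)$ in which $C\in\mathbf{O}(W)$ acts by $$(A+\mathbb{R}E,\;B)\mapsto(CAC^{-1}+\mathbb{R}E,\;CB).$$ (1) If $k=1$, then there exist a real vector space $V$ and a semialgebraic continuous surjective map $$\bigl(S(W)/(\mathbb{R}E)\bigr)\oplus\operatorname{Hom}_{\mathbb{F}}(\mathbb{F}^k,W)\to V\oplus\mathbb{F}$$ whose fibres coincide with the $\mathbf{SO}(W)$-orbits and which is $\mathbf{O}(W)$-equivariant, where $C\in\mathbf{O}(W)$ acts on $V\oplus\mathbb{F}$ by $(v,\lambda)\mapsto(v,\det_{\mathbb{F}}C\cdot\lambda)$. (2) If $k=2$, then there exist a real vector space $V$ and a semialgebraic continuous surjective map $$\bigl(S(W)/(\mathbb{R}E)\bigr)\oplus\operatorname{Hom}_{\mathbb{F}}(\mathbb{F}^k,W)\to V$$ whose fibres coincide with the $\mathbf{O}(W)$-orbits.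
   Context: For a finite-dimensional Euclidean ($\mathbb{F}=\mathbb{R}$) or Hermitian ($\mathbb{F}=\mathbb{C}$) space $W$: $A^*$ denotes the adjoint of an operator $A$; $E$ is the identity operator; $S(W)=\{A\in\operatorname{End}_{\mathbb{F}}(W): A=A^*\}$, regarded as a real vector space; $\mathbb{R}E\subset S(W)$ is the set of real multiples of the identity; $\mathbf{O}(W)=\{C\in\mathbf{GL}_{\mathbb{F}}(W): CC^*=E\}$ (so the orthogonal group if $\mathbb{F}=\mathbb{R}$ and the unitary group if $\mathbb{F}=\mathbb{C}$); $\mathbf{SO}(W)=\mathbf{O}(W)\cap\mathbf{SL}_{\mathbb{F}}(W)$. $\det_{\mathbb{F}}$ is the determinant over $\mathbb{F}$. The space $\mathbb{F}^k$ carries the inner product for which its standard basis is orthonormal. "Semialgebraic" refers to real semialgebraic maps between finite-dimensional real vector spaces (spaces over $\mathbb{C}$ being viewed as real vector spaces by restriction of scalars); the real vector space $V$ is finite-dimensional. "The fibres coincide with the $G$-orbits" means that two points have the same image if and only if they lie in the same $G$-orbit. *)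

theory Defs
  imports "HOL-Analysis.Analysis" "HOL-Combinatorics.Permutations"
begin

section \<open>The ground field\<close>

text \<open>A type of this class is the field of real numbers with trivial conjugation, or the field of
  complex numbers with complex conjugation; the two cases are the two disjuncts of the axiom.\<close>

class real_or_complex = real_normed_field +
  fixes cconj :: "'a \<Rightarrow> 'a"
  assumes real_or_complex:
    "(\<forall>z. (\<exists>x. z = x *\<^sub>R 1) \<and> cconj z = z) \<or>
     (\<exists>i. i * i = - 1 \<and> (\<forall>z. \<exists>x y. z = x *\<^sub>R 1 + y *\<^sub>R i) \<and>
          (\<forall>x y. cconj (x *\<^sub>R 1 + y *\<^sub>R i) = x *\<^sub>R 1 - y *\<^sub>R i))"

instantiation real :: real_or_complex
begin
definition cconj_real :: "real \<Rightarrow> real" where "cconj_real x = x"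
instance by standard (simp add: cconj_real_def)
end

instantiation complex :: real_or_complex
begin
definition cconj_complex :: "complex \<Rightarrow> complex" where "cconj_complex = cnj"
instance
proof
  have "\<exists>x y. z = x *\<^sub>R 1 + y *\<^sub>R \<i>" for z :: complex
    by (rule exI[of _ "Re z"], rule exI[of _ "Im z"]) (simp add: complex_eq_iff)
  then have "\<i> * \<i> = - 1 \<and> (\<forall>z. \<exists>x y. z = x *\<^sub>R 1 + y *\<^sub>R \<i>) \<and>
        (\<forall>x y. cconj (x *\<^sub>R 1 + y *\<^sub>R \<i>) = x *\<^sub>R 1 - y *\<^sub>R \<i>)"
    by (simp add: cconj_complex_def complex_eq_iff)
  then show "(\<forall>z::complex. (\<exists>x. z = x *\<^sub>R 1) \<and> cconj z = z) \<or>
     (\<exists>i::complex. i * i = - 1 \<and> (\<forall>z. \<exists>x y. z = x *\<^sub>R 1 + y *\<^sub>R i) \<and>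
          (\<forall>x y. cconj (x *\<^sub>R 1 + y *\<^sub>R i) = x *\<^sub>R 1 - y *\<^sub>R i))"
    by blast
qed
end

section \<open>Euclidean and Hermitian spaces and their operators\<close>

text \<open>The space is the whole type \<open>'w\<close>. Dimension 0 is included (a one-element type).\<close>

locale inner_product_space = vector_space smul
  for smul :: "'f::real_or_complex \<Rightarrow> 'w::ab_group_add \<Rightarrow> 'w" +
  fixes ip :: "'w \<Rightarrow> 'w \<Rightarrow> 'f"
  assumes ip_add: "ip (x + y) z = ip x z + ip y z"
    and ip_scale: "ip (smul a x) y = a * ip x y"
    and ip_conj: "ip y x = cconj (ip x y)"
    and ip_pos: "x \<noteq> 0 \<Longrightarrow> \<exists>r>0. ip x x = of_real r"
    and finite_dim: "\<exists>B. finite B \<and> span B = UNIV"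

definition End_op :: "('f::field \<Rightarrow> 'w::ab_group_add \<Rightarrow> 'w) \<Rightarrow> ('w \<Rightarrow> 'w) set" where
  "End_op smul = {A. Vector_Spaces.linear smul smul A}"

definition adj :: "('w \<Rightarrow> 'w \<Rightarrow> 'f) \<Rightarrow> ('w \<Rightarrow> 'w) \<Rightarrow> 'w \<Rightarrow> 'w" where
  "adj ip A = (THE A'. \<forall>x y. ip (A x) y = ip x (A' y))"

definition O_group ::
  "('f::field \<Rightarrow> 'w::ab_group_add \<Rightarrow> 'w) \<Rightarrow> ('w \<Rightarrow> 'w \<Rightarrow> 'f) \<Rightarrow> ('w \<Rightarrow> 'w) set" where
  "O_group smul ip = {C \<in> End_op smul. bij C \<and> C \<circ> adj ip C = id}"

text \<open>The Leibniz formula for the matrix of the operator in some basis. The entry in row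
  \<open>b'\<close> and column \<open>b\<close> is \<open>representation B (C b) b'\<close>.\<close>

definition op_det :: "('f::field \<Rightarrow> 'w::ab_group_add \<Rightarrow> 'w) \<Rightarrow> ('w \<Rightarrow> 'w) \<Rightarrow> 'f" where
  "op_det smul C =
    (let B = (SOME B. \<not> module.dependent smul B \<and> module.span smul B = UNIV) in
      \<Sum>p | p permutes B. of_int (sign p) * (\<Prod>b\<in>B. module.representation smul B (C b) (p b)))"

definition SO_group ::
  "('f::field \<Rightarrow> 'w::ab_group_add \<Rightarrow> 'w) \<Rightarrow> ('w \<Rightarrow> 'w \<Rightarrow> 'f) \<Rightarrow> ('w \<Rightarrow> 'w) set" where
  "SO_group smul ip = {C \<in> O_group smul ip. op_det smul C = 1}"

section \<open>Real vector spaces with explicit carrier\<close>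

record 'x real_space =
  pts :: "'x set"
  add :: "'x \<Rightarrow> 'x \<Rightarrow> 'x"
  scl :: "real \<Rightarrow> 'x \<Rightarrow> 'x"

definition direct_sum :: "'x real_space \<Rightarrow> 'y real_space \<Rightarrow> ('x \<times> 'y) real_space"
    (infixr \<open>\<oplus>\<^sub>R\<close> 65) where
  "X \<oplus>\<^sub>R Y = \<lparr>pts = pts X \<times> pts Y,
    add = (\<lambda>(x, y) (x', y'). (add X x x', add Y y y')),
    scl = (\<lambda>c (x, y). (scl X c x, scl Y c y))\<rparr>"

text \<open>In the quotient by a subspace \<open>N\<close>, the summand \<open>n\<close> in the scalar multiple makes
  \<open>0\<close> times a coset equal to \<open>N\<close> rather than \<open>{0}\<close>.\<close>

definition coset :: "'x real_space \<Rightarrow> 'x set \<Rightarrow> 'x \<Rightarrow> 'x set" where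
  "coset X N x = {add X x n | n. n \<in> N}"

definition quotient_space :: "'x real_space \<Rightarrow> 'x set \<Rightarrow> 'x set real_space" where
  "quotient_space X N = \<lparr>pts = coset X N ` pts X,
    add = (\<lambda>P Q. {add X x y | x y. x \<in> P \<and> y \<in> Q}),
    scl = (\<lambda>c P. {add X (scl X c x) n | x n. x \<in> P \<and> n \<in> N})\<rparr>"

definition coord_space :: "nat \<Rightarrow> (nat \<Rightarrow> real) real_space" where
  "coord_space m = \<lparr>pts = {v. \<forall>i\<ge>m. v i = 0},
    add = (\<lambda>v w i. v i + w i), scl = (\<lambda>c v i. c * v i)\<rparr>"

definition field_space :: "'f::real_or_complex real_space" where
  "field_space = \<lparr>pts = UNIV, add = (+), scl = scaleR\<rparr>"

definition Hom_space :: "('f::real_or_complex \<Rightarrow> 'v::ab_group_add \<Rightarrow> 'v) \<Rightarrow>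
    ('f \<Rightarrow> 'w::ab_group_add \<Rightarrow> 'w) \<Rightarrow> ('v \<Rightarrow> 'w) real_space" where
  "Hom_space smul1 smul2 = \<lparr>pts = {B. Vector_Spaces.linear smul1 smul2 B},
    add = (\<lambda>A B x. A x + B x), scl = (\<lambda>c A x. smul2 (of_real c) (A x))\<rparr>"

definition S_space :: "('f::real_or_complex \<Rightarrow> 'w::ab_group_add \<Rightarrow> 'w) \<Rightarrow>
    ('w \<Rightarrow> 'w \<Rightarrow> 'f) \<Rightarrow> ('w \<Rightarrow> 'w) real_space" where
  "S_space smul ip = \<lparr>pts = {A \<in> End_op smul. A = adj ip A},
    add = (\<lambda>A B x. A x + B x), scl = (\<lambda>c A x. smul (of_real c) (A x))\<rparr>"

definition real_multiples_E ::
  "('f::real_or_complex \<Rightarrow> 'w::ab_group_add \<Rightarrow> 'w) \<Rightarrow> ('w \<Rightarrow> 'w) set" where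
  "real_multiples_E smul = {\<lambda>x. smul (of_real c) x | c. True}"

section \<open>Topology and semialgebraic maps\<close>

definition lin_functional :: "'x real_space \<Rightarrow> ('x \<Rightarrow> real) \<Rightarrow> bool" where
  "lin_functional X \<phi> \<longleftrightarrow>
    (\<forall>x\<in>pts X. \<forall>y\<in>pts X. \<phi> (add X x y) = \<phi> x + \<phi> y) \<and>
    (\<forall>c. \<forall>x\<in>pts X. \<phi> (scl X c x) = c * \<phi> x)"

text \<open>The coarsest topology making all linear functionals continuous; on a finite-dimensional
  space this is the usual topology.\<close>

definition vs_topology :: "'x real_space \<Rightarrow> 'x topology" where
  "vs_topology X =
    topology_generated_by {{x \<in> pts X. \<phi> x \<in> U} | \<phi> U. lin_functional X \<phi> \<and> open U}"

text \<open>The analogue of \<^const>\<open>real_polynomial_function\<close> for an explicit carrier.\<close>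

inductive polynomial_on :: "'x real_space \<Rightarrow> ('x \<Rightarrow> real) \<Rightarrow> bool" for X where
  linear: "lin_functional X \<phi> \<Longrightarrow> polynomial_on X \<phi>"
| const: "polynomial_on X (\<lambda>x. c)"
| add: "polynomial_on X p \<Longrightarrow> polynomial_on X q \<Longrightarrow> polynomial_on X (\<lambda>x. p x + q x)"
| mult: "polynomial_on X p \<Longrightarrow> polynomial_on X q \<Longrightarrow> polynomial_on X (\<lambda>x. p x * q x)"

inductive semialgebraic_set :: "'x real_space \<Rightarrow> 'x set \<Rightarrow> bool" for X where
  eq: "polynomial_on X p \<Longrightarrow> semialgebraic_set X {x \<in> pts X. p x = 0}"
| pos: "polynomial_on X p \<Longrightarrow> semialgebraic_set X {x \<in> pts X. p x > 0}"
| inter: "semialgebraic_set X A \<Longrightarrow> semialgebraic_set X B \<Longrightarrow> semialgebraic_set X (A \<inter> B)"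
| union: "semialgebraic_set X A \<Longrightarrow> semialgebraic_set X B \<Longrightarrow> semialgebraic_set X (A \<union> B)"
| compl: "semialgebraic_set X A \<Longrightarrow> semialgebraic_set X (pts X - A)"

definition semialgebraic_map :: "'x real_space \<Rightarrow> 'y real_space \<Rightarrow> ('x \<Rightarrow> 'y) \<Rightarrow> bool" where
  "semialgebraic_map X Y f \<longleftrightarrow>
    f ` pts X \<subseteq> pts Y \<and> semialgebraic_set (X \<oplus>\<^sub>R Y) {(x, f x) | x. x \<in> pts X}"

section \<open>The representation\<close>

definition rep_space :: "('f::real_or_complex \<Rightarrow> 'w::ab_group_add \<Rightarrow> 'w) \<Rightarrow>
    ('w \<Rightarrow> 'w \<Rightarrow> 'f) \<Rightarrow> (('w \<Rightarrow> 'w) set \<times> ('f ^ 'k \<Rightarrow> 'w)) real_space" where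
  "rep_space smul ip =
    quotient_space (S_space smul ip) (real_multiples_E smul) \<oplus>\<^sub>R Hom_space (*s) smul"

text \<open>The image of the coset of \<open>A\<close> under conjugation by \<open>C\<close> is the coset of the
  conjugate of \<open>A\<close>.\<close>

definition act :: "('w \<Rightarrow> 'w) \<Rightarrow> ('w \<Rightarrow> 'w) set \<times> ('v \<Rightarrow> 'w) \<Rightarrow> ('w \<Rightarrow> 'w) set \<times> ('v \<Rightarrow> 'w)" where
  "act C = (\<lambda>(P, B). ((\<lambda>A. C \<circ> A \<circ> inv C) ` P, C \<circ> B))"

definition fibres_are_orbits ::
  "'x real_space \<Rightarrow> 'g set \<Rightarrow> ('g \<Rightarrow> 'x \<Rightarrow> 'x) \<Rightarrow> ('x \<Rightarrow> 'y) \<Rightarrow> bool" where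
  "fibres_are_orbits X G a f \<longleftrightarrow>
    (\<forall>x\<in>pts X. \<forall>y\<in>pts X. f x = f y \<longleftrightarrow> (\<exists>C\<in>G. y = a C x))"

end

(* Diagonalize a selfadjoint operator A with eigenvalues l_0 >= ... >= l_(n-1). Up to unitary
   equivalence, A together with k vectors is a configuration of n points l_i on the line labelled by
   the coordinates of the vectors in an eigenbasis, each label up to a scalar of modulus 1; at a multiple
   eigenvalue only the sum of the rank-one Gram matrices of the labels matters. For k = 2, the traceless
   part m_i of the Gram matrix of a label is an arbitrary element of a real vector space, and its trace
   is the norm of m_i.

   Removing the largest point l_0 and multiplying the other Gram matrices by l_0 - l_i gives a
   well-defined configuration of n - 1 points, as this factor kills the labels that collide with l_0.
   Given this smaller configuration and the sum of all m_i, the one remaining parameter is l_0. The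
   total trace is a nonincreasing function of l_0 by the triangle inequality, so the total trace minus
   the sum of the l_0 - l_i is strictly decreasing in l_0, and it takes every real value once: if
   it stays bounded as l_0 comes down to l_1, then the labels at l_1 vanish, and the missing
   values are provided by configurations with l_0 = l_1. Iteration yields global coordinates: the
   traceless and, up to the gaps, the traces of the Gram matrices formed with the Newton products
   (l_0 - A) ... (l_(j-1) - A).

   For k = 1, the labels are nonnegative weights w_i. Here the numbers
   b_i = w_i * prod_(q ~= i) |l_q - l_i| replace the m_i; the orthant of these numbers is mapped
   bijectively onto a half-space by their full product and the differences
   b_(j+1) * ... * b_(n-1) - b_j. The full product is the squared modulus of the determinant of the
   Newton products applied to the vector, which is multiplied by det C under the action of C. It
   vanishes exactly when the vector is not cyclic, that is, when the stabilizer of the pair contains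
   operators of every determinant of modulus 1. *)

theory Submission
  imports Defs "Jordan_Normal_Form.Determinant"
begin

section \<open>Weighted point configurations on the line\<close>

text \<open>The obstacle is that neither eigenvectors nor, at a multiple eigenvalue, the individual
  labels are functions of the orbit. Two configurations are therefore compared through the sums of
  \<open>\<phi> (l i)\<close> times the labels for all real functions \<phi>. These sums see only
  the total label at each point, and they allow division by factors such as \<open>L' - x\<close>.
  Every invariant is a polynomial in matrix entries, vector coordinates and ordered eigenvalues. One
  computation thus serves two purposes: it gives continuity, because ordered eigenvalues are
  continuous, and it gives a quantifier-free description of the graph, because the eigenvalues are
  polynomial functions of the point together with its image. The target dimensions agree with a
  parameter count. Modulo scalars there are n - 1 eigenvalue parameters, and a label modulo phase
  has 2 real parameters over the reals and 3 over the complex numbers if k = 2, hence 3n - 1 and 4n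
  - 1. For k = 1 there is one parameter per label; replacing their full product by a field element
  leaves 2(n - 1) real coordinates besides that element.\<close>

definition newton_coeff :: "(nat \<Rightarrow> real) \<Rightarrow> nat \<Rightarrow> nat \<Rightarrow> real" where
  "newton_coeff l j i = (\<Prod>q<j. l q - l i)"

text \<open>Another point at the position \<open>l i\<close> makes this vanish, so that it has a
  meaning at a multiple eigenvalue, where \<open>w i\<close> alone depends on the choice of an
  eigenbasis.\<close>

definition weight :: "nat \<Rightarrow> (nat \<Rightarrow> real) \<Rightarrow> (nat \<Rightarrow> real) \<Rightarrow> nat \<Rightarrow> real" where
  "weight n l w i = w i * (\<Prod>q\<in>{..<n} - {i}. \<bar>l q - l i\<bar>)"

definition descending :: "nat \<Rightarrow> (nat \<Rightarrow> real) \<Rightarrow> bool" where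
  "descending n l \<longleftrightarrow> (\<forall>i j. i < j \<longrightarrow> j < n \<longrightarrow> l j \<le> l i)"

lemma descending_Suc: "descending (Suc n) l \<Longrightarrow> descending n (l \<circ> Suc)"
  by (auto simp: descending_def)

lemma descending_top: "descending (Suc n) l \<Longrightarrow> i < n \<Longrightarrow> l (Suc i) \<le> l 0"
  by (auto simp: descending_def)

lemma newton_coeff_Suc_Suc:
  "newton_coeff l (Suc j) (Suc i) = (l 0 - l (Suc i)) * newton_coeff (l \<circ> Suc) j i"
  unfolding newton_coeff_def prod.lessThan_Suc_shift by simp

lemma newton_coeff_Suc_0: "newton_coeff l (Suc j) 0 = 0"
  unfolding newton_coeff_def prod.lessThan_Suc_shift by simp

lemma newton_coeff_0 [simp]: "newton_coeff l 0 i = 1"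
  by (simp add: newton_coeff_def)

text \<open>Every Newton coefficient of positive index contains the gap to the top point as a
  factor. Moving it into the labels turns the data of index at least 1 into the full data of a
  configuration without the top point.\<close>

lemma newton_sum_Suc:
  fixes m :: "nat \<Rightarrow> 'h::real_vector"
  shows "(\<Sum>i<Suc n. newton_coeff l (Suc j) i *\<^sub>R m i) =
    (\<Sum>i<n. newton_coeff (l \<circ> Suc) j i *\<^sub>R ((l 0 - l (Suc i)) *\<^sub>R m (Suc i)))"
  unfolding sum.lessThan_Suc_shift
  by (simp add: newton_coeff_Suc_Suc newton_coeff_Suc_0 mult.commute)

text \<open>Descending order makes the factors \<open>l 0 - l (Suc i)\<close> nonnegative, so the
  norms absorb them just as the labels do.\<close>

lemma newton_norm_sum_Suc:
  fixes m :: "nat \<Rightarrow> 'h::real_normed_vector"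
  assumes "descending (Suc n) l"
  shows "(\<Sum>i<Suc n. newton_coeff l (Suc j) i * norm (m i)) =
    (\<Sum>i<n. newton_coeff (l \<circ> Suc) j i * norm ((l 0 - l (Suc i)) *\<^sub>R m (Suc i)))"
  unfolding sum.lessThan_Suc_shift
  using descending_top[OF assms]
  by (auto simp: newton_coeff_Suc_Suc newton_coeff_Suc_0 intro!: sum.cong)

lemma gap_sum_Suc:
  fixes l :: "nat \<Rightarrow> real"
  shows "(\<Sum>i\<in>{Suc j..<Suc n}. l (Suc j) - l i) = (\<Sum>i\<in>{j..<n}. (l \<circ> Suc) j - (l \<circ> Suc) i)"
  by (subst sum.shift_bounds_Suc_ivl) simp

lemma gap_sum_0:
  fixes l :: "nat \<Rightarrow> real"
  shows "(\<Sum>i\<in>{0..<Suc n}. l 0 - l i) = (\<Sum>i<n. l 0 - l (Suc i))"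
  unfolding atLeast0LessThan sum.lessThan_Suc_shift by simp

lemma weight_0:
  assumes "descending (Suc n) l"
  shows "weight (Suc n) l w 0 = w 0 * (\<Prod>i<n. l 0 - l (Suc i))"
proof -
  have "{..<Suc n} - {0} = Suc ` {..<n}"
    unfolding lessThan_Suc_eq_insert_0 by auto
  then have "(\<Prod>q\<in>{..<Suc n} - {0}. \<bar>l q - l 0\<bar>) = (\<Prod>i<n. \<bar>l (Suc i) - l 0\<bar>)"
    by (simp add: prod.reindex)
  also have "\<dots> = (\<Prod>i<n. l 0 - l (Suc i))"
    using descending_top[OF assms] by (auto intro!: prod.cong)
  finally show ?thesis by (simp add: weight_def)
qed

text \<open>The distance to the removed top point migrates from the product of distances into the
  mass, so the weights of the lower points survive the removal.\<close>

lemma weight_Suc: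
  assumes "descending (Suc n) l" "i < n"
  shows "weight (Suc n) l w (Suc i) = weight n (l \<circ> Suc) (\<lambda>i. (l 0 - l (Suc i)) * w (Suc i)) i"
proof -
  have "{..<Suc n} - {Suc i} = insert 0 (Suc ` ({..<n} - {i}))"
    unfolding lessThan_Suc_eq_insert_0 by auto
  then have "(\<Prod>q\<in>{..<Suc n} - {Suc i}. \<bar>l q - l (Suc i)\<bar>)
      = \<bar>l 0 - l (Suc i)\<bar> * (\<Prod>q\<in>{..<n} - {i}. \<bar>l (Suc q) - l (Suc i)\<bar>)"
    by (simp add: prod.reindex)
  then show ?thesis
    using descending_top[OF assms] by (simp add: weight_def)
qed

lemma weight_nonneg: "w i \<ge> 0 \<Longrightarrow> weight n l w i \<ge> 0"
  by (auto simp: weight_def intro!: mult_nonneg_nonneg prod_nonneg)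

subsection \<open>Injectivity\<close>

text \<open>Write \<open>\<phi> x = \<phi> L + (L - x) * \<psi> x\<close>. The value of \<open>\<psi>\<close> at \<open>L\<close> is irrelevant.\<close>

lemma sums_eq_of_top_eq:
  fixes v v' :: "nat \<Rightarrow> 'h::real_vector" and L :: real
  assumes le: "\<And>i. i < n \<Longrightarrow> l i \<le> L"
    and eq: "\<And>\<phi>. (\<Sum>i<n. \<phi> (l i) *\<^sub>R ((L - l i) *\<^sub>R v i)) =
                  (\<Sum>i<n. \<phi> (l i) *\<^sub>R ((L - l i) *\<^sub>R v' i))"
    and tot: "v0 + sum v {..<n} = v0' + sum v' {..<n}"
  shows "\<phi> L *\<^sub>R v0 + (\<Sum>i<n. \<phi> (l i) *\<^sub>R v i) = \<phi> L *\<^sub>R v0' + (\<Sum>i<n. \<phi> (l i) *\<^sub>R v' i)"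
proof -
  define \<psi> where "\<psi> x = (\<phi> x - \<phi> L) / (L - x)" for x
  have split: "\<phi> L *\<^sub>R u0 + (\<Sum>i<n. \<phi> (l i) *\<^sub>R u i) =
      \<phi> L *\<^sub>R (u0 + sum u {..<n}) + (\<Sum>i<n. \<psi> (l i) *\<^sub>R ((L - l i) *\<^sub>R u i))"
    for u0 :: 'h and u :: "nat \<Rightarrow> 'h"
  proof -
    have "(\<Sum>i<n. \<psi> (l i) *\<^sub>R ((L - l i) *\<^sub>R u i)) = (\<Sum>i<n. (\<phi> (l i) - \<phi> L) *\<^sub>R u i)"
      by (intro sum.cong) (auto simp: \<psi>_def)
    then show ?thesis
      by (simp add: scaleR_left_diff_distrib sum_subtractf scaleR_add_right scaleR_sum_right)
  qed
  show ?thesis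
    unfolding split using eq tot by simp
qed

text \<open>The function \<open>\<phi> x = 1 / (L' - x)\<close> is finite at all points because
  \<open>l i \<le> L < L'\<close>. It shows that raising the top point scales the lower labels, in
  sum, by \<open>\<theta> i\<close> between 0 and 1. The missing fractions
  \<open>1 - \<theta> i\<close> pass to the top label, where the triangle inequality can only lose
  norm.\<close>

lemma norm_total_mono:
  fixes m m' :: "nat \<Rightarrow> 'h::real_normed_vector"
  assumes lt: "L < L'" and le: "\<And>i. i < n \<Longrightarrow> l i \<le> L"
    and eqm: "\<And>\<phi>. (\<Sum>i<n. \<phi> (l i) *\<^sub>R ((L - l i) *\<^sub>R m i)) =
                  (\<Sum>i<n. \<phi> (l i) *\<^sub>R ((L' - l i) *\<^sub>R m' i))"
    and eqt: "\<And>\<phi>. (\<Sum>i<n. \<phi> (l i) * ((L - l i) * norm (m i))) =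
                  (\<Sum>i<n. \<phi> (l i) * ((L' - l i) * norm (m' i)))"
    and tot: "m0 + sum m {..<n} = m0' + sum m' {..<n}"
  shows "norm m0' + (\<Sum>i<n. norm (m' i)) \<le> norm m0 + (\<Sum>i<n. norm (m i))"
proof -
  define \<theta> where "\<theta> i = (L - l i) / (L' - l i)" for i
  have \<theta>: "0 \<le> \<theta> i" "\<theta> i \<le> 1" if "i < n" for i
    using le[OF that] lt by (auto simp: \<theta>_def divide_simps)
  have inv: "(1 / (L' - l i)) * (L' - l i) = 1" if "i < n" for i
    using le[OF that] lt by auto
  have 1: "sum m' {..<n} = (\<Sum>i<n. \<theta> i *\<^sub>R m i)"
  proof -
    have "sum m' {..<n} = (\<Sum>i<n. (1 / (L' - l i)) *\<^sub>R ((L' - l i) *\<^sub>R m' i))"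
      using inv by (intro sum.cong) (auto simp del: times_divide_eq_left)
    also have "\<dots> = (\<Sum>i<n. (1 / (L' - l i)) *\<^sub>R ((L - l i) *\<^sub>R m i))"
      using eqm[of "\<lambda>x. 1 / (L' - x)"] by simp
    finally show ?thesis by (simp add: \<theta>_def)
  qed
  have 2: "(\<Sum>i<n. norm (m' i)) = (\<Sum>i<n. \<theta> i * norm (m i))"
  proof -
    have "(\<Sum>i<n. norm (m' i)) = (\<Sum>i<n. (1 / (L' - l i)) * ((L' - l i) * norm (m' i)))"
    proof (intro sum.cong refl)
      fix i assume "i \<in> {..<n}"
      then have "L' - l i \<noteq> 0" using le[of i] lt by auto
      then show "norm (m' i) = (1 / (L' - l i)) * ((L' - l i) * norm (m' i))" by simp
    qed
    also have "\<dots> = (\<Sum>i<n. (1 / (L' - l i)) * ((L - l i) * norm (m i)))"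
      using eqt[of "\<lambda>x. 1 / (L' - x)"] by simp
    finally show ?thesis by (simp add: \<theta>_def)
  qed
  have "m0' = m0 + (\<Sum>i<n. (1 - \<theta> i) *\<^sub>R m i)"
    using tot 1 by (simp add: scaleR_left_diff_distrib sum_subtractf algebra_simps)
  then have "norm m0' \<le> norm m0 + norm (\<Sum>i<n. (1 - \<theta> i) *\<^sub>R m i)"
    by (simp add: norm_triangle_ineq)
  also have "norm (\<Sum>i<n. (1 - \<theta> i) *\<^sub>R m i) \<le> (\<Sum>i<n. (1 - \<theta> i) * norm (m i))"
    by (rule order_trans[OF norm_sum]) (use \<theta> in \<open>auto intro!: sum_mono\<close>)
  finally show ?thesis
    unfolding 2 by (simp add: sum_subtractf left_diff_distrib)
qed

text \<open>Nothing is transferred between masses here. Raising the top point does not increase the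
  total of the lower masses, and it does not increase the top mass either, because the product of
  that mass with the gaps is fixed.\<close>

lemma weight_total_mono:
  fixes w w' :: "nat \<Rightarrow> real"
  assumes lt: "L < L'" and le: "\<And>i. i < n \<Longrightarrow> l i \<le> L" and n: "n > 0"
    and nn: "\<And>i. i < n \<Longrightarrow> w i \<ge> 0" "w0 \<ge> 0" "\<And>i. i < n \<Longrightarrow> w' i \<ge> 0" "w0' \<ge> 0"
    and eqt: "\<And>\<phi>. (\<Sum>i<n. \<phi> (l i) * ((L - l i) * w i)) =
                  (\<Sum>i<n. \<phi> (l i) * ((L' - l i) * w' i))"
    and top: "w0 * (\<Prod>i<n. L - l i) = w0' * (\<Prod>i<n. L' - l i)"
  shows "w0' + sum w' {..<n} \<le> w0 + sum w {..<n}"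
proof -
  have "(\<Sum>i<n. w' i) = (\<Sum>i<n. (1 / (L' - l i)) * ((L' - l i) * w' i))"
  proof (intro sum.cong refl)
    fix i assume "i \<in> {..<n}"
    then have "L' - l i \<noteq> 0" using le[of i] lt by auto
    then show "w' i = (1 / (L' - l i)) * ((L' - l i) * w' i)" by simp
  qed
  also have "\<dots> = (\<Sum>i<n. (1 / (L' - l i)) * ((L - l i) * w i))"
    using eqt[of "\<lambda>x. 1 / (L' - x)"] by simp
  also have "\<dots> \<le> (\<Sum>i<n. w i)"
  proof (intro sum_mono)
    fix i assume "i \<in> {..<n}"
    then have i: "l i \<le> L" "w i \<ge> 0" using le nn by auto
    then have "(L - l i) * w i \<le> (L' - l i) * w i" using lt by (intro mult_right_mono) auto
    then show "(1 / (L' - l i)) * ((L - l i) * w i) \<le> w i"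
      using i lt by (simp add: divide_simps mult.commute)
  qed
  finally have 1: "sum w' {..<n} \<le> sum w {..<n}" .
  have pos: "(\<Prod>i<n. L' - l i) > 0" using le lt by (intro prod_pos) force
  have "w0' * (\<Prod>i<n. L' - l i) \<le> w0 * (\<Prod>i<n. L' - l i)"
    unfolding top[symmetric] using le lt nn by (intro mult_left_mono prod_mono) force+
  then have "w0' \<le> w0" using pos by simp
  with 1 show ?thesis by simp
qed

lemma gap_sum_strict:
  fixes l :: "nat \<Rightarrow> real"
  assumes "L < L'" "n > 0"
  shows "(\<Sum>i<n. L - l i) < (\<Sum>i<n. L' - l i)"
  using assms by (intro sum_strict_mono) auto

text \<open>The top point is determined since the total mass is a nonincreasing function of it, whereas
  the sum of the distances to the other points is strictly increasing.\<close>

theorem labelled_configuration_unique: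
  fixes l l' :: "nat \<Rightarrow> real" and m m' :: "nat \<Rightarrow> 'h::real_normed_vector"
  assumes "descending n l" "descending n l'"
    and "\<And>j. j < n \<Longrightarrow> (\<Sum>i<n. newton_coeff l j i *\<^sub>R m i) = (\<Sum>i<n. newton_coeff l' j i *\<^sub>R m' i)"
    and "\<And>j. Suc j < n \<Longrightarrow>
      (\<Sum>i<n. newton_coeff l j i * norm (m i)) - (\<Sum>i\<in>{j..<n}. l j - l i) =
      (\<Sum>i<n. newton_coeff l' j i * norm (m' i)) - (\<Sum>i\<in>{j..<n}. l' j - l' i)"
  shows "\<exists>c. (\<forall>i<n. l' i = l i + c) \<and>
    (\<forall>\<phi>. (\<Sum>i<n. \<phi> (l i) *\<^sub>R m i) = (\<Sum>i<n. \<phi> (l i) *\<^sub>R m' i)) \<and>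
    (\<forall>\<phi>. (\<Sum>i<n. \<phi> (l i) * norm (m i)) = (\<Sum>i<n. \<phi> (l i) * norm (m' i)))"
  using assms
proof (induction n arbitrary: l l' m m')
  case 0
  then show ?case by simp
next
  case (Suc n)
  show ?case
  proof (cases "n = 0")
    case True
    have "m 0 = m' 0" using Suc.prems(3)[of 0] True by simp
    then show ?thesis using True by (intro exI[of _ "l' 0 - l 0"]) simp
  next
    case False
    define v v' where "v i = (l 0 - l (Suc i)) *\<^sub>R m (Suc i)"
      and "v' i = (l' 0 - l' (Suc i)) *\<^sub>R m' (Suc i)" for i
    note d = Suc.prems(1,2)
    have nv: "norm (v i) = (l 0 - l (Suc i)) * norm (m (Suc i))"
      "norm (v' i) = (l' 0 - l' (Suc i)) * norm (m' (Suc i))" if "i < n" for i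
      using that descending_top[OF d(1) that] descending_top[OF d(2) that]
      by (auto simp: v_def v'_def)
    have "\<exists>c. (\<forall>i<n. (l' \<circ> Suc) i = (l \<circ> Suc) i + c) \<and>
      (\<forall>\<phi>. (\<Sum>i<n. \<phi> ((l \<circ> Suc) i) *\<^sub>R v i) = (\<Sum>i<n. \<phi> ((l \<circ> Suc) i) *\<^sub>R v' i)) \<and>
      (\<forall>\<phi>. (\<Sum>i<n. \<phi> ((l \<circ> Suc) i) * norm (v i)) = (\<Sum>i<n. \<phi> ((l \<circ> Suc) i) * norm (v' i)))"
    proof (rule Suc.IH)
      fix j assume "j < n"
      then show "(\<Sum>i<n. newton_coeff (l \<circ> Suc) j i *\<^sub>R v i) =
          (\<Sum>i<n. newton_coeff (l' \<circ> Suc) j i *\<^sub>R v' i)"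
        unfolding v_def v'_def newton_sum_Suc[symmetric] by (intro Suc.prems) simp
    next
      fix j assume "Suc j < n"
      then show "(\<Sum>i<n. newton_coeff (l \<circ> Suc) j i * norm (v i)) -
            (\<Sum>i\<in>{j..<n}. (l \<circ> Suc) j - (l \<circ> Suc) i) =
          (\<Sum>i<n. newton_coeff (l' \<circ> Suc) j i * norm (v' i)) -
            (\<Sum>i\<in>{j..<n}. (l' \<circ> Suc) j - (l' \<circ> Suc) i)"
        unfolding v_def v'_def newton_norm_sum_Suc[OF d(1), symmetric]
          newton_norm_sum_Suc[OF d(2), symmetric] gap_sum_Suc[symmetric]
        by (intro Suc.prems) simp
    qed (rule descending_Suc, rule d)+
    then obtain c where c: "\<And>i. i < n \<Longrightarrow> l' (Suc i) = l (Suc i) + c"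
      and eqm: "\<And>\<phi>. (\<Sum>i<n. \<phi> (l (Suc i)) *\<^sub>R v i) = (\<Sum>i<n. \<phi> (l (Suc i)) *\<^sub>R v' i)"
      and eqt: "\<And>\<phi>. (\<Sum>i<n. \<phi> (l (Suc i)) * norm (v i)) = (\<Sum>i<n. \<phi> (l (Suc i)) * norm (v' i))"
      by auto
    \<comment> \<open>The lower points agree only up to the translation by \<open>c\<close>;
      \<open>L'\<close> is the second top point in the coordinates of the first
      configuration.\<close>
    define L' where "L' = l' 0 - c"
    let ?l = "\<lambda>i. l (Suc i)" and ?m = "\<lambda>i. m (Suc i)" and ?m' = "\<lambda>i. m' (Suc i)"
    have le: "?l i \<le> l 0" "?l i \<le> L'" if "i < n" for i
      using that descending_top[OF d(1) that] descending_top[OF d(2) that] c[OF that]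
      by (auto simp: L'_def)
    have v': "v' i = (L' - ?l i) *\<^sub>R ?m' i" "norm (v' i) = (L' - ?l i) * norm (?m' i)" if "i < n" for i
      using that c[OF that] nv(2)[OF that] by (auto simp: v'_def L'_def algebra_simps)
    have eqm': "(\<Sum>i<n. \<phi> (?l i) *\<^sub>R ((l 0 - ?l i) *\<^sub>R ?m i)) =
        (\<Sum>i<n. \<phi> (?l i) *\<^sub>R ((L' - ?l i) *\<^sub>R ?m' i))" for \<phi>
      using eqm[of \<phi>] v' by (simp add: v_def)
    have eqt': "(\<Sum>i<n. \<phi> (?l i) * ((l 0 - ?l i) * norm (?m i))) =
        (\<Sum>i<n. \<phi> (?l i) * ((L' - ?l i) * norm (?m' i)))" for \<phi>
    proof -
      have "(\<Sum>i<n. \<phi> (?l i) * ((l 0 - ?l i) * norm (?m i))) = (\<Sum>i<n. \<phi> (?l i) * norm (v i))"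
        using nv(1) by (intro sum.cong) auto
      also have "\<dots> = (\<Sum>i<n. \<phi> (?l i) * norm (v' i))" by (rule eqt)
      also have "\<dots> = (\<Sum>i<n. \<phi> (?l i) * ((L' - ?l i) * norm (?m' i)))"
        using v'(2) by (intro sum.cong) (auto simp del: norm_scaleR)
      finally show ?thesis .
    qed
    have tot: "m 0 + sum ?m {..<n} = m' 0 + sum ?m' {..<n}"
      using Suc.prems(3)[of 0] unfolding sum.lessThan_Suc_shift by simp
    have gap': "(\<Sum>i<n. l' 0 - l' (Suc i)) = (\<Sum>i<n. L' - ?l i)"
      using c by (intro sum.cong) (auto simp: L'_def)
    have r: "norm (m 0) + (\<Sum>i<n. norm (?m i)) - (\<Sum>i<n. l 0 - ?l i) =
        norm (m' 0) + (\<Sum>i<n. norm (?m' i)) - (\<Sum>i<n. L' - ?l i)"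
      using Suc.prems(4)[of 0] False unfolding gap_sum_0 sum.lessThan_Suc_shift gap' by simp
    have "L' = l 0"
    proof (rule ccontr)
      assume "L' \<noteq> l 0"
      then consider "l 0 < L'" | "L' < l 0" by linarith
      then show False
      proof cases
        case 1
        have "norm (m' 0) + (\<Sum>i<n. norm (?m' i)) \<le> norm (m 0) + (\<Sum>i<n. norm (?m i))"
          using norm_total_mono[where l = ?l, OF 1 le(1) eqm' eqt' tot] by simp
        with gap_sum_strict[OF 1, of n ?l] False r show False by simp
      next
        case 2
        have "norm (m 0) + (\<Sum>i<n. norm (?m i)) \<le> norm (m' 0) + (\<Sum>i<n. norm (?m' i))"
          using norm_total_mono[where l = ?l, OF 2 le(2) eqm'[symmetric] eqt'[symmetric] tot[symmetric]]
          by simp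
        with gap_sum_strict[OF 2, of n ?l] False r show False by simp
      qed
    qed
    note L' = this
    have "\<phi> (l 0) *\<^sub>R m 0 + (\<Sum>i<n. \<phi> (?l i) *\<^sub>R ?m i) = \<phi> (l 0) *\<^sub>R m' 0 + (\<Sum>i<n. \<phi> (?l i) *\<^sub>R ?m' i)" for \<phi>
      by (rule sums_eq_of_top_eq) (use le eqm' L' tot in auto)
    \<comment> \<open>The norms are real labels in their own right; with the top points equal,
      \<open>r\<close> supplies the equality of their totals.\<close>
    moreover have "norm (m 0) + sum (norm \<circ> ?m) {..<n} = norm (m' 0) + sum (norm \<circ> ?m') {..<n}"
      using r L' by simp
    then have "\<phi> (l 0) *\<^sub>R norm (m 0) + (\<Sum>i<n. \<phi> (?l i) *\<^sub>R (norm \<circ> ?m) i) =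
        \<phi> (l 0) *\<^sub>R norm (m' 0) + (\<Sum>i<n. \<phi> (?l i) *\<^sub>R (norm \<circ> ?m') i)" for \<phi>
      by (intro sums_eq_of_top_eq) (use le eqt' L' in auto)
    ultimately show ?thesis
      using c L' by (intro exI[of _ c]) (auto simp: sum.lessThan_Suc_shift less_Suc_eq_0_disj L'_def simp del: sum.lessThan_Suc)
  qed
qed

text \<open>The sum is recovered from \<open>(a + b)^2 = (a - b)^2 + 4 * a * b\<close>. This
  separates the top weight from the product of the lower weights when their difference and product
  are known.\<close>

lemma nonneg_pair_unique:
  fixes a b a' b' :: real
  assumes "a - b = a' - b'" "a * b = a' * b'" "a \<ge> 0" "b \<ge> 0" "a' \<ge> 0" "b' \<ge> 0"
  shows "a = a'" "b = b'"
proof -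
  have "(a + b)\<^sup>2 = (a' + b')\<^sup>2"
    using arg_cong[OF assms(1), of "\<lambda>x. x\<^sup>2"] assms(2) by (simp add: power2_eq_square algebra_simps)
  then have "a + b = a' + b'" using assms by (simp add: power2_eq_iff_nonneg)
  with assms(1) show "a = a'" "b = b'" by auto
qed

text \<open>The full product and the difference of index 0 determine the top weight and the product
  of the lower weights. The latter is the full product of the configuration without the top point,
  so the induction hypothesis applies. The top position then follows as for labels, with the top
  weight in the role of the total label.\<close>

theorem weighted_configuration_unique:
  fixes l l' w w' :: "nat \<Rightarrow> real"
  assumes "descending n l" "descending n l'"
    and "\<And>i. i < n \<Longrightarrow> w i \<ge> 0" "\<And>i. i < n \<Longrightarrow> w' i \<ge> 0"
    and "n > 0" "(\<Prod>i<n. weight n l w i) = (\<Prod>i<n. weight n l' w' i)"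
    and "\<And>j. Suc j < n \<Longrightarrow>
      (\<Prod>i\<in>{Suc j..<n}. weight n l w i) - weight n l w j =
      (\<Prod>i\<in>{Suc j..<n}. weight n l' w' i) - weight n l' w' j"
    and "\<And>j. Suc j < n \<Longrightarrow>
      (\<Sum>i<n. newton_coeff l j i * w i) - (\<Sum>i\<in>{j..<n}. l j - l i) =
      (\<Sum>i<n. newton_coeff l' j i * w' i) - (\<Sum>i\<in>{j..<n}. l' j - l' i)"
  shows "\<exists>c. (\<forall>i<n. l' i = l i + c) \<and>
    (\<forall>\<phi>. (\<Sum>i<n. \<phi> (l i) * w i) = (\<Sum>i<n. \<phi> (l i) * w' i))"
  using assms
proof (induction n arbitrary: l l' w w')
  case 0
  then show ?case by simp
next
  case (Suc n)
  show ?case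
  proof (cases "n = 0")
    case True
    have "w 0 = w' 0" using Suc.prems(6) True by (simp add: weight_def)
    then show ?thesis using True by (intro exI[of _ "l' 0 - l 0"]) simp
  next
    case False
    define v v' where "v i = (l 0 - l (Suc i)) * w (Suc i)"
      and "v' i = (l' 0 - l' (Suc i)) * w' (Suc i)" for i
    note d = Suc.prems(1,2)
    note top = descending_top[OF d(1)] descending_top[OF d(2)]
    have vnn: "v i \<ge> 0" "v' i \<ge> 0" if "i < n" for i
      using top that Suc.prems(3,4)[of "Suc i"] by (auto simp: v_def v'_def)
    have ws: "weight (Suc n) l w (Suc i) = weight n (l \<circ> Suc) v i"
      "weight (Suc n) l' w' (Suc i) = weight n (l' \<circ> Suc) v' i" if "i < n" for i
      unfolding v_def v'_def by (rule weight_Suc[OF _ that], rule d)+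
    have ps: "(\<Prod>i\<in>{Suc j..<Suc n}. weight (Suc n) l w i) = (\<Prod>i\<in>{j..<n}. weight n (l \<circ> Suc) v i)"
      "(\<Prod>i\<in>{Suc j..<Suc n}. weight (Suc n) l' w' i) = (\<Prod>i\<in>{j..<n}. weight n (l' \<circ> Suc) v' i)" for j
      unfolding prod.shift_bounds_Suc_ivl using ws by (auto intro!: prod.cong)
    have top_eq: "(\<Prod>i<n. weight n (l \<circ> Suc) v i) = (\<Prod>i<n. weight n (l' \<circ> Suc) v' i)"
        "weight (Suc n) l w 0 = weight (Suc n) l' w' 0"
    proof -
      have "(\<Prod>i<n. weight n (l \<circ> Suc) v i) - weight (Suc n) l w 0 =
          (\<Prod>i<n. weight n (l' \<circ> Suc) v' i) - weight (Suc n) l' w' 0"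
        using Suc.prems(7)[of 0] False unfolding ps by (simp add: atLeast0LessThan)
      moreover have "(\<Prod>i<n. weight n (l \<circ> Suc) v i) * weight (Suc n) l w 0 =
          (\<Prod>i<n. weight n (l' \<circ> Suc) v' i) * weight (Suc n) l' w' 0"
        using Suc.prems(6) ws by (simp add: prod.lessThan_Suc_shift mult.commute del: prod.lessThan_Suc)
      moreover have "(\<Prod>i<n. weight n (l \<circ> Suc) v i) \<ge> 0" "weight (Suc n) l w 0 \<ge> 0"
          "(\<Prod>i<n. weight n (l' \<circ> Suc) v' i) \<ge> 0" "weight (Suc n) l' w' 0 \<ge> 0"
        using Suc.prems(3,4)[of 0] vnn by (auto intro!: prod_nonneg weight_nonneg)
      ultimately show "(\<Prod>i<n. weight n (l \<circ> Suc) v i) = (\<Prod>i<n. weight n (l' \<circ> Suc) v' i)"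
        "weight (Suc n) l w 0 = weight (Suc n) l' w' 0"
        using nonneg_pair_unique by blast+
    qed
    have "\<exists>c. (\<forall>i<n. (l' \<circ> Suc) i = (l \<circ> Suc) i + c) \<and>
      (\<forall>\<phi>. (\<Sum>i<n. \<phi> ((l \<circ> Suc) i) * v i) = (\<Sum>i<n. \<phi> ((l \<circ> Suc) i) * v' i))"
    proof (rule Suc.IH)
      fix j assume j: "Suc j < n"
      then show "(\<Prod>i\<in>{Suc j..<n}. weight n (l \<circ> Suc) v i) - weight n (l \<circ> Suc) v j =
          (\<Prod>i\<in>{Suc j..<n}. weight n (l' \<circ> Suc) v' i) - weight n (l' \<circ> Suc) v' j"
        using Suc.prems(7)[of "Suc j"] ws unfolding ps by simp
      show "(\<Sum>i<n. newton_coeff (l \<circ> Suc) j i * v i) -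
            (\<Sum>i\<in>{j..<n}. (l \<circ> Suc) j - (l \<circ> Suc) i) =
          (\<Sum>i<n. newton_coeff (l' \<circ> Suc) j i * v' i) -
            (\<Sum>i\<in>{j..<n}. (l' \<circ> Suc) j - (l' \<circ> Suc) i)"
        using Suc.prems(8)[of "Suc j"] j newton_sum_Suc[of l j w n] newton_sum_Suc[of l' j w' n]
        unfolding gap_sum_Suc by (simp add: v_def v'_def)
    next
      show "descending n (l \<circ> Suc)" "descending n (l' \<circ> Suc)"
        by (rule descending_Suc, rule d)+
    qed (use vnn False top_eq in \<open>auto simp: comp_def\<close>)
    then obtain c where c: "\<And>i. i < n \<Longrightarrow> l' (Suc i) = l (Suc i) + c"
      and eqt: "\<And>\<phi>. (\<Sum>i<n. \<phi> (l (Suc i)) * v i) = (\<Sum>i<n. \<phi> (l (Suc i)) * v' i)"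
      by auto
    define L' where "L' = l' 0 - c"
    let ?l = "\<lambda>i. l (Suc i)" and ?w = "\<lambda>i. w (Suc i)" and ?w' = "\<lambda>i. w' (Suc i)"
    have le: "?l i \<le> l 0" "?l i \<le> L'" if "i < n" for i
      using top[OF that] c[OF that] by (auto simp: L'_def)
    have v': "v' i = (L' - ?l i) * ?w' i" if "i < n" for i
      using that c[OF that] by (auto simp: v'_def L'_def algebra_simps)
    have eqt': "(\<Sum>i<n. \<phi> (?l i) * ((l 0 - ?l i) * ?w i)) =
        (\<Sum>i<n. \<phi> (?l i) * ((L' - ?l i) * ?w' i))" for \<phi>
      using eqt[of \<phi>] v' by (simp add: v_def)
    have gap': "(\<Sum>i<n. l' 0 - l' (Suc i)) = (\<Sum>i<n. L' - ?l i)"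
      using c by (intro sum.cong) (auto simp: L'_def)
    have "(\<Prod>i<n. l' 0 - l' (Suc i)) = (\<Prod>i<n. L' - ?l i)"
      using c by (intro prod.cong) (auto simp: L'_def)
    then have b0: "w 0 * (\<Prod>i<n. l 0 - ?l i) = w' 0 * (\<Prod>i<n. L' - ?l i)"
      using top_eq(2) by (simp add: weight_0 d)
    have r: "w 0 + sum ?w {..<n} - (\<Sum>i<n. l 0 - ?l i) =
        w' 0 + sum ?w' {..<n} - (\<Sum>i<n. L' - ?l i)"
      using Suc.prems(8)[of 0] False unfolding gap_sum_0 sum.lessThan_Suc_shift gap' by simp
    have nn: "\<And>i. i < n \<Longrightarrow> ?w i \<ge> 0" "w 0 \<ge> 0" "\<And>i. i < n \<Longrightarrow> ?w' i \<ge> 0" "w' 0 \<ge> 0"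
      using Suc.prems(3,4) by auto
    have "L' = l 0"
    proof (rule ccontr)
      assume "L' \<noteq> l 0"
      then consider "l 0 < L'" | "L' < l 0" by linarith
      then show False
      proof cases
        case 1
        have "w' 0 + sum ?w' {..<n} \<le> w 0 + sum ?w {..<n}"
          using False by (intro weight_total_mono[where l = ?l, OF 1 le(1) _ nn eqt' b0]) auto
        with gap_sum_strict[OF 1, of n ?l] False r show False by simp
      next
        case 2
        have "w 0 + sum ?w {..<n} \<le> w' 0 + sum ?w' {..<n}"
          using False by (intro weight_total_mono[where l = ?l, OF 2 le(2) _ nn(3,4,1,2) eqt'[symmetric] b0[symmetric]]) auto
        with gap_sum_strict[OF 2, of n ?l] False r show False by simp
      qed
    qed
    note L' = this
    have "\<phi> (l 0) *\<^sub>R w 0 + (\<Sum>i<n. \<phi> (?l i) *\<^sub>R ?w i) = \<phi> (l 0) *\<^sub>R w' 0 + (\<Sum>i<n. \<phi> (?l i) *\<^sub>R ?w' i)" for \<phi>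
      by (rule sums_eq_of_top_eq) (use le eqt' L' r in auto)
    then show ?thesis
      using c L' by (intro exI[of _ c]) (auto simp: sum.lessThan_Suc_shift less_Suc_eq_0_disj L'_def simp del: sum.lessThan_Suc)
  qed
qed

subsection \<open>Surjectivity\<close>

text \<open>The linear bound drives \<open>G\<close> below every value at infinity, so a single
  point with value at least \<open>r\<close> is enough for the intermediate value theorem.\<close>

lemma attains_or_below:
  fixes G :: "real \<Rightarrow> real"
  assumes "continuous_on {a<..} G" "\<And>x. x \<ge> a + 1 \<Longrightarrow> G x \<le> K - (x - a)"
  shows "(\<exists>x>a. G x = r) \<or> (\<forall>x>a. G x < r)"
proof (rule disjCI)
  assume "\<not> (\<forall>x>a. G x < r)"
  then obtain x0 where x0: "x0 > a" "r \<le> G x0" by force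
  \<comment> \<open>Not before \<open>x0\<close>, inside the range of the bound, and so far out that
    \<open>K - (x1 - a) \<le> r\<close>.\<close>
  define x1 where "x1 = max x0 (max (a + 1) (a + K - r))"
  have x1: "x0 \<le> x1" "a + 1 \<le> x1" "a + K - r \<le> x1"
    unfolding x1_def by (meson max.cobounded1 max.cobounded2 order_trans)+
  have "G x1 \<le> r" using assms(2)[OF x1(2)] x1(3) by linarith
  moreover have "continuous_on {x0..x1} G"
    by (rule continuous_on_subset[OF assms(1)]) (use x0 in auto)
  ultimately obtain x where "x0 \<le> x" "G x = r"
    using IVT2'[of G x1 r x0] x0 x1 by blast
  then show "\<exists>x>a. G x = r" using x0 by (intro exI[of _ x]) auto
qed

lemma at_left_endpoint_le:
  fixes G :: "real \<Rightarrow> real"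
  assumes "continuous_on {a..} G" "\<And>x. x > a \<Longrightarrow> G x < r"
  shows "G a \<le> r"
proof (rule tendsto_upperbound)
  show "(G \<longlongrightarrow> G a) (at_right a)"
    using assms(1) by (auto simp: continuous_on_def intro: tendsto_within_subset)
  show "\<forall>\<^sub>F x in at_right a. G x \<le> r"
    unfolding eventually_at_right_field using assms(2) by (intro exI[of _ "a + 1"]) (auto intro: less_imp_le)
qed simp

text \<open>Applied to a simple pole: if \<open>x / e\<close> stays below a constant at small
  distances \<open>e\<close>, the coefficient \<open>x\<close> cannot be positive.\<close>

lemma le_zero_of_le_small:
  fixes x K :: real
  assumes "\<And>e. 0 < e \<Longrightarrow> e \<le> 1 \<Longrightarrow> x \<le> K * e"
  shows "x \<le> 0"
proof (rule ccontr)
  assume "\<not> x \<le> 0"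
  define e where "e = min 1 (x / (\<bar>K\<bar> + 1))"
  have e: "0 < e" "e \<le> 1" "e * (\<bar>K\<bar> + 1) \<le> x"
    using \<open>\<not> x \<le> 0\<close> by (auto simp: e_def pos_le_divide_eq[symmetric])
  have "x \<le> \<bar>K\<bar> * e" using assms[OF e(1,2)] e(1) by (smt (verit) mult_right_mono)
  then show False using e by (simp add: algebra_simps)
qed

text \<open>Two vectors pointing in opposite directions on the line through \<open>m\<close> can
  have sum \<open>m\<close> and any total norm above \<open>norm m\<close>. The vector
  \<open>u\<close> provides the direction when \<open>m = 0\<close>.\<close>

lemma split_with_norm_sum:
  fixes m :: "'h::real_normed_vector"
  assumes H: "subspace H" "u \<in> H" "u \<noteq> 0" "m \<in> H" and t: "norm m \<le> t"
  obtains a b where "a \<in> H" "b \<in> H" "a + b = m" "norm a + norm b = t"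
proof -
  define e where "e = (if m = 0 then (1 / norm u) *\<^sub>R u else (1 / norm m) *\<^sub>R m)"
  have e: "e \<in> H" "norm e = 1" "m = norm m *\<^sub>R e"
    using H by (auto simp: e_def intro: subspace_scale)
  show ?thesis
  proof (rule that)
    show "((t + norm m) / 2) *\<^sub>R e \<in> H" "(- (t - norm m) / 2) *\<^sub>R e \<in> H"
      using H e by (auto intro: subspace_scale)
    show "((t + norm m) / 2) *\<^sub>R e + (- (t - norm m) / 2) *\<^sub>R e = m"
      by (subst (3) e(3)) (simp add: scaleR_add_left[symmetric] field_simps del: scaleR_minus_left)
    show "norm (((t + norm m) / 2) *\<^sub>R e) + norm ((- (t - norm m) / 2) *\<^sub>R e) = t"
      using t e(2) norm_ge_zero[of m] by (simp add: abs_if field_simps del: norm_ge_zero)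
  qed
qed

lemma gap_sum_ge:
  fixes l :: "nat \<Rightarrow> real"
  assumes "n > 0" "\<And>i. i < n \<Longrightarrow> l i \<le> l 0" "l 0 \<le> x"
  shows "x - l 0 \<le> (\<Sum>i<n. x - l i)"
proof (rule member_le_sum)
  fix i assume "i \<in> {..<n} - {0}"
  then show "0 \<le> x - l i" using assms(2)[of i] assms(3) by simp
qed (use assms in auto)

text \<open>\<open>G x\<close> is the value attained when the top point is placed at
  \<open>x > l 0\<close>, where all labels are forced. If it stays below \<open>r\<close>, the
  labels sitting at \<open>l 0\<close> vanish and \<open>G\<close> is continuous up to
  \<open>l 0\<close>; the deficit \<open>r - G (l 0)\<close> is made up by splitting the top label
  between two points that coincide there.\<close>

lemma labelled_top_point_exists:
  fixes l :: "nat \<Rightarrow> real" and m :: "nat \<Rightarrow> 'h::real_normed_vector"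
  assumes n: "n > 0" and le: "\<And>i. i < n \<Longrightarrow> l i \<le> l 0"
    and H: "subspace H" "u \<in> H" "u \<noteq> 0" and m: "\<And>i. i < n \<Longrightarrow> m i \<in> H" and s: "s \<in> H"
  shows "\<exists>L m0 m'. l 0 \<le> L \<and> m0 \<in> H \<and> (\<forall>i<n. m' i \<in> H \<and> (L - l i) *\<^sub>R m' i = m i) \<and>
    m0 + sum m' {..<n} = s \<and> norm m0 + (\<Sum>i<n. norm (m' i)) - (\<Sum>i<n. L - l i) = r"
proof -
  define M where "M x i = (1 / (x - l i)) *\<^sub>R m i" for x i
  define G where "G x = norm (s - sum (M x) {..<n}) + (\<Sum>i<n. norm (M x i)) - (\<Sum>i<n. x - l i)" for x
  have MH: "M x i \<in> H" if "i < n" for x i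
    using m[OF that] H by (auto simp: M_def intro: subspace_scale)
  have sMH: "sum (M x) {..<n} \<in> H" for x
    using H MH by (auto intro: subspace_sum)
  have "(\<exists>x>l 0. G x = r) \<or> (\<forall>x>l 0. G x < r)"
  proof (rule attains_or_below)
    show "continuous_on {l 0<..} G"
      unfolding G_def M_def by (intro continuous_intros) (use le in force)+
    fix x assume x: "x \<ge> l 0 + 1"
    have M1: "norm (M x i) \<le> norm (m i)" if "i < n" for i
    proof -
      have "norm (m i) * 1 \<le> norm (m i) * (x - l i)"
        using le[OF that] x by (intro mult_left_mono) auto
      then show ?thesis using le[OF that] x by (simp add: M_def divide_simps)
    qed
    have "norm (s - sum (M x) {..<n}) \<le> norm s + (\<Sum>i<n. norm (M x i))"
      by (rule order_trans[OF norm_triangle_ineq4]) (simp add: norm_sum)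
    moreover have "(\<Sum>i<n. norm (M x i)) \<le> (\<Sum>i<n. norm (m i))"
      using M1 by (intro sum_mono) auto
    moreover have "x - l 0 \<le> (\<Sum>i<n. x - l i)"
      using n le x by (intro gap_sum_ge) auto
    ultimately show "G x \<le> (norm s + 2 * (\<Sum>i<n. norm (m i))) - (x - l 0)"
      unfolding G_def by linarith
  qed
  then show ?thesis
  proof
    assume "\<exists>x>l 0. G x = r"
    then obtain L where L: "L > l 0" "G L = r" by blast
    have "(L - l i) *\<^sub>R M L i = m i" if "i < n" for i
      using le[OF that] L by (simp add: M_def)
    then show ?thesis
      using L MH sMH H s
      by (intro exI[of _ L] exI[of _ "s - sum (M L) {..<n}"] exI[of _ "M L"])
        (auto simp: G_def intro: subspace_diff)
  next
    assume below: "\<forall>x>l 0. G x < r"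
    \<comment> \<open>Near \<open>l 0\<close> the label \<open>M x i\<close> would have the pole
      \<open>m i / (x - l 0)\<close>, whereas \<open>G x < r\<close> bounds all label norms.\<close>
    have zero: "m i = 0" if i: "i < n" "l i = l 0" for i
    proof -
      have "norm (m i) \<le> 0"
      proof (rule le_zero_of_le_small)
        fix e :: real assume e: "0 < e" "e \<le> 1"
        let ?x = "l 0 + e"
        have "norm (M ?x i) \<le> (\<Sum>i<n. norm (M ?x i))"
          using i by (intro member_le_sum) auto
        also have "\<dots> \<le> G ?x + (\<Sum>i<n. ?x - l i)" by (simp add: G_def)
        also have "\<dots> \<le> r + (\<Sum>i<n. l 0 + 1 - l i)"
          using below e by (intro add_mono sum_mono) (auto intro: less_imp_le)
        finally show "norm (m i) \<le> (r + (\<Sum>i<n. l 0 + 1 - l i)) * e"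
          using i e by (simp add: M_def field_simps)
      qed
      then show ?thesis by simp
    qed
    have "continuous_on {l 0..} (\<lambda>x. M x i)" if "i < n" for i
    proof (cases "l i = l 0")
      case True
      then show ?thesis using zero[OF that] by (simp add: M_def)
    next
      case False
      then show ?thesis
        using le[OF that] unfolding M_def by (intro continuous_intros) force
    qed
    then have "continuous_on {l 0..} G"
      unfolding G_def by (intro continuous_intros) auto
    then have Gr: "G (l 0) \<le> r" using below by (intro at_left_endpoint_le) auto
    define \<mu> where "\<mu> = s - sum (M (l 0)) {..<n}"
    have "\<mu> \<in> H" using H s sMH by (auto simp: \<mu>_def intro: subspace_diff)
    then obtain a b where ab: "a \<in> H" "b \<in> H" "a + b = \<mu>" "norm a + norm b = norm \<mu> + (r - G (l 0))"
      using split_with_norm_sum[OF H, of \<mu> "norm \<mu> + (r - G (l 0))"] Gr by auto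
    \<comment> \<open>The point of index 0 also lies at \<open>l 0\<close>, so any label
      \<open>b\<close> satisfies \<open>(l 0 - l 0) *\<^sub>R b = m 0 = 0\<close>. At the other
      points in this position the convention for division by zero gives the label 0.\<close>
    define m' where "m' = (M (l 0))(0 := b)"
    have M0: "M (l 0) 0 = 0" by (simp add: M_def)
    have 1: "sum m' {..<n} = b + sum (M (l 0)) {..<n}"
      using n by (simp add: sum.remove[of "{..<n}" 0] m'_def M0)
    have 2: "(\<Sum>i<n. norm (m' i)) = norm b + (\<Sum>i<n. norm (M (l 0) i))"
      using n by (simp add: sum.remove[of "{..<n}" 0] m'_def M0)
    have "a + sum m' {..<n} = s" using ab(3) unfolding 1 \<mu>_def by (simp add: algebra_simps)
    moreover have "norm a + (\<Sum>i<n. norm (m' i)) - (\<Sum>i<n. l 0 - l i) = r"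
      using ab(4) unfolding 2 G_def \<mu>_def by simp
    moreover have "(l 0 - l i) *\<^sub>R m' i = m i" "m' i \<in> H" if "i < n" for i
      using zero[OF that] n zero[of 0] MH[OF that] ab by (auto simp: m'_def M_def)
    ultimately show ?thesis
      using ab by (intro exI[of _ "l 0"] exI[of _ a] exI[of _ m']) auto
  qed
qed

text \<open>If \<open>G\<close> stays below \<open>r\<close>, then not only the masses at
  \<open>l 0\<close> but also \<open>b\<close> must vanish, since the product of the gaps tends to 0
  there. With \<open>L = l 0\<close> the equation for \<open>b\<close> then holds for every top
  mass, and \<open>w0 = r - G (l 0)\<close> makes up the deficit.\<close>

lemma weighted_top_point_exists:
  fixes l w :: "nat \<Rightarrow> real"
  assumes n: "n > 0" and le: "\<And>i. i < n \<Longrightarrow> l i \<le> l 0"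
    and w: "\<And>i. i < n \<Longrightarrow> w i \<ge> 0" and b: "b \<ge> 0"
  shows "\<exists>L w0 w'. l 0 \<le> L \<and> w0 \<ge> 0 \<and> (\<forall>i<n. w' i \<ge> 0 \<and> (L - l i) * w' i = w i) \<and>
    w0 * (\<Prod>i<n. L - l i) = b \<and> w0 + sum w' {..<n} - (\<Sum>i<n. L - l i) = r"
proof -
  define V where "V x i = w i / (x - l i)" for x i
  define G where "G x = b / (\<Prod>i<n. x - l i) + sum (V x) {..<n} - (\<Sum>i<n. x - l i)" for x
  have Vnn: "V x i \<ge> 0" if "i < n" "l 0 \<le> x" for x i
    using w[OF that(1)] le[OF that(1)] that(2) by (auto simp: V_def)
  have Pp: "(\<Prod>i<n. x - l i) > 0" if "l 0 < x" for x
    using le that by (intro prod_pos) force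
  have "(\<exists>x>l 0. G x = r) \<or> (\<forall>x>l 0. G x < r)"
  proof (rule attains_or_below)
    show "continuous_on {l 0<..} G"
      unfolding G_def V_def by (intro continuous_intros) (use le in force)+
    fix x assume x: "x \<ge> l 0 + 1"
    have "V x i \<le> w i" if "i < n" for i
    proof -
      have "w i * 1 \<le> w i * (x - l i)"
        using le[OF that] w[OF that] x by (intro mult_left_mono) auto
      then show ?thesis using le[OF that] x by (simp add: V_def divide_simps)
    qed
    then have "sum (V x) {..<n} \<le> sum w {..<n}" by (intro sum_mono) auto
    moreover have "1 \<le> (\<Prod>i<n. x - l i)" using x le by (intro prod_ge_1) force
    then have "b / (\<Prod>i<n. x - l i) \<le> b" using b by (simp add: divide_le_eq mult_le_cancel_left1)
    moreover have "x - l 0 \<le> (\<Sum>i<n. x - l i)"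
      using n le x by (intro gap_sum_ge) auto
    ultimately show "G x \<le> (b + sum w {..<n}) - (x - l 0)"
      unfolding G_def by linarith
  qed
  then show ?thesis
  proof
    assume "\<exists>x>l 0. G x = r"
    then obtain L where L: "L > l 0" "G L = r" by blast
    have "(L - l i) * V L i = w i" if "i < n" for i
      using le[OF that] L by (simp add: V_def)
    moreover have P1: "b / (\<Prod>i<n. L - l i) * (\<Prod>i<n. L - l i) = b"
      using Pp[OF L(1)] by (intro nonzero_eq_divide_eq[THEN iffD1] refl less_imp_neq[symmetric])
    ultimately show ?thesis
      using L Vnn Pp[OF L(1)] b P1
      by (rule_tac exI[of _ L], rule_tac exI[of _ "b / (\<Prod>i<n. L - l i)"], rule_tac exI[of _ "V L"])
        (simp add: G_def del: prod_zero_iff)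
  next
    assume below: "\<forall>x>l 0. G x < r"
    \<comment> \<open>Adding the gap sum at distance 1 above \<open>l 0\<close> to \<open>r\<close>
      gives a bound for the masses alone.\<close>
    define K where "K = r + (\<Sum>i<n. l 0 + 1 - l i)"
    have Kb: "b / (\<Prod>i<n. l 0 + e - l i) + sum (V (l 0 + e)) {..<n} \<le> K" if e: "0 < e" "e \<le> 1" for e
    proof -
      have "b / (\<Prod>i<n. l 0 + e - l i) + sum (V (l 0 + e)) {..<n} = G (l 0 + e) + (\<Sum>i<n. l 0 + e - l i)"
        by (simp add: G_def)
      also have "\<dots> \<le> K"
        unfolding K_def using below e by (intro add_mono sum_mono) (auto intro: less_imp_le)
      finally show ?thesis .
    qed
    have zero: "w i = 0" if i: "i < n" "l i = l 0" for i
    proof -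
      have "w i \<le> 0"
      proof (rule le_zero_of_le_small)
        fix e :: real assume e: "0 < e" "e \<le> 1"
        have "V (l 0 + e) i \<le> sum (V (l 0 + e)) {..<n}"
          using i e Vnn by (intro member_le_sum) auto
        also have "\<dots> \<le> K" using Kb[OF e] b Pp[of "l 0 + e"] e
          by (smt (verit) divide_nonneg_pos)
        finally show "w i \<le> K * e"
          using i e by (simp add: V_def field_simps)
      qed
      then show ?thesis using w[OF i(1)] by simp
    qed
    have b0: "b = 0"
    proof -
      \<comment> \<open>An upper bound for the product of the gaps of nonzero index; the gap of
        index 0 is \<open>e\<close>.\<close>
      define C where "C = (\<Prod>i\<in>{..<n} - {0}. l 0 + 1 - l i)"
      have "b \<le> 0"
      proof (rule le_zero_of_le_small)
        fix e :: real assume e: "0 < e" "e \<le> 1"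
        have "(\<Prod>i<n. l 0 + e - l i) = e * (\<Prod>i\<in>{..<n} - {0}. l 0 + e - l i)"
          using n by (subst prod.remove[of _ 0]) auto
        also have "\<dots> \<le> e * C"
          unfolding C_def using e le by (intro mult_left_mono prod_mono) force+
        finally have P: "(\<Prod>i<n. l 0 + e - l i) \<le> e * C" .
        have "sum (V (l 0 + e)) {..<n} \<ge> 0" using Vnn e by (intro sum_nonneg) auto
        then have bK: "b / (\<Prod>i<n. l 0 + e - l i) \<le> K" using Kb[OF e] by linarith
        have pp: "(\<Prod>i<n. l 0 + e - l i) > 0" using Pp e by simp
        have K: "K \<ge> 0" using bK b pp by (smt (verit) divide_nonneg_pos)
        have "b \<le> K * (\<Prod>i<n. l 0 + e - l i)" using bK pp by (simp add: pos_divide_le_eq)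
        also have "\<dots> \<le> K * (e * C)" using P K by (intro mult_left_mono)
        finally show "b \<le> (K * C) * e" by (simp add: algebra_simps)
      qed
      then show ?thesis using b by simp
    qed
    have "continuous_on {l 0..} (\<lambda>x. V x i)" if "i < n" for i
    proof (cases "l i = l 0")
      case True
      then show ?thesis using zero[OF that] by (simp add: V_def)
    next
      case False
      then show ?thesis
        using le[OF that] unfolding V_def by (intro continuous_intros) force
    qed
    then have "continuous_on {l 0..} G"
      unfolding G_def b0 by (simp, intro continuous_intros) auto
    then have Gr: "G (l 0) \<le> r" using below by (intro at_left_endpoint_le) auto
    have "(\<Prod>i<n. l 0 - l i) = 0" using n by (auto intro!: prod_zero)
    moreover have "(l 0 - l i) * V (l 0) i = w i" if "i < n" for i
      using zero[OF that] by (auto simp: V_def)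
    ultimately show ?thesis
      using Gr b0 Vnn
      by (rule_tac exI[of _ "l 0"], rule_tac exI[of _ "r - G (l 0)"], rule_tac exI[of _ "V (l 0)"])
        (auto simp: G_def)
  qed
qed

lemma descending_case_nat:
  assumes "descending n l" "n > 0 \<Longrightarrow> l 0 \<le> L"
  shows "descending (Suc n) (case_nat L l)"
  unfolding descending_def
proof (intro allI impI)
  fix i j assume ij: "i < j" "j < Suc n"
  then obtain j' where j': "j = Suc j'" "j' < n" by (cases j) auto
  have "l j' \<le> l 0" using assms(1) j' by (cases j') (auto simp: descending_def)
  then show "case_nat L l j \<le> case_nat L l i"
    using ij j' assms by (cases i) (auto simp: descending_def)
qed

text \<open>Points are added from the lowest upwards. The data of index at least 1 are realized by
  the lower points; their labels are then rescaled to fit a new top point, whose position is chosen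
  according to the data of index 0. A single point carries no trace condition.\<close>

theorem labelled_configuration_exists:
  fixes s :: "nat \<Rightarrow> 'h::real_normed_vector" and r :: "nat \<Rightarrow> real"
  assumes "n > 0" "\<And>j. s j \<in> H"
    and H: "subspace H" "u \<in> H" "u \<noteq> 0"
  shows "\<exists>l m. descending n l \<and> (\<forall>i<n. m i \<in> H) \<and>
    (\<forall>j<n. (\<Sum>i<n. newton_coeff l j i *\<^sub>R m i) = s j) \<and>
    (\<forall>j. Suc j < n \<longrightarrow> (\<Sum>i<n. newton_coeff l j i * norm (m i)) - (\<Sum>i\<in>{j..<n}. l j - l i) = r j)"
  using assms(1,2)
proof (induction n arbitrary: s r rule: nat_induct_non_zero)
  case 1
  then show ?case
    by (rule_tac exI[of _ "\<lambda>_. 0"], rule_tac exI[of _ "\<lambda>_. s 0"]) (auto simp: descending_def)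
next
  case (Suc n)
  obtain l m where l: "descending n l" and m: "\<And>i. i < n \<Longrightarrow> m i \<in> H"
    and sm: "\<And>j. j < n \<Longrightarrow> (\<Sum>i<n. newton_coeff l j i *\<^sub>R m i) = s (Suc j)"
    and rm: "\<And>j. Suc j < n \<Longrightarrow>
      (\<Sum>i<n. newton_coeff l j i * norm (m i)) - (\<Sum>i\<in>{j..<n}. l j - l i) = r (Suc j)"
    using Suc.IH[of "s \<circ> Suc" "r \<circ> Suc"] Suc.prems by auto
  have le: "l i \<le> l 0" if "i < n" for i
    using l that by (cases i) (auto simp: descending_def)
  obtain L m0 m' where L: "l 0 \<le> L" and m0: "m0 \<in> H" and m'H: "\<And>i. i < n \<Longrightarrow> m' i \<in> H"
    and m': "\<And>i. i < n \<Longrightarrow> (L - l i) *\<^sub>R m' i = m i"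
    and s0: "m0 + sum m' {..<n} = s 0"
    and r0: "norm m0 + (\<Sum>i<n. norm (m' i)) - (\<Sum>i<n. L - l i) = r 0"
    using labelled_top_point_exists[of n l H u m "s 0" "r 0", OF Suc.hyps le H m] Suc.prems by blast
  let ?l = "case_nat L l" and ?m = "case_nat m0 m'"
  have d: "descending (Suc n) ?l" using l L by (intro descending_case_nat)
  have comp: "?l \<circ> Suc = l" by auto
  have "(\<Sum>i<Suc n. newton_coeff ?l j i *\<^sub>R ?m i) = s j" if "j < Suc n" for j
  proof (cases j)
    case 0
    then show ?thesis using s0 by (simp add: sum.lessThan_Suc_shift del: sum.lessThan_Suc)
  next
    case (Suc k)
    then show ?thesis
      using sm[of k] that m' unfolding Suc newton_sum_Suc comp by simp
  qed
  moreover have "(\<Sum>i<Suc n. newton_coeff ?l j i * norm (?m i)) - (\<Sum>i\<in>{j..<Suc n}. ?l j - ?l i) = r j"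
    if "Suc j < Suc n" for j
  proof (cases j)
    case 0
    show ?thesis
      unfolding 0 gap_sum_0 sum.lessThan_Suc_shift using r0 by simp
  next
    case (Suc k)
    then show ?thesis
      using rm[of k] that m' unfolding Suc newton_norm_sum_Suc[OF d] comp gap_sum_Suc by simp
  qed
  ultimately show ?case
    using d m0 m'H by (rule_tac exI[of _ ?l], rule_tac exI[of _ ?m]) (auto split: nat.split)
qed

text \<open>The full product \<open>d\<close> and the difference \<open>e 0\<close> fix the top
  weight and the product of the lower weights. The latter is again nonnegative and serves as the
  full product in the induction.\<close>

theorem weighted_configuration_exists:
  fixes e r :: "nat \<Rightarrow> real"
  assumes "n > 0" "d \<ge> 0"
  shows "\<exists>l w. descending n l \<and> (\<forall>i<n. w i \<ge> 0) \<and> (\<Prod>i<n. weight n l w i) = d \<and>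
    (\<forall>j. Suc j < n \<longrightarrow> (\<Prod>i\<in>{Suc j..<n}. weight n l w i) - weight n l w j = e j) \<and>
    (\<forall>j. Suc j < n \<longrightarrow> (\<Sum>i<n. newton_coeff l j i * w i) - (\<Sum>i\<in>{j..<n}. l j - l i) = r j)"
  using assms
proof (induction n arbitrary: d e r rule: nat_induct_non_zero)
  case 1
  then show ?case
    by (rule_tac exI[of _ "\<lambda>_. 0"], rule_tac exI[of _ "\<lambda>_. d"]) (auto simp: descending_def weight_def)
next
  case (Suc n)
  \<comment> \<open>The sum of the two nonnegative numbers with difference \<open>e 0\<close> and
    product \<open>d\<close>.\<close>
  define D where "D = sqrt ((e 0)\<^sup>2 + 4 * d)"
  have "\<bar>e 0\<bar> \<le> D" unfolding D_def using Suc.prems by (intro real_le_rsqrt) auto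
  then have ab: "(D + e 0) / 2 \<ge> 0" "(D - e 0) / 2 \<ge> 0" by auto
  have "D\<^sup>2 = (e 0)\<^sup>2 + 4 * d" using Suc.prems by (simp add: D_def)
  then have abd: "((D - e 0) / 2) * ((D + e 0) / 2) = d"
    by (simp add: power2_eq_square field_simps)
  obtain l w where l: "descending n l" and w: "\<And>i. i < n \<Longrightarrow> w i \<ge> 0"
    and dw: "(\<Prod>i<n. weight n l w i) = (D + e 0) / 2"
    and ew: "\<And>j. Suc j < n \<Longrightarrow> (\<Prod>i\<in>{Suc j..<n}. weight n l w i) - weight n l w j = e (Suc j)"
    and rw: "\<And>j. Suc j < n \<Longrightarrow>
      (\<Sum>i<n. newton_coeff l j i * w i) - (\<Sum>i\<in>{j..<n}. l j - l i) = r (Suc j)"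
    using Suc.IH[of "(D + e 0) / 2" "e \<circ> Suc" "r \<circ> Suc"] ab by auto
  have le: "l i \<le> l 0" if "i < n" for i
    using l that by (cases i) (auto simp: descending_def)
  obtain L w0 w' where L: "l 0 \<le> L" and w0: "w0 \<ge> 0" and w'nn: "\<And>i. i < n \<Longrightarrow> w' i \<ge> 0"
    and w': "\<And>i. i < n \<Longrightarrow> (L - l i) * w' i = w i"
    and b0: "w0 * (\<Prod>i<n. L - l i) = (D - e 0) / 2"
    and r0: "w0 + sum w' {..<n} - (\<Sum>i<n. L - l i) = r 0"
    using weighted_top_point_exists[of n l w "(D - e 0) / 2" "r 0", OF Suc.hyps le w ab(2)] by blast
  let ?l = "case_nat L l" and ?w = "case_nat w0 w'"
  have d: "descending (Suc n) ?l" using l L by (intro descending_case_nat)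
  have comp: "?l \<circ> Suc = l" by auto
  have ws: "weight (Suc n) ?l ?w (Suc i) = weight n l w i" if "i < n" for i
  proof -
    have "weight (Suc n) ?l ?w (Suc i) = weight n l (\<lambda>i. (L - l i) * w' i) i"
      using weight_Suc[OF d that, of ?w] comp by simp
    also have "\<dots> = weight n l w i" using w'[OF that] by (simp add: weight_def)
    finally show ?thesis .
  qed
  have w00: "weight (Suc n) ?l ?w 0 = (D - e 0) / 2"
    using b0 by (simp add: weight_0[OF d])
  have ps: "(\<Prod>i\<in>{Suc j..<Suc n}. weight (Suc n) ?l ?w i) = (\<Prod>i\<in>{j..<n}. weight n l w i)" for j
    unfolding prod.shift_bounds_Suc_ivl using ws by (auto intro!: prod.cong)
  have "(\<Prod>i<Suc n. weight (Suc n) ?l ?w i) = d"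
    unfolding prod.lessThan_Suc_shift w00 abd[symmetric] dw[symmetric] using ws by simp
  moreover have "(\<Prod>i\<in>{Suc j..<Suc n}. weight (Suc n) ?l ?w i) - weight (Suc n) ?l ?w j = e j"
    if "Suc j < Suc n" for j
  proof (cases j)
    case 0
    then show ?thesis unfolding ps 0 w00 atLeast0LessThan dw by (simp add: field_simps)
  next
    case (Suc k)
    then show ?thesis using ew[of k] that ws[of k] unfolding ps by simp
  qed
  moreover have "(\<Sum>i<Suc n. newton_coeff ?l j i * ?w i) - (\<Sum>i\<in>{j..<Suc n}. ?l j - ?l i) = r j"
    if "Suc j < Suc n" for j
  proof (cases j)
    case 0
    show ?thesis
      unfolding 0 gap_sum_0 sum.lessThan_Suc_shift using r0 by simp
  next
    case (Suc k)
    then show ?thesis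
      using rw[of k] that w' newton_sum_Suc[of ?l k ?w n] unfolding Suc comp gap_sum_Suc by simp
  qed
  moreover have wnn: "?w i \<ge> 0" if "i < Suc n" for i
    using w0 w'nn that by (cases i) auto
  ultimately show ?case
    using d wnn by (rule_tac exI[of _ ?l], rule_tac exI[of _ ?w]) blast
qed

section \<open>Real and imaginary parts over the ground field\<close>

text \<open>The value 0 in the real case lets the decomposition into real and imaginary parts be
  written uniformly, and the test \<open>imag_unit = 0\<close> distinguishes the two fields.\<close>

definition imag_unit :: "'a::real_or_complex" where
  "imag_unit = (if \<exists>i::'a. i * i = - 1 \<and> (\<forall>z. \<exists>x y. z = x *\<^sub>R 1 + y *\<^sub>R i) \<and>
          (\<forall>x y. cconj (x *\<^sub>R 1 + y *\<^sub>R i) = x *\<^sub>R 1 - y *\<^sub>R i)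
    then SOME i. i * i = - 1 \<and> (\<forall>z. \<exists>x y. z = x *\<^sub>R 1 + y *\<^sub>R i) \<and>
          (\<forall>x y. cconj (x *\<^sub>R 1 + y *\<^sub>R i) = x *\<^sub>R 1 - y *\<^sub>R i) else 0)"

lemma imag_unit_cases:
  obtains (real) "imag_unit = (0::'a::real_or_complex)" "\<And>z::'a. \<exists>x. z = of_real x" "\<And>z::'a. cconj z = z"
  | (complex) "imag_unit * imag_unit = (- 1::'a)" "\<And>z::'a. \<exists>x y. z = of_real x + of_real y * imag_unit"
      "\<And>x y. cconj (of_real x + of_real y * imag_unit :: 'a) = of_real x - of_real y * imag_unit"
proof (cases "\<exists>i::'a. i * i = - 1 \<and> (\<forall>z. \<exists>x y. z = x *\<^sub>R 1 + y *\<^sub>R i) \<and>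
          (\<forall>x y. cconj (x *\<^sub>R 1 + y *\<^sub>R i) = x *\<^sub>R 1 - y *\<^sub>R i)")
  case True
  from someI_ex[OF True] True show ?thesis
    by (intro complex) (simp_all add: imag_unit_def scaleR_conv_of_real)
next
  case False
  then have "\<forall>z::'a. (\<exists>x. z = x *\<^sub>R 1) \<and> cconj z = z"
    using real_or_complex[where ?'a = 'a] by blast
  with False show ?thesis
    by (intro real) (auto simp: imag_unit_def scaleR_conv_of_real)
qed

lemma imag_unit_square: "imag_unit * imag_unit = (if imag_unit = (0::'a::real_or_complex) then 0 else - 1 :: 'a)"
  by (rule imag_unit_cases[where ?'a = 'a]) auto

text \<open>In the complex case, squaring \<open>x - x' = (y' - y) * imag_unit\<close> gives a
  vanishing sum of two real squares.\<close>

lemma real_imag_decomposition_unique: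
  assumes "of_real x + of_real y * imag_unit = (of_real x' + of_real y' * imag_unit :: 'a::real_or_complex)"
  shows "x = x'" "imag_unit \<noteq> (0::'a) \<Longrightarrow> y = y'"
proof -
  have eq: "of_real (x - x') = (of_real (y' - y) * imag_unit :: 'a)"
    using assms by (simp add: algebra_simps)
  have sq: "of_real ((x - x')\<^sup>2) = (of_real ((y' - y)\<^sup>2) * (imag_unit * imag_unit) :: 'a)"
    using arg_cong2[OF eq eq, of "(*)"] by (simp add: power2_eq_square mult_ac del: of_real_diff)
  show "x = x'"
  proof (cases "imag_unit = (0::'a)")
    case True
    then show ?thesis using eq by simp
  next
    case False
    then have "of_real ((x - x')\<^sup>2 + (y' - y)\<^sup>2) = (0::'a)" using sq by (simp add: imag_unit_square)
    then have "(x - x')\<^sup>2 + (y' - y)\<^sup>2 = 0" using of_real_eq_0_iff by blast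
    then show ?thesis by (simp add: sum_power2_eq_zero_iff)
  qed
  then show "y = y'" if "imag_unit \<noteq> (0::'a)" using eq that by auto
qed

definition fre :: "'a::real_or_complex \<Rightarrow> real" where
  "fre z = (THE x. \<exists>y. z = of_real x + of_real y * imag_unit)"

text \<open>Over the reals \<open>imag_unit = 0\<close> leaves the coefficient undetermined; it is
  set to 0.\<close>

definition fim :: "'a::real_or_complex \<Rightarrow> real" where
  "fim z = (THE y. (imag_unit = (0::'a) \<longrightarrow> y = 0) \<and> (\<exists>x. z = of_real x + of_real y * imag_unit))"

lemma fre_unique: "fre (of_real x + of_real y * imag_unit) = x"
  unfolding fre_def by (rule the_equality) (auto dest: real_imag_decomposition_unique)

lemma fim_unique:
  assumes "imag_unit = (0::'a::real_or_complex) \<Longrightarrow> y = 0"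
  shows "fim (of_real x + of_real y * imag_unit :: 'a) = y"
  unfolding fim_def
proof (rule the_equality)
  fix y' assume *: "(imag_unit = (0::'a) \<longrightarrow> y' = 0) \<and>
    (\<exists>x'. of_real x + of_real y * imag_unit = (of_real x' + of_real y' * imag_unit :: 'a))"
  then show "y' = y"
    using assms by (cases "imag_unit = (0::'a)") (auto dest: real_imag_decomposition_unique(2))
qed (use assms in auto)

lemma real_imag_decomposition: "z = of_real (fre z) + of_real (fim z) * (imag_unit::'a::real_or_complex)"
proof -
  obtain x y where "z = of_real x + of_real y * (imag_unit::'a)" "imag_unit = (0::'a) \<Longrightarrow> y = 0"
  proof (rule imag_unit_cases[where ?'a = 'a])
    assume "imag_unit = (0::'a)" "\<And>z::'a. \<exists>x. z = of_real x"
    then show ?thesis using that[of _ 0] by fastforce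
  next
    assume "imag_unit * imag_unit = (- 1::'a)" "\<And>z::'a. \<exists>x y. z = of_real x + of_real y * imag_unit"
    then show ?thesis using that by (metis mult_zero_left neg_equal_0_iff_equal zero_neq_one)
  qed
  then show ?thesis using fre_unique fim_unique by metis
qed

lemma fim_eq_0_if_real: "imag_unit = (0::'a) \<Longrightarrow> fim (z::'a::real_or_complex) = 0"
  using fim_unique[of 0 "fre z", where ?'a = 'a] real_imag_decomposition[of z] by simp

lemma field_eqI: "fre z = fre w \<Longrightarrow> fim z = fim w \<Longrightarrow> z = w" for z w :: "'a::real_or_complex"
  using real_imag_decomposition by metis

lemma fre_fim_add [simp]:
  fixes z w :: "'a::real_or_complex"
  shows "fre (z + w) = fre z + fre w" "fim (z + w) = fim z + fim w"
proof -
  have eq: "z + w = of_real (fre z + fre w) + of_real (fim z + fim w) * imag_unit"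
    by (subst (1) real_imag_decomposition[of z], subst (1) real_imag_decomposition[of w]) (simp add: algebra_simps)
  show "fre (z + w) = fre z + fre w" "fim (z + w) = fim z + fim w"
    unfolding eq by (rule fre_unique, rule fim_unique) (simp add: fim_eq_0_if_real)
qed

text \<open>The formulas of complex multiplication are valid over both fields because imaginary
  parts vanish in the real case.\<close>

lemma fre_fim_mult [simp]:
  fixes z w :: "'a::real_or_complex"
  shows "fre (z * w) = fre z * fre w - fim z * fim w" "fim (z * w) = fre z * fim w + fim z * fre w"
proof -
  have "z * w = of_real (fre z * fre w) + of_real (fim z * fim w) * (imag_unit * imag_unit)
      + of_real (fre z * fim w + fim z * fre w) * imag_unit"
    by (subst (1) real_imag_decomposition[of z], subst (1) real_imag_decomposition[of w]) (simp add: algebra_simps)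
  also have "of_real (fim z * fim w) * (imag_unit * imag_unit) = (- of_real (fim z * fim w) :: 'a)"
    by (simp add: imag_unit_square fim_eq_0_if_real)
  finally have eq: "z * w = of_real (fre z * fre w - fim z * fim w) + of_real (fre z * fim w + fim z * fre w) * imag_unit"
    by (simp add: algebra_simps)
  show "fre (z * w) = fre z * fre w - fim z * fim w" "fim (z * w) = fre z * fim w + fim z * fre w"
    unfolding eq by (rule fre_unique, rule fim_unique) (simp add: fim_eq_0_if_real)
qed

lemma fre_fim_of_real [simp]:
  "fre (of_real x :: 'a::real_or_complex) = x" "fim (of_real x :: 'a) = 0"
  using fre_unique[of x 0, where ?'a = 'a] fim_unique[of 0 x, where ?'a = 'a] by auto

lemma fre_fim_0 [simp]: "fre 0 = 0" "fim 0 = 0"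
  using fre_fim_of_real[of 0] by auto

lemma fre_fim_1 [simp]: "fre 1 = 1" "fim 1 = 0"
  using fre_fim_of_real[of 1] by auto

lemma fre_fim_uminus [simp]: "fre (- z) = - fre z" "fim (- z) = - fim z"
  using fre_fim_add[of z "- z"] by simp_all

lemma fre_fim_diff [simp]: "fre (z - w) = fre z - fre w" "fim (z - w) = fim z - fim w"
  using fre_fim_add[of z "- w"] by simp_all

lemma fre_fim_sum [simp]: "fre (sum f A) = (\<Sum>x\<in>A. fre (f x))" "fim (sum f A) = (\<Sum>x\<in>A. fim (f x))"
  by (induction A rule: infinite_finite_induct) simp_all

lemma fre_fim_cconj [simp]: "fre (cconj z) = fre z" "fim (cconj z) = - fim z"
proof -
  have eq: "cconj z = of_real (fre z) + of_real (- fim z) * imag_unit"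
  proof (rule imag_unit_cases[where ?'a = 'a])
    assume "imag_unit = (0::'a)" "\<And>z::'a. cconj z = z"
    then show ?thesis using real_imag_decomposition[of z] by simp
  next
    assume "\<And>x y. cconj (of_real x + of_real y * imag_unit :: 'a) = of_real x - of_real y * imag_unit"
    then have "cconj (of_real (fre z) + of_real (fim z) * imag_unit :: 'a) = of_real (fre z) - of_real (fim z) * imag_unit"
      by blast
    then show ?thesis unfolding real_imag_decomposition[of z, symmetric] by simp
  qed
  show "fre (cconj z) = fre z" "fim (cconj z) = - fim z"
    unfolding eq by (rule fre_unique, rule fim_unique) (simp add: fim_eq_0_if_real)
qed

lemma cconj_simps [simp]:
  "cconj (z + w) = cconj z + cconj w" "cconj (z * w) = cconj z * cconj w" "cconj (- z) = - cconj z"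
  "cconj (z - w) = cconj z - cconj w" "cconj (cconj z) = z" "cconj (of_real x) = of_real x"
  "cconj 0 = 0" "cconj 1 = 1"
  by (rule field_eqI; simp add: algebra_simps)+

lemma cconj_sum [simp]: "cconj (sum f A) = (\<Sum>x\<in>A. cconj (f x))"
  by (rule field_eqI) (simp_all add: sum_negf)

lemma cconj_eq_0_iff [simp]: "cconj z = 0 \<longleftrightarrow> z = 0"
  by (metis cconj_simps(5) cconj_simps(7))

definition sqnorm :: "'a::real_or_complex \<Rightarrow> real" where
  "sqnorm z = (fre z)\<^sup>2 + (fim z)\<^sup>2"

lemma mult_cconj: "z * cconj z = of_real (sqnorm z)"
  by (rule field_eqI) (simp_all add: sqnorm_def power2_eq_square)

lemma sqnorm_nonneg [simp]: "sqnorm z \<ge> 0"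
  by (simp add: sqnorm_def)

lemma sqnorm_eq_0_iff [simp]: "sqnorm z = 0 \<longleftrightarrow> z = 0"
  by (auto simp: sqnorm_def sum_power2_eq_zero_iff intro: field_eqI)

lemma sqnorm_mult: "sqnorm (z * w) = sqnorm z * sqnorm w"
  by (simp add: sqnorm_def power2_eq_square algebra_simps)

lemma sqnorm_of_real [simp]: "sqnorm (of_real x) = x\<^sup>2"
  by (simp add: sqnorm_def)

lemma sqnorm_1 [simp]: "sqnorm 1 = 1" and sqnorm_0 [simp]: "sqnorm 0 = 0"
  by (simp_all add: sqnorm_def)

lemma sqnorm_cconj [simp]: "sqnorm (cconj z) = sqnorm z"
  by (simp add: sqnorm_def)

lemma sqnorm_prod: "sqnorm (prod f A) = (\<Prod>x\<in>A. sqnorm (f x))"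
  by (induction A rule: infinite_finite_induct) (simp_all add: sqnorm_mult)

section \<open>Algebras of real-valued functions\<close>

text \<open>\<open>Q\<close> stands for continuity or for being a polynomial function. Expressions
  in matrix entries and eigenvalues are thus analysed once for both properties.\<close>

locale function_algebra =
  fixes Q :: "('x \<Rightarrow> real) \<Rightarrow> bool"
  assumes const: "Q (\<lambda>x. c)"
    and add: "Q f \<Longrightarrow> Q g \<Longrightarrow> Q (\<lambda>x. f x + g x)"
    and mult: "Q f \<Longrightarrow> Q g \<Longrightarrow> Q (\<lambda>x. f x * g x)"
begin

lemma uminus: "Q f \<Longrightarrow> Q (\<lambda>x. - f x)"
  using mult[OF const[of "- 1"]] by simp

lemma diff: "Q f \<Longrightarrow> Q g \<Longrightarrow> Q (\<lambda>x. f x - g x)"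
  using add[OF _ uminus] by simp

lemma sum: "(\<And>i. i \<in> I \<Longrightarrow> Q (f i)) \<Longrightarrow> Q (\<lambda>x. \<Sum>i\<in>I. f i x)"
  by (induction I rule: infinite_finite_induct) (simp_all add: const add)

lemma prod: "(\<And>i. i \<in> I \<Longrightarrow> Q (f i)) \<Longrightarrow> Q (\<lambda>x. \<Prod>i\<in>I. f i x)"
  by (induction I rule: infinite_finite_induct) (simp_all add: const mult)

lemma power: "Q f \<Longrightarrow> Q (\<lambda>x. f x ^ k)"
  by (induction k) (simp_all add: const mult)

definition QF :: "('x \<Rightarrow> 'f::real_or_complex) \<Rightarrow> bool" where
  "QF f \<longleftrightarrow> Q (\<lambda>x. fre (f x)) \<and> Q (\<lambda>x. fim (f x))"

lemma QF_const: "QF (\<lambda>x. c)" and QF_add: "QF f \<Longrightarrow> QF g \<Longrightarrow> QF (\<lambda>x. f x + g x)"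
  and QF_mult: "QF f \<Longrightarrow> QF g \<Longrightarrow> QF (\<lambda>x. f x * g x)"
  and QF_diff: "QF f \<Longrightarrow> QF g \<Longrightarrow> QF (\<lambda>x. f x - g x)"
  and QF_cconj: "QF f \<Longrightarrow> QF (\<lambda>x. cconj (f x))"
  and QF_of_real: "Q h \<Longrightarrow> QF (\<lambda>x. of_real (h x))"
  by (auto simp: QF_def intro!: const add mult diff uminus)

lemma QF_sum: "(\<And>i. i \<in> I \<Longrightarrow> QF (f i)) \<Longrightarrow> QF (\<lambda>x. \<Sum>i\<in>I. f i x)"
  by (auto simp: QF_def intro!: sum)

lemma QF_prod: "(\<And>i. i \<in> I \<Longrightarrow> QF (f i)) \<Longrightarrow> QF (\<lambda>x. \<Prod>i\<in>I. f i x)"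
  by (induction I rule: infinite_finite_induct) (simp_all add: QF_const QF_mult)

end

lemma function_algebra_continuous_on: "function_algebra (continuous_on S)"
  by unfold_locales (auto intro: continuous_intros)

section \<open>Operators on inner product spaces\<close>

primrec newton_op :: "('f::real_or_complex \<Rightarrow> 'w::ab_group_add \<Rightarrow> 'w) \<Rightarrow> (nat \<Rightarrow> real) \<Rightarrow> ('w \<Rightarrow> 'w) \<Rightarrow> nat \<Rightarrow> 'w \<Rightarrow> 'w" where
  "newton_op smul l A 0 x = x"
| "newton_op smul l A (Suc j) x = smul (of_real (l j)) (newton_op smul l A j x) - A (newton_op smul l A j x)"

context inner_product_space
begin

lemma ip_add_right: "ip x (y + z) = ip x y + ip x z"
  using ip_add[of y z x] ip_conj by (metis cconj_simps(1))

lemma ip_scale_right: "ip x (smul a y) = cconj a * ip x y"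
  using ip_scale[of a y x] ip_conj by (metis cconj_simps(2))

lemma ip_zero [simp]: "ip 0 x = 0" "ip x 0 = 0"
  using ip_scale[of 0 0 x] ip_scale_right[of x 0 0] by simp_all

lemma ip_uminus [simp]: "ip (- x) y = - ip x y" "ip x (- y) = - ip x y"
  using ip_scale[of "- 1" x y] ip_scale_right[of x "- 1" y] by simp_all

lemma ip_diff: "ip (x - y) z = ip x z - ip y z"
  using ip_add[of x "- y" z] by simp

lemma ip_diff_right: "ip x (y - z) = ip x y - ip x z"
  using ip_add_right[of x y "- z"] by simp

lemma ip_sum: "ip (sum f I) x = (\<Sum>i\<in>I. ip (f i) x)"
  by (induction I rule: infinite_finite_induct) (simp_all add: ip_add)

lemma ip_sum_right: "ip x (sum f I) = (\<Sum>i\<in>I. ip x (f i))"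
  by (induction I rule: infinite_finite_induct) (simp_all add: ip_add_right)

lemmas ip_simps = ip_add ip_add_right ip_scale ip_scale_right ip_diff ip_diff_right

definition normsq :: "'w \<Rightarrow> real" where
  "normsq x = fre (ip x x)"

lemma ip_self: "ip x x = of_real (normsq x)"
  using ip_pos[of x] by (cases "x = 0") (auto simp: normsq_def)

lemma normsq_pos: "x \<noteq> 0 \<Longrightarrow> normsq x > 0"
  using ip_pos[of x] by (auto simp: normsq_def)

lemma normsq_0 [simp]: "normsq 0 = 0"
  by (simp add: normsq_def)

lemma normsq_nonneg [simp]: "normsq x \<ge> 0"
  using normsq_pos[of x] by (cases "x = 0") auto

lemma normsq_eq_0_iff [simp]: "normsq x = 0 \<longleftrightarrow> x = 0"
  using normsq_pos[of x] by (cases "x = 0") auto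

lemma normsq_scale: "normsq (smul (of_real s) x) = s\<^sup>2 * normsq x"
  by (simp add: normsq_def ip_scale ip_scale_right power2_eq_square)

lemma ip_eqI_right: "(\<And>z. ip z x = ip z y) \<Longrightarrow> x = y"
  using normsq_eq_0_iff[of "x - y"] by (simp add: normsq_def ip_diff_right)

lemma sqnorm_ip_sym: "sqnorm (ip x y) = sqnorm (ip y x)"
  by (subst ip_conj) simp

section \<open>Orthonormal systems, expansions and Parseval's identity\<close>

abbreviation n where "n \<equiv> dim UNIV"

definition orthonormal :: "nat \<Rightarrow> (nat \<Rightarrow> 'w) \<Rightarrow> bool" where
  "orthonormal k u \<longleftrightarrow> (\<forall>i<k. \<forall>j<k. ip (u i) (u j) = (if i = j then 1 else 0))"

lemma orthonormal_ip: "orthonormal k u \<Longrightarrow> i < k \<Longrightarrow> j < k \<Longrightarrow> ip (u i) (u j) = (if i = j then 1 else 0)"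
  by (simp add: orthonormal_def)

lemma orthonormal_coeff:
  assumes "orthonormal k u" "i < k"
  shows "ip (\<Sum>j<k. smul (c j) (u j)) (u i) = c i"
proof -
  have "ip (\<Sum>j<k. smul (c j) (u j)) (u i) = (\<Sum>j<k. if j = i then c j else 0)"
    unfolding ip_sum ip_scale using assms by (intro sum.cong) (auto simp: orthonormal_ip)
  also have "\<dots> = c i" using assms by simp
  finally show ?thesis .
qed

lemma orthonormal_inj: "orthonormal k u \<Longrightarrow> inj_on u {..<k}"
  by (rule inj_onI) (metis lessThan_iff orthonormal_ip zero_neq_one)

lemma orthonormal_independent:
  assumes "orthonormal k u"
  shows "independent (u ` {..<k})"
proof (rule independent_if_scalars_zero)
  fix f x assume s: "(\<Sum>x\<in>u ` {..<k}. smul (f x) x) = 0" and x: "x \<in> u ` {..<k}"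
  then obtain i where i: "x = u i" "i < k" by auto
  have "(\<Sum>j<k. smul (f (u j)) (u j)) = 0"
    using s by (simp add: sum.reindex[OF orthonormal_inj[OF assms]])
  then have "ip (\<Sum>j<k. smul (f (u j)) (u j)) (u i) = 0" by simp
  then show "f x = 0" using orthonormal_coeff[OF assms i(2)] i by simp
qed simp

lemma orthonormal_le_dim:
  assumes "orthonormal k u"
  shows "k \<le> n"
proof -
  obtain B0 where B0: "finite B0" "span B0 = UNIV" using finite_dim by auto
  obtain B where B: "independent B" "UNIV \<subseteq> span B" "card B = n" by (rule basis_exists[of UNIV])
  have "finite B" using independent_span_bound[OF B0(1) B(1)] B0 by auto
  then have "card (u ` {..<k}) \<le> card B"
    using independent_span_bound[OF _ orthonormal_independent[OF assms], of B] B by auto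
  then show ?thesis using B(3) card_image[OF orthonormal_inj[OF assms]] by simp
qed

lemma orthonormal_spanning_or_extendable:
  assumes u: "orthonormal k u"
  shows "(\<forall>x. x = (\<Sum>i<k. smul (ip x (u i)) (u i))) \<or>
    (\<exists>v. normsq v = 1 \<and> (\<forall>i<k. ip v (u i) = 0))"
proof (cases "\<forall>x. x = (\<Sum>i<k. smul (ip x (u i)) (u i))")
  case False
  then obtain x where x: "x - (\<Sum>i<k. smul (ip x (u i)) (u i)) \<noteq> 0" by auto
  define y where "y = x - (\<Sum>i<k. smul (ip x (u i)) (u i))"
  have y: "ip y (u i) = 0" if "i < k" for i
    using orthonormal_coeff[OF u that] by (simp add: y_def ip_diff)
  have y0: "normsq y > 0" using x by (intro normsq_pos) (simp add: y_def)
  define v where "v = smul (of_real (1 / sqrt (normsq y))) y"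
  have "normsq v = 1"
    using y0 by (auto simp: v_def normsq_scale power_divide simp del: of_real_divide)
  moreover have "ip v (u i) = 0" if "i < k" for i
    using y[OF that] by (simp add: v_def ip_scale)
  ultimately show ?thesis by blast
qed blast

lemma orthonormal_extend:
  assumes "orthonormal k u" "normsq v = 1" "\<And>i. i < k \<Longrightarrow> ip v (u i) = 0"
  shows "orthonormal (Suc k) (u(k := v))"
proof -
  have "ip (u i) v = 0" if "i < k" for i
    using assms(3)[OF that] ip_conj[of v "u i"] by simp
  then show ?thesis using assms ip_self[of v] by (auto simp: orthonormal_def less_Suc_eq)
qed

lemma orthonormal_expand:
  assumes u: "orthonormal n u"
  shows "x = (\<Sum>i<n. smul (ip x (u i)) (u i))"
  using orthonormal_spanning_or_extendable[OF u] orthonormal_extend[OF u] orthonormal_le_dim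
  by (metis Suc_n_not_le_n)

lemma spanning_eq_dim:
  assumes u: "orthonormal k u" and "\<And>x. x = (\<Sum>i<k. smul (ip x (u i)) (u i))"
  shows "k = n"
proof -
  have "x \<in> span (u ` {..<k})" for x
    by (subst assms(2)[of x]) (intro span_sum span_scale span_base imageI)
  then have "span (u ` {..<k}) = span UNIV" by auto
  then have "n = card (u ` {..<k})"
    using orthonormal_independent[OF u] by (rule dim_eq_card)
  then show ?thesis using card_image[OF orthonormal_inj[OF u]] by simp
qed

lemma unit_vector_orthogonal_exists:
  assumes u: "orthonormal k u" and "k < n"
  shows "\<exists>v. normsq v = 1 \<and> (\<forall>i<k. ip v (u i) = 0)"
  using orthonormal_spanning_or_extendable[OF u] spanning_eq_dim[OF u] assms(2) by blast

lemma orthonormal_exists: "k \<le> n \<Longrightarrow> \<exists>u. orthonormal k u"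
proof (induction k)
  case 0
  then show ?case by (simp add: orthonormal_def)
next
  case (Suc k)
  then show ?case
    using unit_vector_orthogonal_exists orthonormal_extend by (metis Suc_leD Suc_le_lessD)
qed

definition basis :: "nat \<Rightarrow> 'w" where
  "basis = (SOME u. orthonormal n u)"

lemma orthonormal_basis: "orthonormal n basis"
  unfolding basis_def using orthonormal_exists[OF order_refl] by (rule someI_ex)

lemma parseval:
  assumes "orthonormal n u"
  shows "ip x y = (\<Sum>i<n. ip x (u i) * cconj (ip y (u i)))"
proof -
  have "ip x y = ip x (\<Sum>i<n. smul (ip y (u i)) (u i))"
    using orthonormal_expand[OF assms, of y] by simp
  then show ?thesis by (simp add: ip_sum_right ip_scale_right mult.commute)
qed

lemma normsq_parseval:
  assumes "orthonormal n u"
  shows "normsq x = (\<Sum>i<n. sqnorm (ip x (u i)))"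
  unfolding normsq_def by (subst parseval[OF assms]) (simp add: mult_cconj del: fre_fim_mult)

lemma eq_if_coeffs_eq:
  assumes "orthonormal n u" "\<And>i. i < n \<Longrightarrow> ip x (u i) = ip y (u i)"
  shows "x = y"
  using assms(2) orthonormal_expand[OF assms(1), of x] orthonormal_expand[OF assms(1), of y] by simp

subsection \<open>Selfadjoint and unitary operators\<close>

abbreviation lin :: "('w \<Rightarrow> 'w) \<Rightarrow> bool" where
  "lin \<equiv> Vector_Spaces.linear smul smul"

lemma linI: "(\<And>x y. A (x + y) = A x + A y) \<Longrightarrow> (\<And>a x. A (smul a x) = smul a (A x)) \<Longrightarrow> lin A"
  unfolding Vector_Spaces.linear_iff using vector_space_axioms by blast

lemma lin_add: "lin A \<Longrightarrow> A (x + y) = A x + A y"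
  and lin_scale: "lin A \<Longrightarrow> A (smul a x) = smul a (A x)"
  unfolding Vector_Spaces.linear_iff by blast+

lemma lin_0: "lin A \<Longrightarrow> A 0 = 0"
  using lin_scale[of A 0 0] by simp

lemma lin_sum: "lin A \<Longrightarrow> A (sum f I) = (\<Sum>i\<in>I. A (f i))"
  by (induction I rule: infinite_finite_induct) (simp_all add: lin_0 lin_add)

lemma lin_diff: "lin A \<Longrightarrow> A (x - y) = A x - A y"
  using lin_add[of A "x - y" y] by simp

lemma lin_expand:
  assumes "lin A" "orthonormal n u"
  shows "A x = (\<Sum>i<n. smul (ip x (u i)) (A (u i)))"
  by (subst orthonormal_expand[OF assms(2), of x]) (simp add: lin_sum lin_scale assms(1))

lemma lin_eqI:
  assumes "lin A" "lin B" "orthonormal n u" "\<And>i. i < n \<Longrightarrow> A (u i) = B (u i)"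
  shows "A = B"
proof
  show "A x = B x" for x
    unfolding lin_expand[OF assms(1,3), of x] lin_expand[OF assms(2,3), of x] using assms(4) by simp
qed

lemma adj_eqI:
  assumes "\<And>x y. ip (A x) y = ip x (A' y)"
  shows "adj ip A = A'"
  unfolding adj_def
proof (rule the_equality)
  fix A'' assume "\<forall>x y. ip (A x) y = ip x (A'' y)"
  then show "A'' = A'" using assms by (intro ext ip_eqI_right) metis
qed (use assms in blast)

lemma adj_ip:
  assumes "lin A"
  shows "ip (A x) y = ip x (adj ip A y)"
proof -
  define A' where "A' y = (\<Sum>i<n. smul (cconj (ip (A (basis i)) y)) (basis i))" for y
  have *: "ip (A x) y = ip x (A' y)" for x y
    unfolding A'_def lin_expand[OF assms orthonormal_basis, of x] ip_sum ip_sum_right ip_scale ip_scale_right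
    by (simp add: mult.commute)
  show ?thesis unfolding adj_eqI[of A A', OF *] by (rule *)
qed

definition selfadj :: "('w \<Rightarrow> 'w) \<Rightarrow> bool" where
  "selfadj A \<longleftrightarrow> lin A \<and> (\<forall>x y. ip (A x) y = ip x (A y))"

lemma selfadj_iff: "selfadj A \<longleftrightarrow> A \<in> End_op smul \<and> A = adj ip A"
  unfolding selfadj_def End_op_def using adj_ip[of A] adj_eqI[of A A] by auto

lemma selfadj_lin: "selfadj A \<Longrightarrow> lin A"
  and selfadj_ip: "selfadj A \<Longrightarrow> ip (A x) y = ip x (A y)"
  by (simp_all add: selfadj_def)

definition unitary :: "('w \<Rightarrow> 'w) \<Rightarrow> bool" where
  "unitary C \<longleftrightarrow> lin C \<and> (\<forall>x y. ip (C x) (C y) = ip x y)"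

lemma unitary_lin: "unitary C \<Longrightarrow> lin C"
  and unitary_ip: "unitary C \<Longrightarrow> ip (C x) (C y) = ip x y"
  by (simp_all add: unitary_def)

lemma unitary_orthonormal: "unitary C \<Longrightarrow> orthonormal k u \<Longrightarrow> orthonormal k (\<lambda>i. C (u i))"
  by (simp add: orthonormal_def unitary_ip)

lemma unitary_bij:
  assumes "unitary C"
  shows "bij C"
proof (rule bijI)
  show "inj C"
  proof (rule injI)
    fix x y assume "C x = C y"
    then have "C (x - y) = 0" using lin_diff[OF unitary_lin[OF assms]] by simp
    then have "normsq (x - y) = 0" using unitary_ip[OF assms, of "x - y" "x - y"] by (simp add: normsq_def)
    then show "x = y" by simp
  qed
  have "y = C (\<Sum>i<n. smul (ip y (C (basis i))) (basis i))" for y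
    using orthonormal_expand[OF unitary_orthonormal[OF assms orthonormal_basis], of y]
    by (simp add: lin_sum lin_scale unitary_lin[OF assms])
  then show "surj C" by (rule surjI[OF sym])
qed

lemma unitary_inv [simp]:
  assumes "unitary C"
  shows "inv_into UNIV C (C x) = x" "C (inv_into UNIV C x) = x"
  using unitary_bij[OF assms] by (simp_all add: bij_is_inj bij_is_surj surj_f_inv_f)

lemma unitary_ip_inv: "unitary C \<Longrightarrow> ip (C x) y = ip x (inv_into UNIV C y)"
  using unitary_ip[of C x "inv_into UNIV C y"] by simp

lemma O_group_eq: "O_group smul ip = {C. unitary C}"
proof (intro equalityI subsetI)
  fix C assume "C \<in> O_group smul ip"
  then have C: "lin C" "bij C" "C \<circ> adj ip C = id"
    by (auto simp: O_group_def End_op_def)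
  have "adj ip C (C y) = y" for y
    using C(3) bij_is_inj[OF C(2)] by (metis comp_apply id_apply injD)
  then show "C \<in> {C. unitary C}"
    using C(1) adj_ip[OF C(1)] by (simp add: unitary_def)
next
  fix C assume "C \<in> {C. unitary C}"
  then have C: "unitary C" by simp
  have "adj ip C = inv_into UNIV C" by (rule adj_eqI) (rule unitary_ip_inv[OF C])
  then show "C \<in> O_group smul ip"
    using C unitary_bij[OF C] by (auto simp: O_group_def End_op_def unitary_lin fun_eq_iff)
qed

lemma unitary_comp: "unitary C \<Longrightarrow> unitary D \<Longrightarrow> unitary (C \<circ> D)"
  by (auto simp: unitary_def intro!: linI simp: lin_add lin_scale)

lemma unitary_id: "unitary (\<lambda>x. x)"
  by (auto simp: unitary_def intro!: linI)

lemma unitary_inverse: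
  assumes "unitary C"
  shows "unitary (inv_into UNIV C)"
  unfolding unitary_def
proof
  show "lin (inv_into UNIV C)"
    by (rule linI; rule injD[OF bij_is_inj[OF unitary_bij[OF assms]]])
      (simp_all add: assms lin_add lin_scale unitary_lin)
  show "\<forall>x y. ip (inv_into UNIV C x) (inv_into UNIV C y) = ip x y"
    using unitary_ip[OF assms] unitary_inv(2)[OF assms] by metis
qed

lemma unitary_between_bases:
  assumes u: "orthonormal n u" and v: "orthonormal n v"
  shows "\<exists>C. unitary C \<and> (\<forall>i<n. C (u i) = v i)"
proof (intro exI[of _ "\<lambda>x. \<Sum>i<n. smul (ip x (u i)) (v i)"] conjI allI impI)
  let ?C = "\<lambda>x. \<Sum>i<n. smul (ip x (u i)) (v i)"
  have "lin ?C"
    by (rule linI) (simp_all add: ip_add ip_scale scale_left_distrib sum.distrib scale_sum_right)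
  moreover have "ip (?C x) (?C y) = ip x y" for x y
    unfolding parseval[OF v, of "?C x" "?C y"] parseval[OF u, of x y]
    by (simp add: orthonormal_coeff[OF v])
  ultimately show "unitary ?C" by (simp add: unitary_def)
  fix i assume i: "i < n"
  show "?C (u i) = v i"
    by (rule eq_if_coeffs_eq[OF v]) (simp add: orthonormal_coeff[OF v] orthonormal_ip[OF u] orthonormal_ip[OF v] i)
qed

text \<open>For \<open>a = 2 / normsq w\<close> this is the reflection in the hyperplane orthogonal to \<open>w\<close>.\<close>

definition reflection :: "'f \<Rightarrow> 'w \<Rightarrow> 'w \<Rightarrow> 'w" where
  "reflection a w x = x - smul (a * ip x w) w"

text \<open>For nonzero \<open>w\<close> the condition says that \<open>1 - a * normsq w\<close>,
  the eigenvalue of the reflection at \<open>w\<close>, has modulus 1.\<close>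

lemma reflection_unitary:
  assumes "a + cconj a = a * cconj a * of_real (normsq w)"
  shows "unitary (reflection a w)"
  unfolding unitary_def
proof (intro conjI allI)
  show "lin (reflection a w)"
    by (rule linI) (simp_all add: reflection_def ip_simps algebra_simps)
  fix x y
  have "ip (reflection a w x) (reflection a w y) = ip x y - cconj a * cconj (ip y w) * ip x w
      - a * ip x w * (ip w y) + a * ip x w * cconj a * cconj (ip y w) * of_real (normsq w)"
    by (simp add: reflection_def ip_simps algebra_simps ip_self)
  also have "\<dots> = ip x y - ip x w * ip w y * (a + cconj a - a * cconj a * of_real (normsq w))"
    by (simp add: ip_conj[of w y] algebra_simps)
  finally show "ip (reflection a w x) (reflection a w y) = ip x y" using assms by simp
qed

lemma reflection_orthogonal: "ip x w = 0 \<Longrightarrow> reflection a w x = x"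
  by (simp add: reflection_def)

lemma reflection_commute:
  assumes "selfadj A" "A w = smul (of_real \<mu>) w"
  shows "A (reflection a w x) = reflection a w (A x)"
proof -
  have "ip (A x) w = of_real \<mu> * ip x w"
    using assms by (simp add: selfadj_ip ip_scale_right)
  then show ?thesis
    using assms by (simp add: reflection_def lin_diff lin_scale selfadj_lin mult_ac)
qed

text \<open>For nonzero \<open>w = x - y\<close> the requirement
  \<open>x - smul (a * ip x w) w = y\<close> forces \<open>a = 1 / ip x w\<close>. Equal norms give
  \<open>ip x w + cconj (ip x w) = normsq w\<close>, which is the unitarity condition for this
  \<open>a\<close>. Over the complex numbers \<open>a\<close> need not be real.\<close>

lemma reflection_swap_exists:
  assumes "normsq x = normsq y"
  shows "\<exists>a. unitary (reflection a (x - y)) \<and> reflection a (x - y) x = y"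
proof (cases "x = y")
  case True
  then show ?thesis
    by (intro exI[of _ 0]) (simp add: reflection_unitary reflection_def)
next
  case False
  define \<alpha> where "\<alpha> = ip x (x - y)"
  have "\<alpha> + cconj \<alpha> = of_real (normsq (x - y))"
    unfolding ip_self[symmetric] \<alpha>_def ip_conj[of x "x - y", symmetric]
    using ip_self[of x] ip_self[of y] assms ip_conj[of y x] by (simp add: ip_simps)
  moreover have "normsq (x - y) \<noteq> 0" using False by simp
  ultimately have \<alpha>: "\<alpha> \<noteq> 0" "\<alpha> + cconj \<alpha> = of_real (normsq (x - y))" by auto
  have c: "cconj (1 / \<alpha>) = 1 / cconj \<alpha>"
    using \<alpha>(1) cconj_simps(2)[of "1 / \<alpha>" \<alpha>] by (simp add: nonzero_eq_divide_eq)
  show ?thesis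
  proof (intro exI[of _ "1 / \<alpha>"] conjI reflection_unitary)
    show "1 / \<alpha> + cconj (1 / \<alpha>) = 1 / \<alpha> * cconj (1 / \<alpha>) * of_real (normsq (x - y))"
      unfolding c \<alpha>(2)[symmetric] using \<alpha>(1) by (simp add: field_simps)
    show "reflection (1 / \<alpha>) (x - y) x = y"
      using \<alpha>(1) by (simp add: reflection_def flip: \<alpha>_def)
  qed
qed

text \<open>The operator is a product of reflections along differences of eigenvectors with the same
  eigenvalue; these commute with \<open>A\<close>, and each one fixes the vectors already in place.\<close>

lemma commuting_unitary_exists:
  assumes A: "selfadj A" and S: "finite S"
    and x: "\<And>s. s \<in> S \<Longrightarrow> A (x s) = smul (of_real (\<mu> s)) (x s)"
    and y: "\<And>s. s \<in> S \<Longrightarrow> A (y s) = smul (of_real (\<mu> s)) (y s)"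
    and gram: "\<And>s t. s \<in> S \<Longrightarrow> t \<in> S \<Longrightarrow> ip (x s) (x t) = ip (y s) (y t)"
  shows "\<exists>C. unitary C \<and> (\<forall>z. C (A z) = A (C z)) \<and> (\<forall>s\<in>S. C (x s) = y s)"
  using S x y gram
proof (induction S)
  case empty
  show ?case using unitary_id by (intro exI[of _ "\<lambda>x. x"]) simp
next
  case (insert s S)
  then obtain C where C: "unitary C" "\<And>z. C (A z) = A (C z)" "\<And>t. t \<in> S \<Longrightarrow> C (x t) = y t"
    by force
  let ?w = "C (x s) - y s"
  have "normsq (C (x s)) = normsq (y s)"
    using insert.prems(3)[of s s] unitary_ip[OF C(1)] by (simp add: normsq_def)
  then obtain a where a: "unitary (reflection a ?w)" "reflection a ?w (C (x s)) = y s"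
    using reflection_swap_exists by blast
  have "A ?w = smul (of_real (\<mu> s)) ?w"
    using insert.prems(1,2)[of s] C(2)[of "x s"]
    by (simp add: lin_diff selfadj_lin A scale_right_diff_distrib lin_scale unitary_lin C(1) flip: C(2))
  then have comm: "A (reflection a ?w z) = reflection a ?w (A z)" for z
    by (rule reflection_commute[OF A])
  have "ip (y t) ?w = 0" if "t \<in> S" for t
    using insert.prems(3)[of t s] that C(3)[OF that] unitary_ip[OF C(1), of "x t" "x s"]
    by (simp add: ip_diff_right)
  then have "reflection a ?w (y t) = y t" if "t \<in> S" for t
    using that by (intro reflection_orthogonal)
  then show ?case
    using a C comm by (intro exI[of _ "reflection a ?w \<circ> C"] conjI unitary_comp) auto
qed

subsection \<open>Algebras of functions with values in the space\<close>

definition QW :: "(('x \<Rightarrow> real) \<Rightarrow> bool) \<Rightarrow> ('x \<Rightarrow> 'w) \<Rightarrow> bool" where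
  "QW Q h \<longleftrightarrow> (\<forall>v. function_algebra.QF Q (\<lambda>x. ip (h x) v))"

context
  fixes Q :: "('x \<Rightarrow> real) \<Rightarrow> bool"
  assumes Q: "function_algebra Q"
begin

interpretation function_algebra Q by (rule Q)

lemma QW_const: "QW Q (\<lambda>x. v)" and QW_add: "QW Q h \<Longrightarrow> QW Q g \<Longrightarrow> QW Q (\<lambda>x. h x + g x)"
  and QW_diff: "QW Q h \<Longrightarrow> QW Q g \<Longrightarrow> QW Q (\<lambda>x. h x - g x)"
  and QW_scale: "QF f \<Longrightarrow> QW Q h \<Longrightarrow> QW Q (\<lambda>x. smul (f x) (h x))"
  by (auto simp: QW_def ip_simps intro: QF_const QF_add QF_diff QF_mult)

lemma QW_sum: "(\<And>i. i \<in> I \<Longrightarrow> QW Q (h i)) \<Longrightarrow> QW Q (\<lambda>x. \<Sum>i\<in>I. h i x)"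
  by (auto simp: QW_def ip_sum intro: QF_sum)

lemma QF_ip:
  assumes "QW Q h" "QW Q g"
  shows "QF (\<lambda>x. ip (h x) (g x))"
proof -
  have "(\<lambda>x. ip (h x) (g x)) = (\<lambda>x. \<Sum>i<n. ip (h x) (basis i) * cconj (ip (g x) (basis i)))"
    by (intro ext parseval orthonormal_basis)
  then show ?thesis
    using assms by (auto simp: QW_def intro!: QF_sum QF_mult QF_cconj)
qed

lemma Q_normsq: "QW Q h \<Longrightarrow> Q (\<lambda>x. normsq (h x))"
  using QF_ip[of h h] by (simp add: normsq_def QF_def)

lemma QW_apply:
  assumes "\<And>x. lin (A x)" "\<And>v. QW Q (\<lambda>x. A x v)" "QW Q h"
  shows "QW Q (\<lambda>x. A x (h x))"
proof -
  have "(\<lambda>x. A x (h x)) = (\<lambda>x. \<Sum>i<n. smul (ip (h x) (basis i)) (A x (basis i)))"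
    by (intro ext lin_expand assms(1) orthonormal_basis)
  then show ?thesis
    using assms by (auto simp: QW_def[of _ h] intro!: QW_sum QW_scale)
qed

lemma QW_funpow:
  assumes "\<And>x. lin (A x)" "\<And>v. QW Q (\<lambda>x. A x v)"
  shows "QW Q (\<lambda>x. (A x ^^ j) v)"
proof (induction j)
  case (Suc j)
  then show ?case using QW_apply[OF assms, of "\<lambda>x. (A x ^^ j) v"] by simp
qed (simp add: QW_const)

lemma QW_newton_op:
  assumes "\<And>x. lin (A x)" "\<And>v. QW Q (\<lambda>x. A x v)" "QW Q h" "\<And>q. q < j \<Longrightarrow> Q (\<lambda>x. l x q)"
  shows "QW Q (\<lambda>x. newton_op smul (l x) (A x) j (h x))"
  using assms(4)
proof (induction j)
  case (Suc j)
  then have "QW Q (\<lambda>x. newton_op smul (l x) (A x) j (h x))" "Q (\<lambda>x. l x j)" by auto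
  then show ?case
    using QW_apply[OF assms(1,2), of "\<lambda>x. newton_op smul (l x) (A x) j (h x)"]
    by (simp add: QW_diff QW_scale QF_of_real)
qed (simp add: assms(3))

end

subsection \<open>The spectral theorem\<close>

text \<open>The abstract space carries no topology of its own, so compactness is borrowed from a
  product of intervals that parametrizes vectors by their real coordinates.\<close>

lemma rayleigh_maximum:
  assumes A: "lin A" and u: "orthonormal k u" and k: "k < n"
  shows "\<exists>x. normsq x = 1 \<and> (\<forall>q<k. ip x (u q) = 0) \<and>
    (\<forall>y. normsq y = 1 \<longrightarrow> (\<forall>q<k. ip y (u q) = 0) \<longrightarrow> fre (ip (A y) y) \<le> fre (ip (A x) x))"
proof -
  interpret fa: function_algebra "continuous_on (UNIV :: (nat \<Rightarrow> real) set)"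
    by (rule function_algebra_continuous_on)
  note fa = fa.function_algebra_axioms
  \<comment> \<open>Even entries are real parts and odd entries imaginary parts of the
    coordinates.\<close>
  define vec where "vec c = (\<Sum>i<n. smul (of_real (c (2 * i)) + of_real (c (Suc (2 * i))) * imag_unit) (basis i))"
    for c :: "nat \<Rightarrow> real"
  have vec: "QW (continuous_on UNIV) vec"
    unfolding vec_def
    by (intro QW_sum[OF fa] QW_scale[OF fa] QW_const[OF fa] fa.QF_add fa.QF_mult fa.QF_of_real fa.QF_const)
      (rule continuous_on_product_coordinates)+
  \<comment> \<open>Coordinates of unit vectors have parts between -1 and 1, so this compact set is
    mapped onto the whole constrained sphere.\<close>
  define K where "K = Pi UNIV (\<lambda>_::nat. {-1..1::real}) \<inter> ({c. normsq (vec c) = 1} \<inter>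
    (\<Inter>q<k. {c. fre (ip (vec c) (u q)) = 0} \<inter> {c. fim (ip (vec c) (u q)) = 0}))"
  have ipq: "continuous_on UNIV (\<lambda>c. fre (ip (vec c) (u q)))" "continuous_on UNIV (\<lambda>c. fim (ip (vec c) (u q)))" for q
    using vec by (simp_all add: QW_def fa.QF_def)
  have "compact (PiE UNIV (\<lambda>_::nat. {-1..1::real}))"
    unfolding compactin_euclidean_iff[symmetric] euclidean_product_topology[symmetric] compactin_PiE by simp
  then have "compact (Pi UNIV (\<lambda>_::nat. {-1..1::real}))" by (simp add: PiE_UNIV_domain)
  moreover have "closed ({c. normsq (vec c) = 1} \<inter>
      (\<Inter>q<k. {c. fre (ip (vec c) (u q)) = 0} \<inter> {c. fim (ip (vec c) (u q)) = 0}))"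
    using Q_normsq[OF fa vec] ipq
    by (intro closed_Int closed_INT ballI closed_Collect_eq) (auto intro: continuous_intros)
  ultimately have comp: "compact K" unfolding K_def by (rule compact_Int_closed)
  have inK: "\<exists>c\<in>K. vec c = y" if y: "normsq y = 1" "\<forall>q<k. ip y (u q) = 0" for y
  proof -
    define c where "c i = (if i div 2 < n then (if even i then fre else fim) (ip y (basis (i div 2))) else 0)" for i
    have "vec c = (\<Sum>i<n. smul (ip y (basis i)) (basis i))"
      unfolding vec_def c_def by (intro sum.cong) (auto simp flip: real_imag_decomposition)
    also have "\<dots> = y" using orthonormal_expand[OF orthonormal_basis, of y] by simp
    finally have vc: "vec c = y" .
    have "\<bar>c i\<bar> \<le> 1" for i
    proof (cases "i div 2 < n")
      case True
      then have "sqnorm (ip y (basis (i div 2))) \<le> (\<Sum>i<n. sqnorm (ip y (basis i)))"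
        by (intro member_le_sum) auto
      also have "\<dots> = 1" using y normsq_parseval[OF orthonormal_basis] by simp
      finally have "(fre (ip y (basis (i div 2))))\<^sup>2 \<le> 1" "(fim (ip y (basis (i div 2))))\<^sup>2 \<le> 1"
        unfolding sqnorm_def by (smt (verit) zero_le_power2)+
      then show ?thesis using True by (auto simp: c_def abs_square_le_1)
    qed (simp add: c_def)
    then have "c i \<in> {-1..1}" for i by (simp add: abs_le_iff minus_le_iff)
    then have "c \<in> K" unfolding K_def by (simp add: vc y Pi_iff)
    then show ?thesis using vc by blast
  qed
  obtain v where "normsq v = 1" "\<forall>q<k. ip v (u q) = 0"
    using unit_vector_orthogonal_exists[OF u k] by auto
  then have "K \<noteq> {}" using inK by blast
  moreover have "QW (continuous_on UNIV) (\<lambda>c. A (vec c))"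
    using QW_apply[OF fa, of "\<lambda>_. A" vec] A vec QW_const[OF fa] by simp
  then have "continuous_on K (\<lambda>c. fre (ip (A (vec c)) (vec c)))"
    using QF_ip[OF fa _ vec] by (auto simp: fa.QF_def intro: continuous_on_subset)
  ultimately obtain c where c: "c \<in> K" "\<forall>d\<in>K. fre (ip (A (vec d)) (vec d)) \<le> fre (ip (A (vec c)) (vec c))"
    using continuous_attains_sup[OF comp] by blast
  show ?thesis
  proof (intro exI[of _ "vec c"] conjI allI impI)
    show "normsq (vec c) = 1" using c(1) by (simp add: K_def)
    show "ip (vec c) (u q) = 0" if "q < k" for q
    proof (rule field_eqI)
      show "fre (ip (vec c) (u q)) = fre 0" "fim (ip (vec c) (u q)) = fim 0"
        using c(1) that by (auto simp: K_def)
    qed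
    show "fre (ip (A y) y) \<le> fre (ip (A (vec c)) (vec c))"
      if y: "normsq y = 1" "\<forall>q<k. ip y (u q) = 0" for y
    proof -
      obtain d where "d \<in> K" "vec d = y" using inK[OF y] by blast
      then show ?thesis using c(2) by auto
    qed
  qed
qed

text \<open>At \<open>t = - b / d\<close> with \<open>d\<close> one more than the absolute value of
  \<open>c\<close>, the expression multiplied by \<open>d^2\<close> is
  \<open>b^2 * (c - 2 * d)\<close>, and its second factor is negative.\<close>

lemma nonneg_quadratic_linear_coeff_0:
  fixes b c :: real
  assumes "\<And>t. 0 \<le> 2 * t * b + t\<^sup>2 * c"
  shows "b = 0"
proof -
  define d where "d = \<bar>c\<bar> + 1"
  have d: "d > 0" by (simp add: d_def)
  have "0 \<le> (2 * (- b / d) * b + (- b / d)\<^sup>2 * c) * d\<^sup>2"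
    using assms[of "- b / d"] by simp
  also have "\<dots> = b\<^sup>2 * (c - 2 * d)" using d by (simp add: power2_eq_square field_simps)
  finally have "0 \<le> b\<^sup>2 * (c - 2 * d)" .
  moreover have "c - 2 * d < 0" by (simp add: d_def abs_if)
  ultimately have "b\<^sup>2 \<le> 0" by (metis mult_le_0_iff not_le zero_le_mult_iff)
  then show "b = 0" by simp
qed

text \<open>The form \<open>f y = \<mu> * normsq y - fre (ip (A y) y)\<close> is nonnegative on the
  orthogonal complement of the earlier eigenvectors and zero at the maximizer \<open>x\<close>. The
  vector \<open>z\<close>, the difference of \<open>\<mu> x\<close> and \<open>A x\<close>, lies in
  that complement, and the derivative of \<open>f\<close> at \<open>x\<close> in its direction is
  \<open>2 * normsq z\<close>; hence \<open>z = 0\<close>.\<close>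

lemma eigenvector_orthogonal_exists:
  assumes A: "selfadj A" and u: "orthonormal k u" and k: "k < n"
    and eig: "\<And>q. q < k \<Longrightarrow> A (u q) = smul (of_real (l q)) (u q)"
  shows "\<exists>x \<mu>. normsq x = 1 \<and> (\<forall>q<k. ip x (u q) = 0) \<and> A x = smul (of_real \<mu>) x \<and>
    (\<forall>y. (\<forall>q<k. ip y (u q) = 0) \<longrightarrow> fre (ip (A y) y) \<le> \<mu> * normsq y)"
proof -
  obtain x where x: "normsq x = 1" "\<And>q. q < k \<Longrightarrow> ip x (u q) = 0"
    and max: "\<And>y. normsq y = 1 \<Longrightarrow> (\<forall>q<k. ip y (u q) = 0) \<Longrightarrow> fre (ip (A y) y) \<le> fre (ip (A x) x)"
    using rayleigh_maximum[OF selfadj_lin[OF A] u k] by blast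
  define \<mu> where "\<mu> = fre (ip (A x) x)"
  define f where "f y = \<mu> * normsq y - fre (ip (A y) y)" for y
  have le: "f y \<ge> 0" if y: "\<And>q. q < k \<Longrightarrow> ip y (u q) = 0" for y
  proof (cases "y = 0")
    case True
    then show ?thesis by (simp add: f_def)
  next
    case False
    define s where "s = 1 / sqrt (normsq y)"
    have s: "s * s * normsq y = 1"
      using normsq_pos[OF False] False by (simp add: s_def field_simps)
    let ?y = "smul (of_real s) y"
    have ny: "normsq ?y = s * s * normsq y"
      by (simp add: normsq_def ip_scale ip_scale_right)
    have "fre (ip (A ?y) ?y) \<le> \<mu>"
      unfolding \<mu>_def by (rule max) (use ny s y in \<open>auto simp: ip_scale\<close>)
    moreover have "fre (ip (A ?y) ?y) = s * s * fre (ip (A y) y)"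
      by (simp add: lin_scale selfadj_lin[OF A] ip_scale ip_scale_right)
    ultimately have "s * s * fre (ip (A y) y) \<le> s * s * (\<mu> * normsq y)"
      using s by (simp add: algebra_simps)
    moreover have "s * s > 0" using s by (metis mult_zero_left not_real_square_gt_zero zero_neq_one)
    ultimately have "fre (ip (A y) y) \<le> \<mu> * normsq y" by (metis mult_le_cancel_left_pos)
    then show ?thesis by (simp add: f_def)
  qed
  define z where "z = smul (of_real \<mu>) x - A x"
  have zu: "ip z (u q) = 0" if "q < k" for q
    using that x(2)[OF that] by (simp add: z_def ip_diff ip_scale selfadj_ip[OF A] eig ip_scale_right)
  have "fre (ip z z) = 0"
  proof (rule nonneg_quadratic_linear_coeff_0)
    fix t :: real
    let ?y = "x + smul (of_real t) z"
    have "0 \<le> f ?y" by (rule le) (use x zu in \<open>simp add: ip_add ip_scale\<close>)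
    also have "f ?y = f x + 2 * t * (\<mu> * fre (ip x z) - fre (ip (A x) z)) + t\<^sup>2 * f z"
    proof -
      have 1: "fre (ip z x) = fre (ip x z)" by (subst ip_conj) simp
      have "ip (A z) x = ip z (A x)" by (rule selfadj_ip[OF A])
      then have 2: "fre (ip (A z) x) = fre (ip (A x) z)" using ip_conj[of "A x" z] by simp
      show ?thesis
        by (simp add: f_def normsq_def ip_simps lin_add lin_scale selfadj_lin[OF A] 1 2 power2_eq_square algebra_simps)
    qed
    also have "f x = 0" using x(1) by (simp add: f_def \<mu>_def)
    also have "\<mu> * fre (ip x z) - fre (ip (A x) z) = fre (ip z z)"
      by (subst (3) z_def) (simp add: ip_diff ip_scale)
    finally show "0 \<le> 2 * t * fre (ip z z) + t\<^sup>2 * f z" by simp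
  qed
  then have "z = 0" using normsq_eq_0_iff[of z] by (simp add: normsq_def)
  then have "A x = smul (of_real \<mu>) x" by (simp add: z_def)
  moreover have "fre (ip (A y) y) \<le> \<mu> * normsq y" if "\<forall>q<k. ip y (u q) = 0" for y
    using le[of y] that by (simp add: f_def)
  ultimately show ?thesis using x by blast
qed

text \<open>Carrying the Rayleigh bound through the induction yields the descending order: each new
  eigenvector competes in all earlier maximum problems.\<close>

lemma eigenvectors_exist:
  assumes A: "selfadj A" and "k \<le> n"
  shows "\<exists>u l. orthonormal k u \<and> descending k l \<and> (\<forall>i<k. A (u i) = smul (of_real (l i)) (u i)) \<and>
    (\<forall>i<k. \<forall>y. (\<forall>q<k. ip y (u q) = 0) \<longrightarrow> fre (ip (A y) y) \<le> l i * normsq y)"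
  using assms(2)
proof (induction k)
  case 0
  show ?case by (simp add: orthonormal_def descending_def)
next
  case (Suc k)
  from Suc.IH[OF Suc_leD[OF Suc.prems]]
  obtain u l where u: "orthonormal k u" and l: "descending k l"
    and eig: "\<And>i. i < k \<Longrightarrow> A (u i) = smul (of_real (l i)) (u i)"
    and bound: "\<And>i y. i < k \<Longrightarrow> (\<forall>q<k. ip y (u q) = 0) \<Longrightarrow> fre (ip (A y) y) \<le> l i * normsq y"
    by blast
  have "k < n" using Suc.prems by simp
  from eigenvector_orthogonal_exists[OF A u this eig]
  obtain x \<mu> where x: "normsq x = 1" "\<And>q. q < k \<Longrightarrow> ip x (u q) = 0" "A x = smul (of_real \<mu>) x"
    and x_bound: "\<And>y. (\<forall>q<k. ip y (u q) = 0) \<Longrightarrow> fre (ip (A y) y) \<le> \<mu> * normsq y" by blast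
  have "\<mu> \<le> l i" if "i < k" for i
    using bound[OF that, of x] x by (simp add: ip_scale ip_self)
  then have "descending (Suc k) (l(k := \<mu>))"
    using l by (auto simp: descending_def less_Suc_eq)
  moreover have "fre (ip (A y) y) \<le> (l(k := \<mu>)) i * normsq y"
    if "i < Suc k" "\<forall>q<Suc k. ip y ((u(k := x)) q) = 0" for i y
  proof -
    have y: "\<forall>q<k. ip y (u q) = 0" using that(2) by (metis fun_upd_other less_Suc_eq less_not_refl)
    show ?thesis using bound[OF _ y, of i] x_bound[OF y] that(1) by (auto simp: less_Suc_eq)
  qed
  moreover have "A ((u(k := x)) i) = smul (of_real ((l(k := \<mu>)) i)) ((u(k := x)) i)" if "i < Suc k" for i
    using that eig x(3) by (auto simp: less_Suc_eq)
  ultimately show ?case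
    using orthonormal_extend[OF u x(1,2)] by (intro exI[of _ "u(k := x)"] exI[of _ "l(k := \<mu>)"]) blast
qed

text \<open>Extending \<open>l\<close> by 0 makes it determined by \<open>A\<close> as a function on
  all numbers.\<close>

definition eigenbasis :: "('w \<Rightarrow> 'w) \<Rightarrow> (nat \<Rightarrow> real) \<Rightarrow> (nat \<Rightarrow> 'w) \<Rightarrow> bool" where
  "eigenbasis A l u \<longleftrightarrow> orthonormal n u \<and> descending n l \<and> (\<forall>i\<ge>n. l i = 0) \<and>
    (\<forall>i<n. A (u i) = smul (of_real (l i)) (u i))"

lemma eigenbasisD:
  assumes "eigenbasis A l u"
  shows "orthonormal n u" "descending n l" "i \<ge> n \<Longrightarrow> l i = 0"
    "i < n \<Longrightarrow> A (u i) = smul (of_real (l i)) (u i)"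
  using assms by (auto simp: eigenbasis_def)

lemma eigenbasis_exists:
  assumes "selfadj A"
  shows "\<exists>l u. eigenbasis A l u"
proof -
  obtain u l where "orthonormal n u" "descending n l" "\<forall>i<n. A (u i) = smul (of_real (l i)) (u i)"
    using eigenvectors_exist[OF assms order_refl] by blast
  then show ?thesis
    by (intro exI[of _ "\<lambda>i. if i < n then l i else 0"] exI[of _ u]) (auto simp: eigenbasis_def descending_def)
qed

definition eigenvalues :: "('w \<Rightarrow> 'w) \<Rightarrow> nat \<Rightarrow> real" where
  "eigenvalues A = (SOME l. \<exists>u. eigenbasis A l u)"

lemma eigenbasis_eigenvalues: "selfadj A \<Longrightarrow> \<exists>u. eigenbasis A (eigenvalues A) u"
  unfolding eigenvalues_def using eigenbasis_exists by (rule someI_ex)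

text \<open>Written in the fixed basis, the trace of a power is polynomial in the matrix entries; it
  gives access to the eigenvalues without eigenvectors.\<close>

definition trace_pow :: "('w \<Rightarrow> 'w) \<Rightarrow> nat \<Rightarrow> real" where
  "trace_pow A j = (\<Sum>i<n. fre (ip ((A ^^ j) (basis i)) (basis i)))"

lemma ip_funpow_eigenvector:
  assumes "selfadj A" "A v = smul (of_real \<mu>) v"
  shows "ip ((A ^^ j) x) v = of_real (\<mu> ^ j) * ip x v"
  by (induction j arbitrary: x) (simp_all add: selfadj_ip assms ip_scale_right mult_ac funpow_swap1)

lemma trace_pow_eq:
  assumes A: "selfadj A" and e: "eigenbasis A l u"
  shows "trace_pow A j = (\<Sum>i<n. l i ^ j)"
proof -
  note u = eigenbasisD(1)[OF e]
  have "fre (ip ((A ^^ j) x) x) = (\<Sum>i<n. l i ^ j * sqnorm (ip x (u i)))" for x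
  proof -
    have "ip ((A ^^ j) x) x = (\<Sum>i<n. of_real (l i ^ j * sqnorm (ip x (u i))))"
      by (subst parseval[OF u]) (simp add: ip_funpow_eigenvector[OF A eigenbasisD(4)[OF e]]
          mult.assoc mult_cconj)
    then show ?thesis by (simp del: of_real_power of_real_mult)
  qed
  then have "trace_pow A j = (\<Sum>i<n. \<Sum>q<n. l q ^ j * sqnorm (ip (basis i) (u q)))"
    by (simp add: trace_pow_def)
  also have "\<dots> = (\<Sum>q<n. l q ^ j * (\<Sum>i<n. sqnorm (ip (u q) (basis i))))"
    by (subst sum.swap) (simp add: sum_distrib_left sqnorm_ip_sym[of "basis _"])
  also have "\<dots> = (\<Sum>q<n. l q ^ j)"
    using orthonormal_ip[OF u] by (simp add: normsq_parseval[OF orthonormal_basis, symmetric] normsq_def)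
  finally show ?thesis .
qed

lemma ip_newton_op:
  assumes "selfadj A" "A v = smul (of_real \<mu>) v"
  shows "ip (newton_op smul l A j x) v = of_real (\<Prod>q<j. l q - \<mu>) * ip x v"
  by (induction j) (simp_all add: ip_diff ip_scale selfadj_ip assms ip_scale_right algebra_simps)

lemma newton_op_unitary:
  assumes "unitary C" "\<And>z. C (A z) = A' (C z)"
  shows "newton_op smul l A' j (C x) = C (newton_op smul l A j x)"
  by (induction j) (simp_all add: assms(2) lin_diff lin_scale unitary_lin assms(1))

lemma ip_newton_op_eigenbasis:
  assumes "selfadj A" "eigenbasis A l u"
  shows "ip (newton_op smul l A j x) y = (\<Sum>i<n. of_real (newton_coeff l j i) * (ip x (u i) * cconj (ip y (u i))))"
  by (subst parseval[OF eigenbasisD(1)[OF assms(2)]])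
    (simp add: ip_newton_op[OF assms(1) eigenbasisD(4)[OF assms(2)]] newton_coeff_def mult_ac)

end

section \<open>Determinants\<close>

definition array_det :: "nat \<Rightarrow> (nat \<Rightarrow> nat \<Rightarrow> 'a::comm_ring_1) \<Rightarrow> 'a" where
  "array_det n f = Determinant.det (Matrix.mat n n (\<lambda>(i, j). f i j))"

lemma array_det_cong: "(\<And>i j. i < n \<Longrightarrow> j < n \<Longrightarrow> f i j = g i j) \<Longrightarrow> array_det n f = array_det n g"
  unfolding array_det_def by (rule arg_cong[where f = Determinant.det]) (rule eq_matI, auto)

lemma array_det_leibniz:
  "array_det n f = (\<Sum>p | p permutes {..<n}. of_int (sign p) * (\<Prod>i<n. f i (p i)))"
proof -
  have "array_det n f = (\<Sum>p | p permutes {0..<n}. of_int (sign p) *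
      (\<Prod>i = 0..<n. Matrix.mat n n (\<lambda>(i, j). f i j) $$ (i, p i)))"
    unfolding array_det_def by (rule det_def') simp
  also have "\<dots> = (\<Sum>p | p permutes {0..<n}. of_int (sign p) * (\<Prod>i = 0..<n. f i (p i)))"
    by (intro sum.cong arg_cong2[where f = "(*)"] prod.cong) (auto simp: permutes_in_image)
  finally show ?thesis by (simp add: atLeast0LessThan)
qed

lemma array_det_mult:
  "array_det n f * array_det n g = array_det n (\<lambda>i j. \<Sum>k<n. f i k * g k j)"
proof -
  have "Matrix.mat n n (\<lambda>(i, j). f i j) * Matrix.mat n n (\<lambda>(i, j). g i j) =
      Matrix.mat n n (\<lambda>(i, j). \<Sum>k<n. f i k * g k j)"
    by (rule eq_matI) (auto simp: scalar_prod_def atLeast0LessThan)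
  then show ?thesis
    unfolding array_det_def by (metis det_mult mat_carrier)
qed

lemma array_det_transpose: "array_det n (\<lambda>i j. f j i) = array_det n f"
proof -
  have "Matrix.mat n n (\<lambda>(i, j). f j i) = transpose_mat (Matrix.mat n n (\<lambda>(i, j). f i j))"
    by (rule eq_matI) auto
  then show ?thesis
    unfolding array_det_def by (metis det_transpose mat_carrier)
qed

lemma array_det_lower_triangular:
  assumes "\<And>i j. i < j \<Longrightarrow> j < n \<Longrightarrow> f i j = 0"
  shows "array_det n f = (\<Prod>i<n. f i i)"
proof -
  have "array_det n f = prod_list (diag_mat (Matrix.mat n n (\<lambda>(i, j). f i j)))"
    unfolding array_det_def by (rule det_lower_triangular[of n]) (use assms in auto)
  then show ?thesis by (simp add: prod_list_diag_prod atLeast0LessThan)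
qed

lemma array_det_delta: "array_det n (\<lambda>i j. if i = j then 1 else 0) = 1"
  by (subst array_det_lower_triangular) auto

lemma array_det_cconj: "array_det n (\<lambda>i j. cconj (f i j)) = cconj (array_det n f)"
proof -
  have p: "cconj (prod g A) = (\<Prod>i\<in>A. cconj (g i))" for g :: "nat \<Rightarrow> 'a" and A
    by (induction A rule: infinite_finite_induct) simp_all
  have s: "cconj (of_int k :: 'a) = of_int k" for k
    by (metis cconj_simps(6) of_real_of_int_eq)
  show ?thesis unfolding array_det_leibniz by (simp add: p s)
qed

lemma prod_pairs_symmetric:
  fixes f :: "nat \<Rightarrow> nat \<Rightarrow> 'a::comm_monoid_mult"
  assumes "\<And>i q. f i q = f q i"
  shows "(\<Prod>i<n. \<Prod>q\<in>{..<n} - {i}. f i q) = (\<Prod>i<n. \<Prod>q<i. f i q) * (\<Prod>i<n. \<Prod>q<i. f i q)"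
proof (induction n)
  case (Suc n)
  have "(\<Prod>q\<in>{..<Suc n} - {i}. f i q) = f n i * (\<Prod>q\<in>{..<n} - {i}. f i q)" if "i < n" for i
  proof -
    have "{..<Suc n} - {i} = insert n ({..<n} - {i})" using that by auto
    then show ?thesis by (simp add: assms[of i n])
  qed
  then have "(\<Prod>i<n. \<Prod>q\<in>{..<Suc n} - {i}. f i q) =
      (\<Prod>i<n. f n i) * ((\<Prod>i<n. \<Prod>q<i. f i q) * (\<Prod>i<n. \<Prod>q<i. f i q))"
    by (simp add: prod.distrib Suc.IH)
  moreover have "{..<Suc n} - {n} = {..<n}" by auto
  ultimately show ?case by (simp add: mult_ac)
qed simp

text \<open>Each distance between two points occurs twice in the full product, once for either end,
  but only once, up to sign, in the product of the diagonal Newton coefficients; hence the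
  square.\<close>

lemma weight_prod:
  "(\<Prod>i<n. weight n l w i) = (\<Prod>i<n. (newton_coeff l i i)\<^sup>2 * w i)"
proof -
  have "(\<Prod>i<n. \<Prod>q\<in>{..<n} - {i}. \<bar>l q - l i\<bar>) = (\<Prod>i<n. (newton_coeff l i i)\<^sup>2)"
  proof -
    have "(\<Prod>i<n. \<Prod>q\<in>{..<n} - {i}. \<bar>l q - l i\<bar>) =
        (\<Prod>i<n. \<bar>newton_coeff l i i\<bar>) * (\<Prod>i<n. \<bar>newton_coeff l i i\<bar>)"
      unfolding newton_coeff_def abs_prod by (rule prod_pairs_symmetric) (rule abs_minus_commute)
    then show ?thesis by (simp flip: prod.distrib add: power2_eq_square)
  qed
  then show ?thesis by (simp add: weight_def prod.distrib mult.commute)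
qed

section \<open>Determinants of operators computed from inner products\<close>

context inner_product_space
begin

definition matrix_det :: "(nat \<Rightarrow> 'w) \<Rightarrow> 'f" where
  "matrix_det x = array_det n (\<lambda>i j. ip (x j) (basis i))"

abbreviation operator_det :: "('w \<Rightarrow> 'w) \<Rightarrow> 'f" where
  "operator_det C \<equiv> matrix_det (\<lambda>j. C (basis j))"

lemma matrix_det_apply:
  assumes "lin C"
  shows "matrix_det (\<lambda>j. C (x j)) = operator_det C * matrix_det x"
proof -
  have "ip (C (x j)) (basis i) = (\<Sum>k<n. ip (C (basis k)) (basis i) * ip (x j) (basis k))" for i j
    by (subst lin_expand[OF assms orthonormal_basis]) (simp add: ip_sum ip_scale mult.commute)
  then show ?thesis unfolding matrix_det_def array_det_mult by simp
qed

lemma matrix_det_change_basis: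
  assumes u: "orthonormal n u"
  shows "matrix_det x = matrix_det u * array_det n (\<lambda>i j. ip (x j) (u i))"
proof -
  have "ip (x j) (basis i) = (\<Sum>k<n. ip (u k) (basis i) * ip (x j) (u k))" for i j
    by (subst parseval[OF u]) (simp add: ip_conj[of _ "basis i"] mult.commute)
  then show ?thesis unfolding matrix_det_def array_det_mult by simp
qed

lemma sqnorm_matrix_det_orthonormal:
  assumes u: "orthonormal n u"
  shows "sqnorm (matrix_det u) = 1"
proof -
  have "cconj (matrix_det u) = array_det n (\<lambda>i j. cconj (ip (u i) (basis j)))"
    unfolding matrix_det_def array_det_cconj[symmetric] by (rule array_det_transpose)
  then have "matrix_det u * cconj (matrix_det u) =
      array_det n (\<lambda>i j. ip (u j) (basis i)) * array_det n (\<lambda>i j. cconj (ip (u i) (basis j)))"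
    unfolding matrix_det_def by (rule arg_cong)
  also have "\<dots> = array_det n (\<lambda>i j. if i = j then 1 else 0)"
    unfolding array_det_mult
  proof (rule array_det_cong)
    fix i j assume ij: "i < n" "j < n"
    have "(\<Sum>k<n. ip (u k) (basis i) * cconj (ip (u k) (basis j))) =
        (\<Sum>k<n. ip (basis j) (u k) * cconj (ip (basis i) (u k)))"
      using ip_conj[of "basis j"] ip_conj[of _ "basis i"] by (simp add: mult.commute)
    also have "\<dots> = ip (basis j) (basis i)" by (rule parseval[OF u, symmetric])
    also have "\<dots> = (if i = j then 1 else 0)" using orthonormal_ip[OF orthonormal_basis ij(2,1)] by auto
    finally show "(\<Sum>k<n. ip (u k) (basis i) * cconj (ip (u k) (basis j))) = (if i = j then 1 else 0)" .
  qed
  also have "\<dots> = 1" by (rule array_det_delta)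
  finally have "of_real (sqnorm (matrix_det u)) = (of_real 1 :: 'f)" by (simp add: mult_cconj)
  then show ?thesis using of_real_eq_iff by blast
qed

lemma sqnorm_operator_det: "unitary C \<Longrightarrow> sqnorm (operator_det C) = 1"
  by (rule sqnorm_matrix_det_orthonormal[OF unitary_orthonormal[OF _ orthonormal_basis]])

lemma operator_det_comp: "lin C \<Longrightarrow> operator_det (\<lambda>x. C (D x)) = operator_det C * operator_det D"
  by (rule matrix_det_apply)

text \<open>The matrices of \<open>C\<close> in the unspecified basis and in the orthonormal one are
  intertwined by the matrix \<open>?G\<close> of inner products between the two bases. It is
  invertible because the coefficients of the orthonormal vectors in the other basis form an
  inverse.\<close>

lemma op_det_eq:
  assumes C: "lin C"
  shows "op_det smul C = operator_det C"
proof -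
  define B where "B = (SOME B. independent B \<and> span B = UNIV)"
  have "\<exists>B. independent B \<and> span B = UNIV"
    using basis_exists[of UNIV] by (metis top.extremum_uniqueI)
  from someI_ex[OF this] have B: "independent B" "span B = UNIV" by (simp_all add: B_def)
  obtain B0 where "finite B0" "span B0 = UNIV" using finite_dim by auto
  then have fin: "finite B" using independent_span_bound[OF _ B(1), of B0] by auto
  have card: "card B = n" using dim_eq_card[of B UNIV] B by simp
  obtain g where g: "bij_betw g {..<n} B"
    using ex_bij_betw_nat_finite[OF fin] card by (auto simp: atLeast0LessThan)
  let ?R = "representation B"
  \<comment> \<open>Transports permutations of indices to permutations of the basis, matching the
    terms of the Leibniz formula.\<close>
  define F where "F \<pi> x = (if x \<in> B then g (\<pi> (inv_into {..<n} g x)) else x)" for \<pi> x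
  have F: "bij_betw F {\<pi>. \<pi> permutes {..<n}} {\<pi>. \<pi> permutes B}"
    using bij_betw_permutations[OF g] by (simp add: F_def[abs_def])
  have Fg: "F \<pi> (g i) = g (\<pi> i)" if "i < n" for \<pi> i
    using g that by (auto simp: F_def bij_betw_def inv_into_f_f)
  have sgn: "sign (F \<pi>) = sign \<pi>" if "\<pi> permutes {..<n}" for \<pi>
  proof -
    have "F \<pi> = map_permutation {..<n} g \<pi>"
      using g by (auto simp: F_def map_permutation_def restrict_id_def bij_betw_def fun_eq_iff)
    moreover have "inj_on g {..<n}" using g by (simp add: bij_betw_def)
    ultimately show ?thesis using sign_map_permutation[OF _ that, of g] by simp
  qed
  have "op_det smul C = (\<Sum>p | p permutes B. of_int (sign p) * (\<Prod>b\<in>B. ?R (C b) (p b)))"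
    by (simp add: op_det_def B_def Let_def)
  also have "\<dots> = (\<Sum>\<pi> | \<pi> permutes {..<n}. of_int (sign (F \<pi>)) * (\<Prod>b\<in>B. ?R (C b) (F \<pi> b)))"
    by (rule sum.reindex_bij_betw[OF F, symmetric])
  also have "\<dots> = (\<Sum>\<pi> | \<pi> permutes {..<n}. of_int (sign \<pi>) * (\<Prod>i<n. ?R (C (g i)) (g (\<pi> i))))"
  proof (intro sum.cong refl arg_cong2[where f = "(*)"])
    fix \<pi> assume "\<pi> \<in> {\<pi>. \<pi> permutes {..<n}}"
    then show "(of_int (sign (F \<pi>)) :: 'f) = of_int (sign \<pi>)" by (simp add: sgn)
    have "(\<Prod>b\<in>B. ?R (C b) (F \<pi> b)) = (\<Prod>i<n. ?R (C (g i)) (F \<pi> (g i)))"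
      by (rule prod.reindex_bij_betw[OF g, symmetric])
    then show "(\<Prod>b\<in>B. ?R (C b) (F \<pi> b)) = (\<Prod>i<n. ?R (C (g i)) (g (\<pi> i)))"
      by (simp add: Fg)
  qed
  also have "\<dots> = array_det n (\<lambda>i j. ?R (C (g i)) (g j))"
    by (rule array_det_leibniz[symmetric])
  finally have op: "op_det smul C = array_det n (\<lambda>i j. ?R (C (g i)) (g j))" .
  have expand: "x = (\<Sum>k<n. smul (?R x (g k)) (g k))" for x
    using sum_representation_eq[OF B(1), of x B] B fin sum.reindex_bij_betw[OF g, of "\<lambda>b. smul (?R x b) b"]
    by simp
  have ip_expand: "ip x y = (\<Sum>k<n. ?R x (g k) * ip (g k) y)" for x y
    by (subst expand[of x]) (simp add: ip_sum ip_scale)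
  let ?G = "\<lambda>i j. ip (g i) (basis j)"
  have 1: "array_det n (\<lambda>i j. ?R (C (g i)) (g j)) * array_det n ?G = array_det n (\<lambda>i j. ip (C (g i)) (basis j))"
    unfolding array_det_mult by (simp flip: ip_expand)
  have "array_det n ?G * array_det n (\<lambda>i j. ip (C (basis i)) (basis j)) = array_det n (\<lambda>i j. ip (C (g i)) (basis j))"
    unfolding array_det_mult
  proof (rule array_det_cong)
    fix i j
    show "(\<Sum>k<n. ip (g i) (basis k) * ip (C (basis k)) (basis j)) = ip (C (g i)) (basis j)"
      by (subst (2) lin_expand[OF C orthonormal_basis]) (simp add: ip_sum ip_scale)
  qed
  then have 2: "array_det n ?G * operator_det C = array_det n (\<lambda>i j. ip (C (g i)) (basis j))"
    unfolding matrix_det_def array_det_transpose[of n "\<lambda>i j. ip (C (basis i)) (basis j)"] .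
  have "array_det n (\<lambda>i j. ?R (basis i) (g j)) * array_det n ?G = array_det n (\<lambda>i j. if i = j then 1 else 0)"
    unfolding array_det_mult using orthonormal_ip[OF orthonormal_basis]
    by (intro array_det_cong) (simp flip: ip_expand)
  then have "array_det n ?G \<noteq> 0" by (auto simp: array_det_delta)
  moreover have "op_det smul C * array_det n ?G = operator_det C * array_det n ?G"
    using 1 2 op by (simp add: mult.commute)
  ultimately show ?thesis by simp
qed

text \<open>The scalar is the one for which \<open>w\<close> has eigenvalue \<open>z\<close>. A
  unitary operator carrying the first basis vector to the direction of \<open>w\<close> conjugates
  \<open>R\<close> into an operator with diagonal \<open>z, 1, ..., 1\<close>, and conjugation
  preserves the determinant.\<close>

lemma det_reflection:
  assumes w: "w \<noteq> 0" and z: "sqnorm z = 1"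
  defines "R \<equiv> reflection ((1 - z) / of_real (normsq w)) w"
  shows "unitary R" "operator_det R = z"
proof -
  have n0: "normsq w > 0" by (rule normsq_pos[OF w])
  have cz: "z * cconj z = 1" using z by (simp add: mult_cconj)
  have cd: "cconj (x / of_real r) = cconj x / of_real r" for x and r :: real
  proof -
    have "x / of_real r = x * of_real (1 / r)" by simp
    then have "cconj (x / of_real r) = cconj x * of_real (1 / r)" by (metis cconj_simps(2,6))
    then show ?thesis by simp
  qed
  show "unitary R"
    unfolding R_def
  proof (rule reflection_unitary)
    show "(1 - z) / of_real (normsq w) + cconj ((1 - z) / of_real (normsq w)) =
      (1 - z) / of_real (normsq w) * cconj ((1 - z) / of_real (normsq w)) * of_real (normsq w)"
    proof -
      have "(1 - z) * (1 - cconj z) = (1 - z) + (1 - cconj z)" using cz by (simp add: algebra_simps)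
      then show ?thesis using n0 unfolding cd by (simp add: add_divide_distrib[symmetric])
    qed
  qed
  have npos: "n > 0"
  proof (rule ccontr)
    assume "\<not> n > 0"
    then have "w = 0" using orthonormal_expand[OF orthonormal_basis, of w] by simp
    then show False using w by simp
  qed
  define s where "s = sqrt (normsq w)"
  have s: "s > 0" "s\<^sup>2 = normsq w" using n0 by (simp_all add: s_def)
  define v where "v = smul (of_real (1 / s)) w"
  have "smul (of_real s) v = smul (of_real s * of_real (1 / s)) w" unfolding v_def by simp
  then have wv: "w = smul (of_real s) v" using s by simp
  have nv: "normsq v = 1" unfolding v_def normsq_scale using s n0 w by (simp add: power_divide)
  have "normsq (basis 0) = normsq v"
    using nv orthonormal_ip[OF orthonormal_basis npos npos] by (simp add: normsq_def)
  then obtain C where C: "unitary C" "C (basis 0) = v"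
    using reflection_swap_exists by blast
  define R0 where "R0 = reflection (1 - z) (basis 0)"
  have R0: "unitary R0"
    unfolding R0_def using orthonormal_ip[OF orthonormal_basis npos npos] cz
    by (intro reflection_unitary) (simp add: normsq_def algebra_simps)
  have comm: "R (C x) = C (R0 x)" for x
  proof -
    have "ip (C x) w = of_real s * ip x (basis 0)"
      using unitary_ip[OF C(1), of x "basis 0"] C(2) by (simp add: wv ip_scale_right)
    then have "smul ((1 - z) / of_real (normsq w) * ip (C x) w) w =
        smul ((1 - z) / of_real (normsq w) * (of_real s * ip x (basis 0)) * of_real s) v"
      by (subst (3) wv) simp
    also have "(1 - z) / of_real (normsq w) * (of_real s * ip x (basis 0)) * of_real s = (1 - z) * ip x (basis 0)"
      using s unfolding s(2)[symmetric] by (simp add: field_simps power2_eq_square)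
    finally show ?thesis
      by (simp add: R_def R0_def reflection_def lin_diff lin_scale unitary_lin C)
  qed
  have "operator_det R * operator_det C = operator_det (\<lambda>x. R (C x))"
    using \<open>unitary R\<close> by (simp add: operator_det_comp unitary_lin)
  also have "\<dots> = operator_det C * operator_det R0"
    unfolding comm using C by (simp add: operator_det_comp unitary_lin)
  finally have "operator_det R * operator_det C = operator_det R0 * operator_det C" by (simp add: mult.commute)
  moreover have "operator_det C \<noteq> 0" using sqnorm_operator_det[OF C(1)] by auto
  ultimately have "operator_det R = operator_det R0" by simp
  also have "\<dots> = array_det n (\<lambda>i j. if i = j then (if i = 0 then z else 1) else 0)"
    unfolding matrix_det_def R0_def reflection_def
    using orthonormal_ip[OF orthonormal_basis] npos
    by (intro array_det_cong) (auto simp: ip_diff ip_scale)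
  also have "\<dots> = (\<Prod>i<n. if i = 0 then z else 1)"
    by (subst array_det_lower_triangular) auto
  also have "\<dots> = z" using npos by simp
  finally show "operator_det R = z" .
qed

text \<open>Up to sign this is the Krylov determinant of \<open>b, A b, ..., A^(n-1) b\<close>,
  since the Newton products are triangular in the powers of \<open>A\<close> with leading
  coefficients 1 or -1. It is nonzero exactly for cyclic \<open>b\<close>.\<close>

definition newton_det :: "('w \<Rightarrow> 'w) \<Rightarrow> (nat \<Rightarrow> real) \<Rightarrow> 'w \<Rightarrow> 'f" where
  "newton_det A l b = matrix_det (\<lambda>j. newton_op smul l A j b)"

lemma newton_det_unitary:
  assumes "unitary C" "\<And>z. C (A z) = A' (C z)"
  shows "newton_det A' l (C b) = operator_det C * newton_det A l b"
  using matrix_det_apply[OF unitary_lin[OF assms(1)], of "\<lambda>j. newton_op smul l A j b"]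
    newton_op_unitary[of C A A' l _ b, OF assms] by (simp add: newton_det_def)

text \<open>In an eigenbasis the matrix is triangular, because \<open>newton_coeff l j i\<close>
  contains the factor \<open>l i - l i\<close> for \<open>i < j\<close>; the change of basis has
  determinant of modulus 1.\<close>

lemma sqnorm_newton_det:
  assumes A: "selfadj A" and e: "eigenbasis A l u"
  shows "sqnorm (newton_det A l b) = (\<Prod>i<n. weight n l (\<lambda>i. sqnorm (ip b (u i))) i)"
proof -
  note u = eigenbasisD(1)[OF e]
  have entry: "ip (newton_op smul l A j b) (u i) = of_real (newton_coeff l j i) * ip b (u i)" if "i < n" for i j
    using ip_newton_op[OF A eigenbasisD(4)[OF e that]] by (simp add: newton_coeff_def)
  have "array_det n (\<lambda>i j. ip (newton_op smul l A j b) (u i)) =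
      array_det n (\<lambda>i j. of_real (newton_coeff l j i) * ip b (u i))"
    by (rule array_det_cong) (simp add: entry)
  also have "\<dots> = (\<Prod>i<n. of_real (newton_coeff l i i) * ip b (u i))"
    by (rule array_det_lower_triangular) (auto simp: newton_coeff_def)
  finally show ?thesis
    unfolding newton_det_def matrix_det_change_basis[OF u, of "\<lambda>j. newton_op smul l A j b"] weight_prod
    by (simp add: sqnorm_mult sqnorm_matrix_det_orthonormal[OF u] sqnorm_prod)
qed

definition omit :: "nat \<Rightarrow> (nat \<Rightarrow> 'a) \<Rightarrow> nat \<Rightarrow> 'a" where
  "omit i l q = (if q < i then l q else l (Suc q))"

lemma bij_betw_omit:
  assumes "i < k"
  shows "bij_betw (\<lambda>q. if q < i then q else Suc q) {..<k - 1} ({..<k} - {i})"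
  by (rule bij_betw_byWitness[where f' = "\<lambda>q. if q < i then q else q - 1"]) (use assms in auto)

lemma prod_omit:
  fixes x :: real
  assumes "i < k"
  shows "(\<Prod>q<k - 1. omit i l q - x) = (\<Prod>q\<in>{..<k} - {i}. l q - x)"
  unfolding prod.reindex_bij_betw[OF bij_betw_omit[OF assms], symmetric] omit_def
  by (rule prod.cong) auto

text \<open>The product of the operators \<open>l q - A\<close> over all \<open>q\<close> other than
  \<open>i\<close> kills every eigenvector except \<open>u i\<close>, and \<open>u i\<close> too if
  \<open>l i\<close> is a multiple eigenvalue. The sign accounts for the \<open>n - 1 - i\<close>
  factors with \<open>i < q\<close>. Individual weights thus become polynomial in \<open>A\<close>,
  the vector and the eigenvalues, although eigenvectors cannot be chosen continuously.\<close>

lemma weight_eq_newton_op: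
  assumes A: "selfadj A" and e: "eigenbasis A l u" and i: "i < n"
  shows "weight n l (\<lambda>i. sqnorm (ip b (u i))) i =
    (- 1) ^ (n - 1 - i) * fre (ip (newton_op smul (omit i l) A (n - 1) b) b)"
proof -
  note u = eigenbasisD(1)[OF e]
  have "ip (newton_op smul (omit i l) A (n - 1) b) b =
      (\<Sum>k<n. of_real (\<Prod>q\<in>{..<n} - {i}. l q - l k) * (ip b (u k) * cconj (ip b (u k))))"
    by (subst parseval[OF u])
      (simp add: ip_newton_op[OF A eigenbasisD(4)[OF e]] prod_omit[OF i, unfolded One_nat_def] mult.assoc del: of_real_prod)
  also have "\<dots> = (\<Sum>k<n. of_real ((\<Prod>q\<in>{..<n} - {i}. l q - l k) * sqnorm (ip b (u k))))"
    by (simp only: mult_cconj of_real_mult)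
  also have "\<dots> = (\<Sum>k<n. if k = i then of_real ((\<Prod>q\<in>{..<n} - {i}. l q - l k) * sqnorm (ip b (u k))) else 0)"
    by (intro sum.cong) (auto simp: prod_zero_iff)
  also have "\<dots> = of_real ((\<Prod>q\<in>{..<n} - {i}. l q - l i) * sqnorm (ip b (u i)))"
    using i by simp
  finally have 1: "fre (ip (newton_op smul (omit i l) A (n - 1) b) b) =
      (\<Prod>q\<in>{..<n} - {i}. l q - l i) * sqnorm (ip b (u i))" by (simp only: fre_fim_of_real)
  have un: "{..<n} - {i} = {..<i} \<union> {Suc i..<n}" using i by auto
  have split: "(\<Prod>q\<in>{..<n} - {i}. f q) = (\<Prod>q<i. f q) * (\<Prod>q\<in>{Suc i..<n}. f q)" for f :: "nat \<Rightarrow> real"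
    unfolding un by (rule prod.union_disjoint) (simp_all add: disjoint_iff)
  have d: "descending n l" by (rule eigenbasisD(2)[OF e])
  have "(\<Prod>q\<in>{Suc i..<n}. \<bar>l q - l i\<bar>) = (\<Prod>q\<in>{Suc i..<n}. (- 1) * (l q - l i))"
    using d by (intro prod.cong) (auto simp: descending_def)
  also have "\<dots> = (- 1) ^ (n - 1 - i) * (\<Prod>q\<in>{Suc i..<n}. l q - l i)"
    unfolding prod.distrib by simp
  moreover have "(\<Prod>q<i. \<bar>l q - l i\<bar>) = (\<Prod>q<i. l q - l i)"
    using d i by (intro prod.cong) (auto simp: descending_def)
  ultimately show ?thesis unfolding 1 weight_def split by simp
qed

end

section \<open>Power sums of descending sequences\<close>

text \<open>A polynomial vanishing at all values of both sequences but one isolates the multiplicity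
  of that value. Together the sequences have at most \<open>2 * n\<close> values, whence the bound
  on the exponents; the order turns equal multisets into equal sequences.\<close>

lemma descending_power_sums_unique:
  fixes l l' :: "nat \<Rightarrow> real"
  assumes d: "descending n l" "descending n l'"
    and eq: "\<And>j. j \<le> 2 * n \<Longrightarrow> (\<Sum>i<n. l i ^ j) = (\<Sum>i<n. l' i ^ j)"
    and i: "i < n"
  shows "l i = l' i"
proof -
  define Z where "Z = l ` {..<n} \<union> l' ` {..<n}"
  have fin: "finite Z" by (simp add: Z_def)
  have cZ: "card Z \<le> 2 * n"
    using card_Un_le[of "l ` {..<n}" "l' ` {..<n}"] card_image_le[of "{..<n}" l] card_image_le[of "{..<n}" l']
    by (simp add: Z_def)
  have poly_eq: "(\<Sum>i<n. poly p (l i)) = (\<Sum>i<n. poly p (l' i))" if "degree p \<le> 2 * n" for p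
  proof -
    have "(\<Sum>i<n. poly p (k i)) = (\<Sum>j\<le>degree p. coeff p j * (\<Sum>i<n. k i ^ j))" for k
      unfolding poly_altdef by (subst sum.swap) (simp add: sum_distrib_left)
    then show ?thesis using eq that by simp
  qed
  have cnt: "card {i\<in>{..<n}. l i = \<mu>} = card {i\<in>{..<n}. l' i = \<mu>}" for \<mu>
  proof (cases "\<mu> \<in> Z")
    case False
    then have "{i\<in>{..<n}. l i = \<mu>} = {}" "{i\<in>{..<n}. l' i = \<mu>} = {}" by (auto simp: Z_def)
    then show ?thesis by (simp only:)
  next
    case True
    define p where "p = (\<Prod>\<nu>\<in>Z - {\<mu>}. [:- \<nu>, 1:])"
    have "degree p \<le> (\<Sum>\<nu>\<in>Z - {\<mu>}. degree [:- \<nu>, 1:])"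
      using degree_prod_sum_le[of "Z - {\<mu>}" "\<lambda>\<nu>. [:- \<nu>, 1:]"] fin by (simp add: p_def comp_def)
    also have "\<dots> = card (Z - {\<mu>})" by simp
    also have "\<dots> \<le> 2 * n" using cZ card_mono[OF fin, of "Z - {\<mu>}"] by auto
    finally have e: "(\<Sum>i<n. poly p (l i)) = (\<Sum>i<n. poly p (l' i))" by (rule poly_eq)
    have p0: "poly p x = 0" if "x \<in> Z" "x \<noteq> \<mu>" for x
      using that fin by (auto simp: p_def poly_prod)
    have p1: "poly p \<mu> \<noteq> 0" using fin by (auto simp: p_def poly_prod)
    have "(\<Sum>i<n. poly p (k i)) = real (card {i\<in>{..<n}. k i = \<mu>}) * poly p \<mu>"
      if "k ` {..<n} \<subseteq> Z" for k
    proof -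
      have "(\<Sum>i<n. poly p (k i)) = (\<Sum>i<n. if k i = \<mu> then poly p \<mu> else 0)"
        using p0 that by (intro sum.cong) auto
      also have "\<dots> = (\<Sum>i\<in>{i\<in>{..<n}. k i = \<mu>}. poly p \<mu>)"
        by (rule sum.inter_filter[symmetric]) simp
      finally show ?thesis by simp
    qed
    from this[of l] this[of l'] e p1 show ?thesis by (auto simp: Z_def)
  qed
  have cm: "count (mset (map k [0..<n])) \<mu> = card {i\<in>{..<n}. k i = \<mu>}" for k :: "nat \<Rightarrow> real" and \<mu>
  proof (induction n)
    case (Suc n)
    have "{i\<in>{..<Suc n}. k i = \<mu>} = (if k n = \<mu> then insert n {i\<in>{..<n}. k i = \<mu>} else {i\<in>{..<n}. k i = \<mu>})"
      by (auto simp: less_Suc_eq)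
    then show ?case using Suc by (simp del: mset_map)
  qed simp
  have ms: "mset (rev (map l [0..<n])) = mset (rev (map l' [0..<n]))"
    by (rule multiset_eqI) (simp only: mset_rev cm cnt)
  have "sorted (rev (map k [0..<n]))" if "descending n k" for k
    unfolding sorted_rev_iff_nth_mono using that by (auto simp: descending_def order_le_less)
  then have "rev (map l [0..<n]) = rev (map l' [0..<n])"
    using properties_for_sort[OF ms] properties_for_sort[OF refl] d by metis
  then have "map l [0..<n] = map l' [0..<n]" by simp
  then show ?thesis using i by simp
qed

lemma descending_closed: "closed {l. descending n l}"
  unfolding descending_def
  by (intro closed_Collect_all closed_Collect_imp closed_Collect_le open_Collect_const)
    (auto intro: continuous_on_product_coordinates)

text \<open>On a compact set of descending sequences, the power sums form a continuous injection, so
  that its inverse is continuous, too.\<close>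

lemma continuous_map_descending:
  fixes l :: "'x \<Rightarrow> nat \<Rightarrow> real"
  assumes p: "\<And>j. continuous_map X euclideanreal (p j)"
    and l: "\<And>x. x \<in> topspace X \<Longrightarrow> descending n (l x)" "\<And>x i. x \<in> topspace X \<Longrightarrow> i \<ge> n \<Longrightarrow> l x i = 0"
    and eq: "\<And>x j. x \<in> topspace X \<Longrightarrow> p j x = (\<Sum>i<n. l x i ^ j)"
  shows "continuous_map X euclideanreal (\<lambda>x. l x i)"
proof -
  define K where "K R = Pi UNIV (\<lambda>_::nat. {-R..R::real}) \<inter> ({l. descending n l} \<inter> {l. \<forall>i. n \<le> i \<longrightarrow> l i = 0})" for R
  \<comment> \<open>The exponents kept are those used for injectivity; the target is a function
    space with its product topology.\<close>
  define P where "P l j = (if j \<le> 2 * n then \<Sum>i<n. l i ^ j else 0)" for l :: "nat \<Rightarrow> real" and j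
  have contP: "continuous_on S P" for S
  proof (rule continuous_on_coordinatewise_then_product)
    fix j
    have "continuous_on S (\<lambda>l::nat \<Rightarrow> real. \<Sum>i<n. l i ^ j)"
      by (intro continuous_on_sum continuous_on_power continuous_on_subset[OF continuous_on_product_coordinates]) auto
    then show "continuous_on S (\<lambda>l. P l j)" by (cases "j \<le> 2 * n") (simp_all add: P_def)
  qed
  have comp: "compact (K R)" for R
  proof -
    have "compact (PiE UNIV (\<lambda>_::nat. {-R..R::real}))"
      unfolding compactin_euclidean_iff[symmetric] euclidean_product_topology[symmetric] compactin_PiE by simp
    moreover have "closed {l::nat \<Rightarrow> real. \<forall>i. n \<le> i \<longrightarrow> l i = 0}"
      by (intro closed_Collect_all closed_Collect_imp closed_Collect_eq open_Collect_const)
        (auto intro: continuous_on_product_coordinates)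
    ultimately show ?thesis
      unfolding K_def using descending_closed
      by (intro compact_Int_closed closed_Int) (simp_all add: PiE_UNIV_domain)
  qed
  have inj: "inj_on P (K R)" for R
  proof (rule inj_onI, rule ext)
    fix k k' i assume k: "k \<in> K R" "k' \<in> K R" "P k = P k'"
    show "k i = k' i"
    proof (cases "i < n")
      case True
      have "(\<Sum>i<n. k i ^ j) = (\<Sum>i<n. k' i ^ j)" if "j \<le> 2 * n" for j
        using fun_cong[OF k(3), of j] that by (simp add: P_def)
      moreover have "descending n k" "descending n k'" using k by (auto simp: K_def)
      ultimately show ?thesis using descending_power_sums_unique[of n k k' i] True by blast
    qed (use k in \<open>auto simp: K_def\<close>)
  qed
  have g: "continuous_on (P ` K R) (inv_into (K R) P)" for R
    by (rule continuous_on_inv[OF contP comp]) (simp add: inv_into_f_f[OF inj])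
  have pm: "continuous_map X euclidean (\<lambda>x j. if j \<le> 2 * n then p j x else 0)"
    unfolding euclidean_product_topology[symmetric] continuous_map_componentwise_UNIV
  proof
    fix j show "continuous_map X euclideanreal (\<lambda>x. if j \<le> 2 * n then p j x else 0)"
      using p[of j] by (cases "j \<le> 2 * n") simp_all
  qed
  have P_eq: "(\<lambda>j. if j \<le> 2 * n then p j x else 0) = P (l x)" if "x \<in> topspace X" for x
    using eq[OF that] by (auto simp: P_def)
  \<comment> \<open>The sum of squares bounds every entry, so on this open set \<open>l\<close>
    takes values in \<open>K R\<close>. Such sets cover the space, and continuity is local.\<close>
  define U where "U R = {x \<in> topspace X. p 2 x \<in> {..<R\<^sup>2}}" for R :: real
  have openU: "openin X (U R)" for R
    unfolding U_def by (rule openin_continuous_map_preimage[OF p]) auto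
  have inK: "l x \<in> K R" if x: "x \<in> U R" and R: "R > 0" for x R
  proof -
    have "\<bar>l x i\<bar> \<le> R" for i
    proof (cases "i < n")
      case True
      have "(l x i)\<^sup>2 \<le> (\<Sum>i<n. (l x i)\<^sup>2)" using True by (intro member_le_sum) auto
      also have "\<dots> \<le> R\<^sup>2" using eq[of x 2] x by (auto simp: U_def)
      finally show ?thesis using R abs_le_square_iff[of "l x i" R] by simp
    next
      case False
      then show ?thesis using l(2)[of x i] x R by (simp add: U_def)
    qed
    then have "l x i \<in> {-R..R}" for i by (simp add: abs_le_iff minus_le_iff)
    then show ?thesis using l x by (auto simp: K_def U_def Pi_iff)
  qed
  have loc: "continuous_map (subtopology X (U R)) euclidean l" if R: "R > 0" for R
  proof -
    have "continuous_map (subtopology X (U R)) (top_of_set (P ` K R)) (\<lambda>x j. if j \<le> 2 * n then p j x else 0)"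
      using continuous_map_from_subtopology[OF pm, of "U R"]
      unfolding continuous_map_in_subtopology using inK[OF _ R] P_eq by (auto simp: U_def)
    moreover have "continuous_map (top_of_set (P ` K R)) euclidean (inv_into (K R) P)"
      using g by (simp add: continuous_map_iff_continuous)
    ultimately have "continuous_map (subtopology X (U R)) euclidean
        (inv_into (K R) P \<circ> (\<lambda>x j. if j \<le> 2 * n then p j x else 0))"
      by (rule continuous_map_compose)
    then show ?thesis
    proof (rule continuous_map_eq)
      fix x assume "x \<in> topspace (subtopology X (U R))"
      then have x: "x \<in> topspace X" "x \<in> U R" by auto
      then show "(inv_into (K R) P \<circ> (\<lambda>x j. if j \<le> 2 * n then p j x else 0)) x = l x"
        using P_eq inK[OF _ R] inv_into_f_f[OF inj] by simp
    qed
  qed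
  have cover: "\<exists>N::nat. x \<in> U (real (Suc N))" if "x \<in> topspace X" for x
  proof -
    obtain N :: nat where "p 2 x < real N" using reals_Archimedean2 by blast
    also have "real N \<le> (real (Suc N))\<^sup>2" by (simp add: power2_eq_square algebra_simps)
    finally show ?thesis using that by (auto simp: U_def)
  qed
  have "continuous_map X euclidean l"
    unfolding continuous_map_def
  proof (intro conjI allI impI)
    fix V :: "(nat \<Rightarrow> real) set" assume V: "openin euclidean V"
    have "openin X {x \<in> U (real (Suc N)). l x \<in> V}" for N :: nat
    proof (rule openin_trans_full[OF _ openU])
      have "openin (subtopology X (U (real (Suc N)))) {x \<in> topspace (subtopology X (U (real (Suc N)))). l x \<in> V}"
        using openin_continuous_map_preimage[OF loc V, of "real (Suc N)"] by simp
      then show "openin (subtopology X (U (real (Suc N)))) {x \<in> U (real (Suc N)). l x \<in> V}"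
        using openin_subset[OF openU] by (simp add: Int_absorb1 Int_absorb2)
    qed
    moreover have "{x \<in> topspace X. l x \<in> V} = (\<Union>N::nat. {x \<in> U (real (Suc N)). l x \<in> V})"
      using cover openin_subset[OF openU] by blast
    ultimately show "openin X {x \<in> topspace X. l x \<in> V}" by auto
  qed auto
  then show ?thesis
    unfolding euclidean_product_topology[symmetric] continuous_map_componentwise_UNIV by auto
qed

section \<open>Polynomial functions and semialgebraic sets\<close>

lemma function_algebra_polynomial_on: "function_algebra (polynomial_on X)"
  by unfold_locales (auto intro: polynomial_on.intros)

lemma function_algebra_continuous_map: "function_algebra (continuous_map X euclideanreal)"
  by unfold_locales (auto intro: continuous_intros)

lemma topspace_vs_topology: "topspace (vs_topology X) = pts X"
proof -
  have "lin_functional X (\<lambda>x. 0)" by (simp add: lin_functional_def)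
  then show ?thesis
    unfolding vs_topology_def topology_generated_by_topspace by blast
qed

lemma continuous_map_lin_functional:
  assumes "lin_functional X \<phi>"
  shows "continuous_map (vs_topology X) euclideanreal \<phi>"
  unfolding continuous_map_def topspace_vs_topology
proof (intro conjI allI impI)
  fix U :: "real set" assume "openin euclidean U"
  then show "openin (vs_topology X) {x \<in> pts X. \<phi> x \<in> U}"
    unfolding vs_topology_def using assms by (intro topology_generated_by_Basis) auto
qed auto

lemma lin_functional_fst:
  "lin_functional X \<phi> \<Longrightarrow> lin_functional (X \<oplus>\<^sub>R Y) (\<lambda>z. \<phi> (fst z))"
  by (auto simp: lin_functional_def direct_sum_def)

lemma lin_functional_snd:
  "lin_functional Y \<phi> \<Longrightarrow> lin_functional (X \<oplus>\<^sub>R Y) (\<lambda>z. \<phi> (snd z))"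
  by (auto simp: lin_functional_def direct_sum_def)

lemma pts_direct_sum: "pts (X \<oplus>\<^sub>R Y) = pts X \<times> pts Y"
  by (simp add: direct_sum_def)

lemma semialgebraic_conj:
  assumes "semialgebraic_set X {x \<in> pts X. A x}" "semialgebraic_set X {x \<in> pts X. B x}"
  shows "semialgebraic_set X {x \<in> pts X. A x \<and> B x}"
proof -
  have "{x \<in> pts X. A x \<and> B x} = {x \<in> pts X. A x} \<inter> {x \<in> pts X. B x}" by auto
  then show ?thesis using semialgebraic_set.inter[OF assms] by simp
qed

lemma semialgebraic_True: "semialgebraic_set X {x \<in> pts X. True}"
  using semialgebraic_set.eq[OF polynomial_on.const[of X 0]] by simp

lemma semialgebraic_ball:
  assumes "finite I" "\<And>i. i \<in> I \<Longrightarrow> semialgebraic_set X {x \<in> pts X. A i x}"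
  shows "semialgebraic_set X {x \<in> pts X. \<forall>i\<in>I. A i x}"
  using assms
proof (induction I)
  case empty
  then show ?case using semialgebraic_True by simp
next
  case (insert i I)
  then show ?case using semialgebraic_conj[of X "A i" "\<lambda>x. \<forall>i\<in>I. A i x"] by simp
qed

lemma semialgebraic_eq:
  assumes "polynomial_on X p" "polynomial_on X q"
  shows "semialgebraic_set X {x \<in> pts X. p x = q x}"
proof -
  interpret function_algebra "polynomial_on X" by (rule function_algebra_polynomial_on)
  have "polynomial_on X (\<lambda>x. p x - q x)" by (rule diff[OF assms])
  from semialgebraic_set.eq[OF this] show ?thesis by simp
qed

lemma semialgebraic_le:
  assumes "polynomial_on X p" "polynomial_on X q"
  shows "semialgebraic_set X {x \<in> pts X. p x \<le> q x}"
proof -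
  interpret function_algebra "polynomial_on X" by (rule function_algebra_polynomial_on)
  have "polynomial_on X (\<lambda>x. p x - q x)" by (rule diff[OF assms])
  from semialgebraic_set.compl[OF semialgebraic_set.pos[OF this]]
  have "semialgebraic_set X (pts X - {x \<in> pts X. p x - q x > 0})" .
  moreover have "{x \<in> pts X. p x \<le> q x} = pts X - {x \<in> pts X. p x - q x > 0}" by auto
  ultimately show ?thesis by simp
qed

lemma semialgebraic_descending:
  assumes "\<And>i. polynomial_on X (\<lambda>x. l x i)"
  shows "semialgebraic_set X {x \<in> pts X. descending n (l x)}"
proof -
  have "{x \<in> pts X. descending n (l x)} = {x \<in> pts X. \<forall>j\<in>{..<n}. \<forall>i\<in>{..<j}. l x j \<le> l x i}"
    by (auto simp: descending_def)
  then show ?thesis using assms by (simp, intro semialgebraic_ball semialgebraic_le) auto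
qed

subsection \<open>Coordinates\<close>

text \<open>A family of functionals that separates points and spans the dual: continuity of a map
  into \<open>Y\<close> and membership in its graph can be tested on it.\<close>

definition coordinates :: "'y real_space \<Rightarrow> nat \<Rightarrow> (nat \<Rightarrow> 'y \<Rightarrow> real) \<Rightarrow> bool" where
  "coordinates Y N \<kappa> \<longleftrightarrow> (\<forall>i<N. lin_functional Y (\<kappa> i)) \<and>
    (\<forall>y\<in>pts Y. \<forall>z\<in>pts Y. (\<forall>i<N. \<kappa> i y = \<kappa> i z) \<longrightarrow> y = z) \<and>
    (\<forall>\<phi>. lin_functional Y \<phi> \<longrightarrow> (\<exists>c. \<forall>y\<in>pts Y. \<phi> y = (\<Sum>i<N. c i * \<kappa> i y)))"

lemma continuous_map_coordinates:
  assumes Y: "coordinates Y N \<kappa>" and f: "f ` pts X \<subseteq> pts Y"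
    and cont: "\<And>i. i < N \<Longrightarrow> continuous_map (vs_topology X) euclideanreal (\<lambda>x. \<kappa> i (f x))"
  shows "continuous_map (vs_topology X) (vs_topology Y) f"
  unfolding vs_topology_def[of Y]
proof (rule continuous_on_generated_topo)
  interpret function_algebra "continuous_map (vs_topology X) euclideanreal"
    by (rule function_algebra_continuous_map)
  fix W assume "W \<in> {{y \<in> pts Y. \<phi> y \<in> U} |\<phi> U. lin_functional Y \<phi> \<and> open U}"
  then obtain \<phi> U where W: "W = {y \<in> pts Y. \<phi> y \<in> U}" "lin_functional Y \<phi>" "open U" by blast
  then obtain c where c: "\<And>y. y \<in> pts Y \<Longrightarrow> \<phi> y = (\<Sum>i<N. c i * \<kappa> i y)"
    using Y unfolding coordinates_def by meson
  have "continuous_map (vs_topology X) euclideanreal (\<lambda>x. \<Sum>i<N. c i * \<kappa> i (f x))"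
    using cont by (intro sum mult const) auto
  then have "openin (vs_topology X) {x \<in> topspace (vs_topology X). (\<Sum>i<N. c i * \<kappa> i (f x)) \<in> U}"
    using W by (intro openin_continuous_map_preimage) auto
  moreover have "{x \<in> topspace (vs_topology X). (\<Sum>i<N. c i * \<kappa> i (f x)) \<in> U} = f -` W \<inter> topspace (vs_topology X)"
    using f c by (auto simp: W topspace_vs_topology)
  ultimately show "openin (vs_topology X) (f -` W \<inter> topspace (vs_topology X))" by simp
next
  show "f ` topspace (vs_topology X) \<subseteq> \<Union> {{y \<in> pts Y. \<phi> y \<in> U} |\<phi> U. lin_functional Y \<phi> \<and> open U}"
    using f topspace_vs_topology[of Y] unfolding topspace_vs_topology vs_topology_def topology_generated_by_topspace
    by blast
qed

lemma lin_functional_coord_space: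
  assumes \<phi>: "lin_functional (coord_space m) \<phi>" and v: "v \<in> pts (coord_space m)"
  shows "\<phi> v = (\<Sum>i<m. \<phi> (\<lambda>j. if j = i then 1 else 0) * v i)"
proof -
  have add: "\<phi> (\<lambda>i. x i + y i) = \<phi> x + \<phi> y" if "\<forall>i\<ge>m. x i = 0" "\<forall>i\<ge>m. y i = 0" for x y
    using \<phi> that by (simp add: lin_functional_def coord_space_def)
  have scl: "\<phi> (\<lambda>i. c * x i) = c * \<phi> x" if "\<forall>i\<ge>m. x i = 0" for x c
    using \<phi> that by (simp add: lin_functional_def coord_space_def)
  have trunc: "(\<lambda>j. if j < m then v j else 0) = v" using v by (auto simp: coord_space_def)
  have "\<phi> (\<lambda>j. if j < k then v j else 0) = (\<Sum>i<k. \<phi> (\<lambda>j. if j = i then 1 else 0) * v i)" if "k \<le> m" for k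
    using that
  proof (induction k)
    case 0
    then show ?case using scl[of "\<lambda>_. 0" 0] by simp
  next
    case (Suc k)
    have "(\<lambda>j. if j < Suc k then v j else 0) =
        (\<lambda>j. (if j < k then v j else 0) + v k * (if j = k then 1 else 0))" by (auto simp: less_Suc_eq)
    then have "\<phi> (\<lambda>j. if j < Suc k then v j else 0) =
        \<phi> (\<lambda>j. if j < k then v j else 0) + \<phi> (\<lambda>j. v k * (if j = k then 1 else 0))"
      using Suc.prems by (simp only:) (rule add, auto)
    also have "\<phi> (\<lambda>j. v k * (if j = k then 1 else 0)) = v k * \<phi> (\<lambda>j. if j = k then 1 else 0)"
      by (rule scl) (use Suc.prems in auto)
    finally show ?case using Suc by simp
  qed
  from this[OF order_refl] show ?thesis
    unfolding trunc .
qed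

lemma coordinates_coord_space: "coordinates (coord_space m) m (\<lambda>i v. v i)"
  unfolding coordinates_def
proof (intro conjI allI impI ballI)
  fix v w :: "nat \<Rightarrow> real" assume vw: "v \<in> pts (coord_space m)" "w \<in> pts (coord_space m)" "\<forall>i<m. v i = w i"
  show "v = w"
  proof
    show "v i = w i" for i using vw by (cases "i < m") (auto simp: coord_space_def)
  qed
next
  fix \<phi> assume "lin_functional (coord_space m) \<phi>"
  then show "\<exists>c. \<forall>v\<in>pts (coord_space m). \<phi> v = (\<Sum>i<m. c i * v i)"
    using lin_functional_coord_space[of m \<phi>] by (intro exI[of _ "\<lambda>i. \<phi> (\<lambda>j. if j = i then 1 else 0)"]) blast
qed (simp add: lin_functional_def coord_space_def)

text \<open>Over the reals the last coordinate is constantly 0, so that the same number of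
  coordinates serves both fields.\<close>

definition coord_field_coordinate :: "nat \<Rightarrow> nat \<Rightarrow> (nat \<Rightarrow> real) \<times> 'f::real_or_complex \<Rightarrow> real" where
  "coord_field_coordinate m i y = (if i < m then fst y i else if i = m then fre (snd y) else fim (snd y))"

lemma coordinates_coord_field:
  "coordinates (coord_space m \<oplus>\<^sub>R (field_space :: 'f::real_or_complex real_space)) (m + 2)
    (coord_field_coordinate m)"
  unfolding coordinates_def
proof (intro conjI allI impI ballI)
  let ?Y = "coord_space m \<oplus>\<^sub>R (field_space :: 'f real_space)"
  fix i
  have "fre (c *\<^sub>R z) = c * fre z" "fim (c *\<^sub>R z) = c * fim z" for c and z :: 'f
    by (simp_all add: scaleR_conv_of_real)
  then show "lin_functional ?Y (coord_field_coordinate m i)"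
    by (auto simp: lin_functional_def coord_space_def field_space_def direct_sum_def coord_field_coordinate_def)
next
  let ?Y = "coord_space m \<oplus>\<^sub>R (field_space :: 'f real_space)"
  fix y z assume yz: "y \<in> pts ?Y" "z \<in> pts ?Y"
    and eq: "\<forall>i<m + 2. coord_field_coordinate m i y = coord_field_coordinate m i z"
  have "fst y i = fst z i" for i
    using eq[rule_format, of i] yz
    by (cases "i < m") (auto simp: coord_field_coordinate_def direct_sum_def coord_space_def)
  moreover have "snd y = snd z"
    using eq[rule_format, of m] eq[rule_format, of "Suc m"]
    by (auto simp: coord_field_coordinate_def intro: field_eqI[of "snd y" "snd z"])
  ultimately show "y = z" by (intro prod_eqI ext) auto
next
  let ?Y = "coord_space m \<oplus>\<^sub>R (field_space :: 'f real_space)"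
  fix \<phi> assume \<phi>: "lin_functional ?Y \<phi>"
  have add: "\<phi> (\<lambda>i. fst y i + fst z i, snd y + snd z) = \<phi> y + \<phi> z" if "y \<in> pts ?Y" "z \<in> pts ?Y" for y z
    using \<phi> that by (auto simp: lin_functional_def direct_sum_def coord_space_def field_space_def)
  have scl: "\<phi> (\<lambda>i. c * fst y i, c *\<^sub>R snd y) = c * \<phi> y" if "y \<in> pts ?Y" for y c
    using \<phi> that by (auto simp: lin_functional_def direct_sum_def coord_space_def field_space_def)
  have zero: "(\<lambda>i. 0, l) \<in> pts ?Y" for l by (simp add: direct_sum_def coord_space_def field_space_def)
  have in0: "(v, 0) \<in> pts ?Y" if "v \<in> pts (coord_space m)" for v
    using that by (simp add: direct_sum_def field_space_def)
  have lf: "lin_functional (coord_space m) (\<lambda>v. \<phi> (v, 0))"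
    unfolding lin_functional_def
  proof (intro conjI ballI allI)
    fix v w assume "v \<in> pts (coord_space m)" "w \<in> pts (coord_space m)"
    then show "\<phi> (real_space.add (coord_space m) v w, 0) = \<phi> (v, 0) + \<phi> (w, 0)"
      using add[OF in0 in0, of v w] by (simp add: coord_space_def)
  next
    fix c v assume "v \<in> pts (coord_space m)"
    then show "\<phi> (real_space.scl (coord_space m) c v, 0) = c * \<phi> (v, 0)"
      using scl[OF in0, of v c] by (simp add: coord_space_def)
  qed
  define e :: "nat \<Rightarrow> nat \<Rightarrow> real" where "e i j = (if j = i then 1 else 0)" for i j
  define c where "c i = (if i < m then \<phi> (e i, 0) else if i = m then \<phi> (\<lambda>_. 0, 1) else \<phi> (\<lambda>_. 0, imag_unit))" for i
  have "\<phi> y = (\<Sum>i<m + 2. c i * coord_field_coordinate m i y)" if y: "y \<in> pts ?Y" for y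
  proof -
    obtain v l where vl: "y = (v, l)" by (cases y)
    have v: "v \<in> pts (coord_space m)" using y vl by (simp add: direct_sum_def)
    have "\<phi> y = \<phi> (v, 0) + \<phi> (\<lambda>_. 0, l)"
      using add[OF in0[OF v] zero[of l]] by (simp add: vl)
    also have "\<phi> (v, 0) = (\<Sum>i<m. \<phi> (e i, 0) * v i)"
      unfolding e_def[abs_def] by (rule lin_functional_coord_space[OF lf v])
    also have "\<phi> (\<lambda>_. 0, l) = fre l * \<phi> (\<lambda>_. 0, 1) + fim l * \<phi> (\<lambda>_. 0, imag_unit)"
    proof -
      have "l = fre l *\<^sub>R 1 + fim l *\<^sub>R imag_unit"
        using real_imag_decomposition[of l] by (simp add: scaleR_conv_of_real)
      then have "\<phi> (\<lambda>_. 0, l) = \<phi> (\<lambda>_. 0, fre l *\<^sub>R 1 + fim l *\<^sub>R imag_unit)" by (rule arg_cong)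
      also have "\<dots> = \<phi> (\<lambda>_. 0, fre l *\<^sub>R 1) + \<phi> (\<lambda>_. 0, fim l *\<^sub>R imag_unit)"
        using add[OF zero[of "fre l *\<^sub>R 1"] zero[of "fim l *\<^sub>R imag_unit"]] by simp
      also have "\<dots> = fre l * \<phi> (\<lambda>_. 0, 1) + fim l * \<phi> (\<lambda>_. 0, imag_unit)"
        using scl[OF zero[of 1], of "fre l"] scl[OF zero[of imag_unit], of "fim l"] by simp
      finally show ?thesis .
    qed
    finally show ?thesis
      by (simp add: c_def coord_field_coordinate_def vl lessThan_Suc numeral_2_eq_2)
  qed
  then show "\<exists>c. \<forall>y\<in>pts ?Y. \<phi> y = (\<Sum>i<m + 2. c i * coord_field_coordinate m i y)"
    by (intro exI[of _ c] ballI)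
qed

section \<open>The representation space\<close>

context inner_product_space
begin

lemma trace_pow_1: "trace_pow A 1 = (\<Sum>i<n. fre (ip (A (basis i)) (basis i)))"
  by (simp add: trace_pow_def)

lemma eigenvalues_unique:
  assumes A: "selfadj A" and e: "eigenbasis A l u"
  shows "eigenvalues A = l"
proof -
  obtain v where v: "eigenbasis A (eigenvalues A) v" using eigenbasis_eigenvalues[OF A] by blast
  show ?thesis
  proof
    fix i
    show "eigenvalues A i = l i"
    proof (cases "i < n")
      case True
      have "(\<Sum>i<n. eigenvalues A i ^ j) = (\<Sum>i<n. l i ^ j)" for j
        using trace_pow_eq[OF A v] trace_pow_eq[OF A e] by simp
      then show ?thesis
        using descending_power_sums_unique[OF eigenbasisD(2)[OF v] eigenbasisD(2)[OF e]] True by blast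
    next
      case False
      then show ?thesis using eigenbasisD(3)[OF v, of i] eigenbasisD(3)[OF e, of i] by simp
    qed
  qed
qed

definition conjugate :: "('w \<Rightarrow> 'w) \<Rightarrow> ('w \<Rightarrow> 'w) \<Rightarrow> 'w \<Rightarrow> 'w" where
  "conjugate C A z = C (A (inv_into UNIV C z))"

lemma conjugate_apply: "unitary C \<Longrightarrow> conjugate C A (C z) = C (A z)"
  by (simp add: conjugate_def)

lemma selfadj_conjugate:
  assumes "unitary C" "selfadj A"
  shows "selfadj (conjugate C A)"
proof -
  note lins = unitary_lin[OF assms(1)] selfadj_lin[OF assms(2)] unitary_lin[OF unitary_inverse[OF assms(1)]]
  have "lin (conjugate C A)"
    by (rule linI) (simp_all add: conjugate_def lin_add[OF lins(1)] lin_add[OF lins(2)] lin_add[OF lins(3)]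
        lin_scale[OF lins(1)] lin_scale[OF lins(2)] lin_scale[OF lins(3)])
  moreover have "ip (conjugate C A x) y = ip x (conjugate C A y)" for x y
    using unitary_ip[OF assms(1), of "inv_into UNIV C x" "A (inv_into UNIV C y)"] assms
    by (simp add: conjugate_def unitary_ip_inv selfadj_ip)
  ultimately show ?thesis by (simp add: selfadj_def)
qed

lemma eigenbasis_conjugate:
  assumes "unitary C" "eigenbasis A l u"
  shows "eigenbasis (conjugate C A) l (\<lambda>i. C (u i))"
  using assms by (auto simp: eigenbasis_def conjugate_apply lin_scale unitary_lin unitary_orthonormal)

lemma eigenvalues_conjugate:
  assumes "unitary C" "selfadj A"
  shows "eigenvalues (conjugate C A) = eigenvalues A"
proof -
  obtain u where "eigenbasis A (eigenvalues A) u" using eigenbasis_eigenvalues[OF assms(2)] by blast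
  from eigenvalues_unique[OF selfadj_conjugate[OF assms] eigenbasis_conjugate[OF assms(1) this]]
  show ?thesis .
qed

lemma trace_pow_conjugate:
  assumes "unitary C" "selfadj A"
  shows "trace_pow (conjugate C A) j = trace_pow A j"
proof -
  obtain u where u: "eigenbasis A (eigenvalues A) u" using eigenbasis_eigenvalues[OF assms(2)] by blast
  show ?thesis
    using trace_pow_eq[OF assms(2) u] trace_pow_eq[OF selfadj_conjugate[OF assms] eigenbasis_conjugate[OF assms(1) u]]
    by simp
qed

section \<open>Representatives of trace zero modulo scalars\<close>

definition scalar_coset :: "('w \<Rightarrow> 'w) \<Rightarrow> ('w \<Rightarrow> 'w) set" where
  "scalar_coset A = {\<lambda>x. A x + smul (of_real c) x | c. True}"

definition traceless :: "('w \<Rightarrow> 'w) \<Rightarrow> 'w \<Rightarrow> 'w" where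
  "traceless A x = A x - smul (of_real (trace_pow A 1 / real n)) x"

text \<open>The representative of trace 0, a linear section of the quotient by the scalars. The
  default value keeps it selfadjoint on arbitrary sets, as required where expressions are evaluated
  over a whole type.\<close>

definition reduced :: "('w \<Rightarrow> 'w) set \<Rightarrow> 'w \<Rightarrow> 'w" where
  "reduced P = (if \<exists>A\<in>P. selfadj A then traceless (SOME A. A \<in> P \<and> selfadj A) else (\<lambda>_. 0))"

lemma selfadj_add_scalar:
  assumes "selfadj A"
  shows "selfadj (\<lambda>x. A x + smul (of_real c) x)"
  unfolding selfadj_def
proof (intro conjI allI)
  show "lin (\<lambda>x. A x + smul (of_real c) x)"
    by (rule linI) (simp_all add: lin_add lin_scale selfadj_lin assms scale_right_distrib mult.commute)
qed (simp add: ip_simps selfadj_ip assms)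

lemma selfadj_traceless: "selfadj A \<Longrightarrow> selfadj (traceless A)"
  using selfadj_add_scalar[of A "- (trace_pow A 1 / real n)"]
  by (simp add: traceless_def[abs_def])

lemma selfadj_zero: "selfadj (\<lambda>_. 0)"
  by (auto simp: selfadj_def intro!: linI)

lemma selfadj_reduced: "selfadj (reduced P)"
proof (cases "\<exists>A\<in>P. selfadj A")
  case True
  then have "selfadj (SOME A. A \<in> P \<and> selfadj A)" by (metis (mono_tags, lifting) someI_ex)
  then show ?thesis using True by (simp add: reduced_def selfadj_traceless)
next
  case False
  then show ?thesis by (simp add: reduced_def selfadj_zero)
qed

lemma trace_add_scalar:
  "trace_pow (\<lambda>x. A x + smul (of_real c) x) 1 = trace_pow A 1 + real n * c"
  unfolding trace_pow_1
  using orthonormal_ip[OF orthonormal_basis] by (simp add: ip_add ip_scale sum.distrib)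

lemma trace_traceless: "trace_pow (traceless A) 1 = 0"
proof -
  have "traceless A = (\<lambda>x. A x + smul (of_real (- (trace_pow A 1 / real n))) x)"
    by (simp add: traceless_def fun_eq_iff)
  then have "trace_pow (traceless A) 1 = trace_pow A 1 + real n * (- (trace_pow A 1 / real n))"
    by (simp only: trace_add_scalar)
  also have "\<dots> = 0" by (cases "n = 0") (simp_all add: trace_pow_def)
  finally show ?thesis .
qed

lemma traceless_add_scalar: "traceless (\<lambda>x. A x + smul (of_real c) x) = traceless A"
proof (cases "n = 0")
  case True
  then show ?thesis by (intro ext eq_if_coeffs_eq[OF orthonormal_basis]) simp
next
  case False
  have "(trace_pow A 1 + real n * c) / real n = trace_pow A 1 / real n + c"
    using False by (simp add: field_simps)
  then show ?thesis
    unfolding traceless_def trace_add_scalar by (auto simp: scale_left_distrib fun_eq_iff simp del: of_real_divide)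
qed

text \<open>The choice made by \<open>reduced\<close> is immaterial, as all candidates differ by
  scalars, to which \<open>traceless\<close> is insensitive.\<close>

lemma reduced_eqI:
  assumes "A \<in> P" "selfadj A" "\<And>A'. A' \<in> P \<Longrightarrow> \<exists>c. A' = (\<lambda>x. A x + smul (of_real c) x)"
  shows "reduced P = traceless A"
proof -
  define A' where "A' = (SOME A. A \<in> P \<and> selfadj A)"
  have "A' \<in> P \<and> selfadj A'" unfolding A'_def by (rule someI[of _ A]) (use assms in simp)
  then obtain c where "A' = (\<lambda>x. A x + smul (of_real c) x)" using assms(3) by blast
  then have "traceless A' = traceless A" by (simp only: traceless_add_scalar)
  then show ?thesis using assms by (auto simp: reduced_def A'_def)
qed

lemma mem_scalar_coset: "A \<in> scalar_coset A"
proof -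
  have "A = (\<lambda>x. A x + smul (of_real 0) x)" by simp
  then show ?thesis unfolding scalar_coset_def by blast
qed

lemma reduced_scalar_coset: "selfadj A \<Longrightarrow> reduced (scalar_coset A) = traceless A"
  by (rule reduced_eqI) (auto simp: mem_scalar_coset, auto simp: scalar_coset_def)

lemma scalar_coset_add_scalar:
  "scalar_coset (\<lambda>x. A x + smul (of_real c) x) = scalar_coset A"
proof -
  have "(\<lambda>x. (A x + smul (of_real c) x) + smul (of_real d) x) = (\<lambda>x. A x + smul (of_real (c + d)) x)" for d
    by (simp add: scale_left_distrib add.assoc)
  moreover have "(\<lambda>x. A x + smul (of_real d) x) = (\<lambda>x. A x + smul (of_real c) x + smul (of_real (d - c)) x)" for d
    by (simp add: add.assoc flip: scale_left_distrib of_real_add)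
  ultimately show ?thesis unfolding scalar_coset_def by (auto; metis)
qed

lemma scalar_coset_reduced:
  assumes "selfadj A"
  shows "scalar_coset (reduced (scalar_coset A)) = scalar_coset A"
proof -
  have "traceless A = (\<lambda>x. A x + smul (of_real (- (trace_pow A 1 / real n))) x)"
    by (simp add: traceless_def fun_eq_iff)
  then show ?thesis
    unfolding reduced_scalar_coset[OF assms] by (simp only: scalar_coset_add_scalar)
qed

lemma conjugate_scalar_coset:
  assumes "unitary C"
  shows "(\<lambda>A. C \<circ> A \<circ> inv_into UNIV C) ` scalar_coset A = scalar_coset (conjugate C A)"
proof -
  have "C \<circ> (\<lambda>x. A x + smul (of_real c) x) \<circ> inv_into UNIV C = (\<lambda>x. conjugate C A x + smul (of_real c) x)" for c
    using assms by (simp add: fun_eq_iff conjugate_def lin_add lin_scale unitary_lin)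
  moreover have "scalar_coset A = range (\<lambda>c x. A x + smul (of_real c) x)" for A
    by (auto simp: scalar_coset_def)
  ultimately show ?thesis by (simp add: image_image)
qed

lemma traceless_conjugate:
  assumes "unitary C" "selfadj A"
  shows "traceless (conjugate C A) = conjugate C (traceless A)"
  using assms
  by (auto simp: traceless_def trace_pow_conjugate fun_eq_iff conjugate_def lin_diff lin_scale unitary_lin)

section \<open>Points of the representation space, the action and linear functionals\<close>

definition column :: "('f ^ 'k \<Rightarrow> 'w) \<Rightarrow> 'k \<Rightarrow> 'w" where
  "column B c = B (axis c 1)"

lemma coset_eq_scalar_coset: "coset (S_space smul ip) (real_multiples_E smul) A = scalar_coset A"
  by (auto simp: coset_def S_space_def real_multiples_E_def scalar_coset_def)

lemma pts_rep_space:
  "pts (rep_space smul ip) =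
    {(P, B). (\<exists>A. selfadj A \<and> P = scalar_coset A) \<and> Vector_Spaces.linear (*s) smul B}"
proof -
  have S: "pts (S_space smul ip) = {A. selfadj A}"
    by (auto simp: S_space_def selfadj_iff)
  have "pts (rep_space smul ip) = (coset (S_space smul ip) (real_multiples_E smul) ` pts (S_space smul ip)) \<times>
      {B. Vector_Spaces.linear (*s) smul B}"
    by (simp add: rep_space_def quotient_space_def direct_sum_def Hom_space_def)
  then show ?thesis unfolding S coset_eq_scalar_coset by auto
qed

lemma rep_space_cases:
  assumes "x \<in> pts (rep_space smul ip)"
  obtains A where "selfadj A" "trace_pow A 1 = 0" "fst x = scalar_coset A" "reduced (fst x) = A"
    "Vector_Spaces.linear (*s) smul (snd x)"
proof -
  obtain A where A: "selfadj A" "fst x = scalar_coset A" "Vector_Spaces.linear (*s) smul (snd x)"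
    using assms unfolding pts_rep_space by (cases x) auto
  show ?thesis
  proof (rule that)
    show "selfadj (reduced (fst x))" by (rule selfadj_reduced)
    show "trace_pow (reduced (fst x)) 1 = 0" using A by (simp only: reduced_scalar_coset trace_traceless)
    show "fst x = scalar_coset (reduced (fst x))" using A by (simp only: scalar_coset_reduced)
  qed (use A in auto)
qed

lemma linear_expand:
  fixes B :: "'f ^ 'k \<Rightarrow> 'w"
  assumes "Vector_Spaces.linear (*s) smul B"
  shows "B x = (\<Sum>c\<in>UNIV. smul (vec_nth x c) (column B c))"
proof -
  interpret B: Vector_Spaces.linear "(*s) :: 'f \<Rightarrow> 'f ^ 'k \<Rightarrow> 'f ^ 'k" smul B by (rule assms)
  have "B x = B (\<Sum>c\<in>UNIV. vec_nth x c *s axis c 1)" by (simp only: basis_expansion)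
  then show ?thesis by (simp add: B.sum B.scale column_def)
qed

lemma linear_of_columns:
  fixes b :: "'k::finite \<Rightarrow> 'w"
  defines "B \<equiv> \<lambda>x :: 'f ^ 'k. \<Sum>c\<in>UNIV. smul (vec_nth x c) (b c)"
  shows "Vector_Spaces.linear (*s) smul B" "column B = b"
proof -
  show "Vector_Spaces.linear (*s) smul B"
    unfolding Vector_Spaces.linear_iff
    using vector_space_axioms vec.vector_space_axioms
    by (auto simp: B_def scale_left_distrib sum.distrib scale_sum_right)
  show "column B = b"
  proof
    fix d
    have "column B d = (\<Sum>c\<in>UNIV. if c = d then b c else 0)"
      unfolding column_def B_def axis_def by (intro sum.cong) auto
    then show "column B d = b d" by simp
  qed
qed

lemma rep_point_exists:
  fixes b :: "'k::finite \<Rightarrow> 'w"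
  assumes "selfadj A" "trace_pow A 1 = 0"
  shows "\<exists>x\<in>pts (rep_space smul ip :: (('w \<Rightarrow> 'w) set \<times> ('f ^ 'k \<Rightarrow> 'w)) real_space).
    reduced (fst x) = A \<and> column (snd x) = b"
proof
  let ?x = "(scalar_coset A, \<lambda>x :: 'f ^ 'k. \<Sum>c\<in>UNIV. smul (vec_nth x c) (b c))"
  show "?x \<in> pts (rep_space smul ip)"
    unfolding pts_rep_space using assms linear_of_columns(1) by auto
  have "traceless A = A" by (simp add: traceless_def fun_eq_iff assms del: One_nat_def)
  then show "reduced (fst ?x) = A \<and> column (snd ?x) = b"
    by (simp add: reduced_scalar_coset assms linear_of_columns(2))
qed

lemma act_rep_space:
  fixes x :: "('w \<Rightarrow> 'w) set \<times> ('f ^ 'k \<Rightarrow> 'w)"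
  assumes C: "unitary C" and x: "x \<in> pts (rep_space smul ip)"
  shows "reduced (fst (act C x)) = conjugate C (reduced (fst x))"
    "column (snd (act C x)) c = C (column (snd x) c)"
    "act C x \<in> pts (rep_space smul ip)"
proof -
  obtain A where A: "selfadj A" "trace_pow A 1 = 0" "fst x = scalar_coset A" "reduced (fst x) = A"
    "Vector_Spaces.linear (*s) smul (snd x)" by (rule rep_space_cases[OF x])
  have fst: "fst (act C x) = scalar_coset (conjugate C A)"
    using A conjugate_scalar_coset[OF C] by (simp add: act_def case_prod_unfold)
  have "traceless A = A" by (simp add: traceless_def fun_eq_iff A(2) del: One_nat_def)
  then show "reduced (fst (act C x)) = conjugate C (reduced (fst x))"
    unfolding fst using A C by (simp add: reduced_scalar_coset selfadj_conjugate traceless_conjugate)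
  show "column (snd (act C x)) c = C (column (snd x) c)"
    by (simp add: column_def act_def case_prod_unfold)
  have "Vector_Spaces.linear (*s) smul (C \<circ> snd x)"
    using A(5) unitary_lin[OF C] unfolding Vector_Spaces.linear_iff by auto
  then show "act C x \<in> pts (rep_space smul ip)"
    unfolding pts_rep_space using fst selfadj_conjugate[OF C A(1)] by (auto simp: act_def case_prod_unfold)
qed

lemma rep_point_eq_act:
  fixes x y :: "('w \<Rightarrow> 'w) set \<times> ('f ^ 'k \<Rightarrow> 'w)"
  assumes C: "unitary C" and x: "x \<in> pts (rep_space smul ip)" and y: "y \<in> pts (rep_space smul ip)"
    and A: "\<And>z. C (reduced (fst x) z) = reduced (fst y) (C z)"
    and b: "\<And>c. C (column (snd x) c) = column (snd y) c"
  shows "y = act C x"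
proof (rule prod_eqI)
  note Cx = act_rep_space[OF C x]
  have "conjugate C (reduced (fst x)) = reduced (fst y)"
    using C by (simp add: conjugate_def A fun_eq_iff)
  then have "scalar_coset (reduced (fst (act C x))) = scalar_coset (reduced (fst y))"
    using Cx(1) by simp
  then show "fst y = fst (act C x)"
    using rep_space_cases[OF Cx(3)] rep_space_cases[OF y] by metis
  have "snd y v = snd (act C x) v" for v
    using linear_expand[of "snd y" v] linear_expand[of "snd (act C x)" v] Cx(2,3) y b
    unfolding pts_rep_space by (simp add: case_prod_unfold)
  then show "snd y = snd (act C x)" by auto
qed

text \<open>\<open>h\<close> will be the real or the imaginary part. Sums and multiples of cosets
  are formed as sets of operators, but each stays in a single class modulo scalars, and the trace is
  linear; so the representatives of trace 0 add and scale.\<close>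

lemma lin_functional_reduced:
  fixes h :: "'f \<Rightarrow> real"
  assumes h: "\<And>z w. h (z + w) = h z + h w" "\<And>c z. h (of_real c * z) = c * h z"
  shows "lin_functional (rep_space smul ip) (\<lambda>x. h (ip (reduced (fst x) v) w))"
proof -
  have add: "reduced {\<lambda>z. A' z + D' z | A' D'. A' \<in> scalar_coset A \<and> D' \<in> scalar_coset D} =
      (\<lambda>z. reduced (scalar_coset A) z + reduced (scalar_coset D) z)"
    if AD: "selfadj A" "selfadj D" for A D
  proof -
    have "reduced {\<lambda>z. A' z + D' z | A' D'. A' \<in> scalar_coset A \<and> D' \<in> scalar_coset D} =
        traceless (\<lambda>z. A z + D z)"
    proof (rule reduced_eqI)
      show "(\<lambda>z. A z + D z) \<in> {\<lambda>z. A' z + D' z | A' D'. A' \<in> scalar_coset A \<and> D' \<in> scalar_coset D}"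
        using mem_scalar_coset by blast
      show "selfadj (\<lambda>z. A z + D z)"
        unfolding selfadj_def
      proof (intro conjI allI)
        show "lin (\<lambda>z. A z + D z)"
          by (rule linI) (simp_all add: lin_add selfadj_lin AD lin_scale scale_right_distrib)
      qed (simp add: ip_simps selfadj_ip AD)
      fix E assume "E \<in> {\<lambda>z. A' z + D' z | A' D'. A' \<in> scalar_coset A \<and> D' \<in> scalar_coset D}"
      then obtain c d where "E = (\<lambda>z. (A z + smul (of_real c) z) + (D z + smul (of_real d) z))"
        by (auto simp: scalar_coset_def)
      then have "E = (\<lambda>z. (A z + D z) + smul (of_real (c + d)) z)"
        by (simp add: scale_left_distrib fun_eq_iff add_ac)
      then show "\<exists>c. E = (\<lambda>z. (A z + D z) + smul (of_real c) z)" by blast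
    qed
    moreover have "trace_pow (\<lambda>z. A z + D z) 1 = trace_pow A 1 + trace_pow D 1"
      unfolding trace_pow_1 by (simp add: ip_add sum.distrib)
    ultimately show ?thesis
      using AD by (simp add: reduced_scalar_coset traceless_def add_divide_distrib scale_left_distrib fun_eq_iff
          del: One_nat_def)
  qed
  have scl: "reduced {\<lambda>z. smul (of_real c) (A' z) + N z | A' N. A' \<in> scalar_coset A \<and> N \<in> real_multiples_E smul} =
      (\<lambda>z. smul (of_real c) (reduced (scalar_coset A) z))"
    if A: "selfadj A" for A c
  proof -
    have "reduced {\<lambda>z. smul (of_real c) (A' z) + N z | A' N. A' \<in> scalar_coset A \<and> N \<in> real_multiples_E smul} =
        traceless (\<lambda>z. smul (of_real c) (A z))"
    proof (rule reduced_eqI)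
      have "(\<lambda>z. smul (of_real 0) z) \<in> real_multiples_E smul" unfolding real_multiples_E_def by blast
      moreover have "(\<lambda>z. smul (of_real c) (A z)) = (\<lambda>z. smul (of_real c) (A z) + smul (of_real 0) z)" by simp
      ultimately show "(\<lambda>z. smul (of_real c) (A z)) \<in>
          {\<lambda>z. smul (of_real c) (A' z) + N z | A' N. A' \<in> scalar_coset A \<and> N \<in> real_multiples_E smul}"
        using mem_scalar_coset by blast
      show "selfadj (\<lambda>z. smul (of_real c) (A z))"
        unfolding selfadj_def
      proof (intro conjI allI)
        show "lin (\<lambda>z. smul (of_real c) (A z))"
          by (rule linI) (simp_all add: lin_add selfadj_lin A lin_scale scale_right_distrib mult.commute)
      qed (simp add: ip_simps selfadj_ip A)
      fix E assume "E \<in> {\<lambda>z. smul (of_real c) (A' z) + N z | A' N. A' \<in> scalar_coset A \<and> N \<in> real_multiples_E smul}"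
      then obtain d e where "E = (\<lambda>z. smul (of_real c) (A z + smul (of_real d) z) + smul (of_real e) z)"
        by (auto simp: scalar_coset_def real_multiples_E_def)
      then have "E = (\<lambda>z. smul (of_real c) (A z) + smul (of_real (c * d + e)) z)"
        by (simp add: scale_left_distrib scale_right_distrib fun_eq_iff add_ac)
      then show "\<exists>d. E = (\<lambda>z. smul (of_real c) (A z) + smul (of_real d) z)" by blast
    qed
    moreover have "trace_pow (\<lambda>z. smul (of_real c) (A z)) 1 = c * trace_pow A 1"
      unfolding trace_pow_1 by (simp add: ip_scale sum_distrib_left)
    ultimately show ?thesis
      using A by (simp add: reduced_scalar_coset traceless_def scale_right_diff_distrib fun_eq_iff
          del: One_nat_def)
  qed
  show ?thesis
    unfolding lin_functional_def
  proof (intro conjI ballI allI)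
    fix x y :: "('w \<Rightarrow> 'w) set \<times> ('f ^ 'k \<Rightarrow> 'w)"
    assume "x \<in> pts (rep_space smul ip)" "y \<in> pts (rep_space smul ip)"
    then obtain A D where AD: "selfadj A" "fst x = scalar_coset A" "selfadj D" "fst y = scalar_coset D"
      by (metis rep_space_cases)
    have "fst (real_space.add (rep_space smul ip) x y) =
        {\<lambda>z. A' z + D' z | A' D'. A' \<in> scalar_coset A \<and> D' \<in> scalar_coset D}"
      by (simp add: rep_space_def direct_sum_def quotient_space_def S_space_def case_prod_unfold AD)
    then show "h (ip (reduced (fst (real_space.add (rep_space smul ip) x y)) v) w) =
        h (ip (reduced (fst x) v) w) + h (ip (reduced (fst y) v) w)"
      by (simp add: add AD ip_add h)
  next
    fix c and x :: "('w \<Rightarrow> 'w) set \<times> ('f ^ 'k \<Rightarrow> 'w)"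
    assume "x \<in> pts (rep_space smul ip)"
    then obtain A where A: "selfadj A" "fst x = scalar_coset A" by (metis rep_space_cases)
    have "fst (real_space.scl (rep_space smul ip) c x) =
        {\<lambda>z. smul (of_real c) (A' z) + N z | A' N. A' \<in> scalar_coset A \<and> N \<in> real_multiples_E smul}"
      by (simp add: rep_space_def direct_sum_def quotient_space_def S_space_def case_prod_unfold A)
    then show "h (ip (reduced (fst (real_space.scl (rep_space smul ip) c x)) v) w) =
        c * h (ip (reduced (fst x) v) w)"
      by (simp add: scl A ip_scale h)
  qed
qed

lemma lin_functional_column:
  fixes h :: "'f \<Rightarrow> real"
  assumes h: "\<And>z w. h (z + w) = h z + h w" "\<And>c z. h (of_real c * z) = c * h z"
  shows "lin_functional (rep_space smul ip) (\<lambda>x. h (ip (column (snd x) c) w))"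
  by (auto simp: lin_functional_def rep_space_def direct_sum_def Hom_space_def column_def ip_add ip_scale h)

lemma QW_coordinate_functions:
  assumes Q: "function_algebra Q"
    and lf: "\<And>\<phi>. lin_functional (rep_space smul ip :: (('w \<Rightarrow> 'w) set \<times> ('f ^ 'k \<Rightarrow> 'w)) real_space) \<phi> \<Longrightarrow> Q (\<lambda>z. \<phi> (g z))"
  shows "QW Q (\<lambda>z. reduced (fst (g z)) v)" "QW Q (\<lambda>z. column (snd (g z)) c)"
proof -
  interpret function_algebra Q by (rule Q)
  have f: "fre (of_real c * z) = c * fre z" "fim (of_real c * z) = c * fim z" for c and z :: 'f by simp_all
  show "QW Q (\<lambda>z. reduced (fst (g z)) v)"
    unfolding QW_def QF_def
    using lf[OF lin_functional_reduced[OF fre_fim_add(1) f(1)]] lf[OF lin_functional_reduced[OF fre_fim_add(2) f(2)]]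
    by blast
  show "QW Q (\<lambda>z. column (snd (g z)) c)"
    unfolding QW_def QF_def
    using lf[OF lin_functional_column[OF fre_fim_add(1) f(1)]] lf[OF lin_functional_column[OF fre_fim_add(2) f(2)]]
    by blast
qed

end

section \<open>Invariants built from ordered eigenvalues\<close>

context inner_product_space
begin

definition newton_trace :: "('w \<Rightarrow> 'w) \<Rightarrow> ('k::finite \<Rightarrow> 'w) \<Rightarrow> (nat \<Rightarrow> real) \<Rightarrow> nat \<Rightarrow> real" where
  "newton_trace A b l j = (\<Sum>c\<in>UNIV. fre (ip (newton_op smul l A j (b c)) (b c)))"

definition trace_minus_gaps :: "('w \<Rightarrow> 'w) \<Rightarrow> ('k::finite \<Rightarrow> 'w) \<Rightarrow> (nat \<Rightarrow> real) \<Rightarrow> nat \<Rightarrow> real" where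
  "trace_minus_gaps A b l j = newton_trace A b l j - (\<Sum>i\<in>{j..<n}. l j - l i)"

lemma newton_op_cong: "(\<And>q. q < j \<Longrightarrow> l q = l' q) \<Longrightarrow> newton_op smul l A j x = newton_op smul l' A j x"
  by (induction j) auto

text \<open>Only the eigenvalues before the \<open>j\<close>-th enter, which makes a recursive
  recovery of the eigenvalues possible.\<close>

lemma newton_trace_cong: "(\<And>q. q < j \<Longrightarrow> l q = l' q) \<Longrightarrow> newton_trace A b l j = newton_trace A b l' j"
  using newton_op_cong[of j l l'] by (simp add: newton_trace_def)

lemma newton_trace_eq:
  assumes "selfadj A" "eigenbasis A l u"
  shows "newton_trace A b l j = (\<Sum>i<n. newton_coeff l j i * (\<Sum>c\<in>UNIV. sqnorm (ip (b c) (u i))))"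
proof -
  have "fre (ip (newton_op smul l A j x) x) = (\<Sum>i<n. newton_coeff l j i * sqnorm (ip x (u i)))" for x
    unfolding ip_newton_op_eigenbasis[OF assms] mult_cconj of_real_mult[symmetric] fre_fim_sum fre_fim_of_real ..
  then show ?thesis
    unfolding newton_trace_def by (simp add: sum_distrib_left) (rule sum.swap)
qed

text \<open>Vanishing of the total replaces the sum of the later eigenvalues by that of the earlier
  ones.\<close>

lemma gap_sum_eq:
  fixes l :: "nat \<Rightarrow> real"
  assumes "(\<Sum>i<n. l i) = 0" "j < n"
  shows "(\<Sum>i\<in>{j..<n}. l j - l i) = real (n - j) * l j + (\<Sum>q<j. l q)"
proof -
  have "(\<Sum>i<n. l i) = (\<Sum>q<j. l q) + (\<Sum>i\<in>{j..<n}. l i)"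
    using sum.atLeastLessThan_concat[of 0 j n l] assms(2) by (simp add: atLeast0LessThan)
  then show ?thesis using assms(1) by (simp add: sum_subtractf)
qed

subsection \<open>Continuity and semialgebraicity\<close>

text \<open>A semantic rendering of being polynomial in the matrix entries, the coordinates of the columns
  and the eigenvalues. It is applied to the algebras of continuous and of polynomial functions.\<close>

definition invariant_expr :: "'z itself \<Rightarrow> (('w \<Rightarrow> 'w) \<Rightarrow> ('k::finite \<Rightarrow> 'w) \<Rightarrow> (nat \<Rightarrow> real) \<Rightarrow> real) \<Rightarrow> bool" where
  "invariant_expr _ E \<longleftrightarrow> (\<forall>(Q :: ('z \<Rightarrow> real) \<Rightarrow> bool) A b l. function_algebra Q \<longrightarrow> (\<forall>z. selfadj (A z)) \<longrightarrow>
    (\<forall>v. QW Q (\<lambda>z. A z v)) \<longrightarrow> (\<forall>c. QW Q (\<lambda>z. b z c)) \<longrightarrow> (\<forall>i. Q (\<lambda>z. l z i)) \<longrightarrow>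
    Q (\<lambda>z. E (A z) (b z) (l z)))"

lemma invariant_exprD:
  fixes Q :: "('z \<Rightarrow> real) \<Rightarrow> bool"
  assumes "invariant_expr TYPE('z) E" "function_algebra Q" "\<And>z. selfadj (A z)" "\<And>v. QW Q (\<lambda>z. A z v)"
    "\<And>c. QW Q (\<lambda>z. b z c)" "\<And>i. Q (\<lambda>z. l z i)"
  shows "Q (\<lambda>z. E (A z) (b z) (l z))"
  using assms unfolding invariant_expr_def by blast

lemma invariant_expr_newton_op:
  fixes Q :: "('z \<Rightarrow> real) \<Rightarrow> bool"
  assumes Q: "function_algebra Q" and A: "\<And>z. selfadj (A z)" "\<And>v. QW Q (\<lambda>z. A z v)"
    and b: "QW Q b" "QW Q b'" and l: "\<And>i. Q (\<lambda>z. l z i)"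
  shows "QW Q (\<lambda>z. newton_op smul (l z) (A z) j (b z))"
    "function_algebra.QF Q (\<lambda>z. ip (newton_op smul (l z) (A z) j (b z)) (b' z))"
    "Q (\<lambda>z. fre (ip (newton_op smul (l z) (A z) j (b z)) (b' z)))"
    "Q (\<lambda>z. fim (ip (newton_op smul (l z) (A z) j (b z)) (b' z)))"
proof -
  interpret function_algebra Q by (rule Q)
  show 1: "QW Q (\<lambda>z. newton_op smul (l z) (A z) j (b z))"
    by (rule QW_newton_op[OF Q selfadj_lin[OF A(1)] A(2) b(1) l])
  show 2: "QF (\<lambda>z. ip (newton_op smul (l z) (A z) j (b z)) (b' z))"
    by (rule QF_ip[OF Q 1 b(2)])
  then show "Q (\<lambda>z. fre (ip (newton_op smul (l z) (A z) j (b z)) (b' z)))"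
    "Q (\<lambda>z. fim (ip (newton_op smul (l z) (A z) j (b z)) (b' z)))"
    by (simp_all only: QF_def)
qed

lemma invariant_expr_newton_trace: "invariant_expr TYPE('z) (\<lambda>A b l. newton_trace A b l j)"
  unfolding invariant_expr_def newton_trace_def
proof (intro allI impI)
  fix Q :: "('z \<Rightarrow> real) \<Rightarrow> bool" and A and b :: "'z \<Rightarrow> 'k::finite \<Rightarrow> 'w" and l :: "'z \<Rightarrow> nat \<Rightarrow> real"
  assume *: "function_algebra Q" "\<forall>z. selfadj (A z)" "\<forall>v. QW Q (\<lambda>z. A z v)"
    "\<forall>c. QW Q (\<lambda>z. b z c)" "\<forall>i. Q (\<lambda>z. l z i)"
  interpret function_algebra Q by (rule *)
  show "Q (\<lambda>z. \<Sum>c\<in>UNIV. fre (ip (newton_op smul (l z) (A z) j (b z c)) (b z c)))"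
    by (rule sum, rule invariant_expr_newton_op(3)) (use * in auto)
qed

lemma invariant_expr_trace_minus_gaps: "invariant_expr TYPE('z) (\<lambda>A b l. trace_minus_gaps A b l j)"
  unfolding invariant_expr_def trace_minus_gaps_def
proof (intro allI impI)
  fix Q :: "('z \<Rightarrow> real) \<Rightarrow> bool" and A and b :: "'z \<Rightarrow> 'k::finite \<Rightarrow> 'w" and l :: "'z \<Rightarrow> nat \<Rightarrow> real"
  assume *: "function_algebra Q" "\<forall>z. selfadj (A z)" "\<forall>v. QW Q (\<lambda>z. A z v)"
    "\<forall>c. QW Q (\<lambda>z. b z c)" "\<forall>i. Q (\<lambda>z. l z i)"
  interpret function_algebra Q by (rule *)
  have "Q (\<lambda>z. newton_trace (A z) (b z) (l z) j)"
    by (rule invariant_exprD[where E = "\<lambda>A b l. newton_trace A b l j" and A = A and b = b and l = l,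
          OF invariant_expr_newton_trace]) (use * in auto)
  moreover have "Q (\<lambda>z. \<Sum>i\<in>{j..<n}. l z j - l z i)"
    by (rule sum, rule diff) (use * in auto)
  ultimately show "Q (\<lambda>z. newton_trace (A z) (b z) (l z) j - (\<Sum>i\<in>{j..<n}. l z j - l z i))"
    by (rule diff)
qed

text \<open>The eigenvalues are recovered polynomially from the point and its image, one after the other:
  the sum of the gaps below the \<open>j\<close>-th eigenvalue involves, besides this eigenvalue, only the
  preceding ones. Hence the graph is described without quantifiers.\<close>

lemma invariant_map_properties:
  fixes M :: "(('w \<Rightarrow> 'w) set \<times> ('f ^ 'k::finite \<Rightarrow> 'w)) real_space" and Y :: "'y real_space"
    and E :: "nat \<Rightarrow> ('w \<Rightarrow> 'w) \<Rightarrow> ('k \<Rightarrow> 'w) \<Rightarrow> (nat \<Rightarrow> real) \<Rightarrow> real"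
  assumes M: "M = rep_space smul ip" and Y: "coordinates Y N \<kappa>" and f: "f ` pts M \<subseteq> pts Y"
    and E: "\<And>x i. x \<in> pts M \<Longrightarrow> i < N \<Longrightarrow>
      \<kappa> i (f x) = E i (reduced (fst x)) (column (snd x)) (eigenvalues (reduced (fst x)))"
    and expr: "\<And>i. i < N \<Longrightarrow> invariant_expr TYPE(('w \<Rightarrow> 'w) set \<times> ('f ^ 'k \<Rightarrow> 'w)) (E i)"
      "\<And>i. i < N \<Longrightarrow> invariant_expr TYPE((('w \<Rightarrow> 'w) set \<times> ('f ^ 'k \<Rightarrow> 'w)) \<times> 'y) (E i)"
    and \<rho>: "\<And>j. Suc j < n \<Longrightarrow> \<rho> j < N \<and> E (\<rho> j) = (\<lambda>A b l. trace_minus_gaps A b l j)"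
  shows "semialgebraic_map M Y f" "continuous_map (vs_topology M) (vs_topology Y) f"
proof -
  define ev where "ev x = eigenvalues (reduced (fst x))" for x :: "('w \<Rightarrow> 'w) set \<times> ('f ^ 'k \<Rightarrow> 'w)"
  have eb: "\<exists>u. eigenbasis (reduced (fst x)) (ev x) u" for x :: "('w \<Rightarrow> 'w) set \<times> ('f ^ 'k \<Rightarrow> 'w)"
    unfolding ev_def by (rule eigenbasis_eigenvalues[OF selfadj_reduced])
  have ev_desc: "descending n (ev x)" for x using eb eigenbasisD(2) by blast
  have ev_0: "ev x i = 0" if "i \<ge> n" for x i using eb[of x] eigenbasisD(3)[OF _ that] by blast
  have ev_trace: "trace_pow (reduced (fst x)) j = (\<Sum>i<n. ev x i ^ j)" for x j
    using eb[of x] trace_pow_eq[OF selfadj_reduced] by blast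
  have ev_sum: "(\<Sum>i<n. ev x i) = 0" if "x \<in> pts M" for x
  proof -
    have "trace_pow (reduced (fst x)) 1 = 0" using that unfolding M by (metis rep_space_cases)
    then show ?thesis using ev_trace[of x 1] by simp
  qed
  show "continuous_map (vs_topology M) (vs_topology Y) f"
  proof (rule continuous_map_coordinates[OF Y f])
    let ?Q = "continuous_map (vs_topology M) euclideanreal"
    have Q: "function_algebra ?Q" by (rule function_algebra_continuous_map)
    have lf: "?Q (\<lambda>z. \<phi> (id z))" if "lin_functional (rep_space smul ip) \<phi>" for \<phi>
      using continuous_map_lin_functional[OF that] M by simp
    have A: "QW ?Q (\<lambda>z. reduced (fst z) v)" and b: "QW ?Q (\<lambda>z. column (snd z) c)" for v c
      using QW_coordinate_functions[OF Q lf] by simp_all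
    interpret function_algebra ?Q by (rule Q)
    have tr: "?Q (\<lambda>x. trace_pow (reduced (fst x)) j)" for j
    proof -
      have "QW ?Q (\<lambda>x. (reduced (fst x) ^^ j) (basis i))" for i
        by (rule QW_funpow[OF Q selfadj_lin[OF selfadj_reduced] A])
      then show ?thesis unfolding trace_pow_def by (intro sum) (simp add: QW_def QF_def)
    qed
    have ev_cont: "?Q (\<lambda>x. ev x i)" for i
      by (rule continuous_map_descending[OF tr]) (use ev_desc ev_0 ev_trace in auto)
    fix i assume i: "i < N"
    have "?Q (\<lambda>x. E i (reduced (fst x)) (column (snd x)) (ev x))"
      by (rule invariant_exprD[where E = "E i" and A = "\<lambda>x. reduced (fst x)"
            and b = "\<lambda>x. column (snd x)" and l = ev, OF expr(1)[OF i] Q selfadj_reduced A b ev_cont])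
    then show "?Q (\<lambda>x. \<kappa> i (f x))"
      by (rule continuous_map_eq) (simp add: topspace_vs_topology E[OF _ i] ev_def)
  qed
  \<comment> \<open>On the sum with \<open>Y\<close> the polynomial functions include the
    coordinates of a candidate image, through which the eigenvalues are to be expressed.\<close>
  let ?MY = "M \<oplus>\<^sub>R Y"
  let ?Q = "polynomial_on ?MY"
  have Q: "function_algebra ?Q" by (rule function_algebra_polynomial_on)
  have lf: "?Q (\<lambda>z. \<phi> (fst z))" if "lin_functional (rep_space smul ip) \<phi>" for \<phi>
    using that unfolding M by (intro polynomial_on.linear lin_functional_fst)
  have A: "QW ?Q (\<lambda>z. reduced (fst (fst z)) v)" and b: "QW ?Q (\<lambda>z. column (snd (fst z)) c)" for v c
    by (rule QW_coordinate_functions[where g = fst, OF Q lf]; assumption)+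
  interpret function_algebra ?Q by (rule Q)
  have tr: "?Q (\<lambda>x. trace_pow (reduced (fst (fst x))) j)" for j
  proof -
    have "QW ?Q (\<lambda>x. (reduced (fst (fst x)) ^^ j) (basis i))" for i
      by (rule QW_funpow[OF Q selfadj_lin[OF selfadj_reduced] A])
    then show ?thesis unfolding trace_pow_def by (intro sum) (simp add: QW_def QF_def)
  qed
  have \<kappa>: "?Q (\<lambda>z. \<kappa> i (snd z))" if "i < N" for i
    using Y that unfolding coordinates_def by (intro polynomial_on.linear lin_functional_snd) auto
  have rec: "\<exists>\<Lambda>. (\<forall>i. ?Q (\<lambda>z. \<Lambda> z i)) \<and> (\<forall>x\<in>pts M. \<forall>q<j. \<Lambda> (x, f x) q = ev x q)" if "j \<le> n - 1" for j
    using that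
  proof (induction j)
    case 0
    show ?case by (intro exI[of _ "\<lambda>_ _. 0"]) (simp add: const)
  next
    case (Suc j)
    then obtain \<Lambda> where \<Lambda>: "\<And>i. ?Q (\<lambda>z. \<Lambda> z i)" "\<And>x q. x \<in> pts M \<Longrightarrow> q < j \<Longrightarrow> \<Lambda> (x, f x) q = ev x q"
      by (metis Suc_leD)
    have j: "Suc j < n" using Suc.prems by simp
    define T where "T z = newton_trace (reduced (fst (fst z))) (column (snd (fst z))) (\<Lambda> z) j" for z
    \<comment> \<open>Solves the equation for the \<open>j\<close>-th trace invariant, in which the
      unknown eigenvalue occurs linearly with coefficient \<open>- (n - j)\<close>.\<close>
    define L where "L z = (1 / real (n - j)) * (T z - \<kappa> (\<rho> j) (snd z) - (\<Sum>q<j. \<Lambda> z q))" for z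
    have "?Q T"
      unfolding T_def[abs_def]
      by (rule invariant_exprD[where E = "\<lambda>A b l. newton_trace A b l j" and A = "\<lambda>z. reduced (fst (fst z))"
            and b = "\<lambda>z. column (snd (fst z))" and l = \<Lambda>, OF invariant_expr_newton_trace Q selfadj_reduced A b \<Lambda>(1)])
    then have "?Q L"
      unfolding L_def[abs_def] using \<kappa> \<rho>[OF j] \<Lambda>(1) by (intro mult const diff sum) auto
    moreover have "L (x, f x) = ev x j" if x: "x \<in> pts M" for x
    proof -
      have "T (x, f x) = newton_trace (reduced (fst x)) (column (snd x)) (ev x) j"
        unfolding T_def fst_conv using \<Lambda>(2)[OF x] by (rule newton_trace_cong)
      moreover have "\<kappa> (\<rho> j) (f x) = trace_minus_gaps (reduced (fst x)) (column (snd x)) (ev x) j"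
        using E[OF x, of "\<rho> j"] \<rho>[OF j] by (simp add: ev_def)
      moreover have "(\<Sum>q<j. \<Lambda> (x, f x) q) = (\<Sum>q<j. ev x q)" using \<Lambda>(2)[OF x] by simp
      ultimately have "T (x, f x) - \<kappa> (\<rho> j) (f x) - (\<Sum>q<j. \<Lambda> (x, f x) q) = real (n - j) * ev x j"
        using gap_sum_eq[OF ev_sum[OF x], of j] j by (simp add: trace_minus_gaps_def)
      then show ?thesis using j by (simp add: L_def)
    qed
    moreover have "?Q (\<lambda>z. ((\<Lambda> z)(j := L z)) i)" for i
      using \<Lambda>(1) \<open>?Q L\<close> by (cases "i = j") simp_all
    ultimately show ?case
      using \<Lambda>(2) by (intro exI[of _ "\<lambda>z. (\<Lambda> z)(j := L z)"]) (simp add: less_Suc_eq)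
  qed
  obtain \<Lambda>0 where \<Lambda>0: "\<And>i. ?Q (\<lambda>z. \<Lambda>0 z i)" "\<And>x q. x \<in> pts M \<Longrightarrow> q < n - 1 \<Longrightarrow> \<Lambda>0 (x, f x) q = ev x q"
    using rec[OF order_refl] by blast
  \<comment> \<open>There is no trace invariant for the last index; the last eigenvalue is minus the
    sum of the others.\<close>
  define \<Lambda> where "\<Lambda> z i = (if i < n - 1 then \<Lambda>0 z i else if i < n then - (\<Sum>q<n - 1. \<Lambda>0 z q) else 0)" for z i
  have \<Lambda>: "?Q (\<lambda>z. \<Lambda> z i)" for i
  proof -
    have "?Q (\<lambda>z. - (\<Sum>q<n - 1. \<Lambda>0 z q))" by (rule uminus, rule sum, rule \<Lambda>0)
    then show ?thesis
      unfolding \<Lambda>_def using \<Lambda>0(1)[of i] const[of 0] by (cases "i < n - 1"; cases "i < n") simp_all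
  qed
  have \<Lambda>_ev: "\<Lambda> (x, f x) = ev x" if x: "x \<in> pts M" for x
  proof
    fix i
    show "\<Lambda> (x, f x) i = ev x i"
    proof (cases "i < n - 1")
      case True
      then show ?thesis using \<Lambda>0(2)[OF x] by (simp add: \<Lambda>_def)
    next
      case False
      show ?thesis
      proof (cases "i < n")
        case True
        with False have i: "n = Suc i" by simp
        have "ev x i = - (\<Sum>q<i. ev x q)" using ev_sum[OF x] i by simp
        then show ?thesis using \<Lambda>0(2)[OF x] i by (simp add: \<Lambda>_def)
      qed (use False ev_0 in \<open>simp add: \<Lambda>_def\<close>)
    qed
  qed
  \<comment> \<open>For a pair off the graph \<open>\<Lambda>\<close> need not consist of
    eigenvalues. Order and power sums force it to, and the equations for the coordinates then say
    that the second component is the image of the first.\<close>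
  define G where "G z \<longleftrightarrow> descending n (\<Lambda> z) \<and>
    (\<forall>j\<in>{..2 * n}. trace_pow (reduced (fst (fst z))) j = (\<Sum>i<n. \<Lambda> z i ^ j)) \<and>
    (\<forall>i\<in>{..<N}. \<kappa> i (snd z) = E i (reduced (fst (fst z))) (column (snd (fst z))) (\<Lambda> z))" for z
  have "semialgebraic_set ?MY {z \<in> pts ?MY. G z}"
    unfolding G_def
  proof (intro semialgebraic_conj semialgebraic_ball semialgebraic_eq semialgebraic_descending)
    fix i assume "i \<in> {..<N}"
    then have "i < N" by simp
    show "?Q (\<lambda>z. E i (reduced (fst (fst z))) (column (snd (fst z))) (\<Lambda> z))"
      by (rule invariant_exprD[where E = "E i" and A = "\<lambda>z. reduced (fst (fst z))"
            and b = "\<lambda>z. column (snd (fst z))" and l = \<Lambda>, OF expr(2)[OF \<open>i < N\<close>] Q selfadj_reduced A b \<Lambda>])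
  next
    fix j
    show "?Q (\<lambda>z. \<Sum>i<n. \<Lambda> z i ^ j)" by (rule sum, rule power, rule \<Lambda>)
  qed (use \<Lambda> tr \<kappa> in auto)
  moreover have "{(x, f x) | x. x \<in> pts M} = {z \<in> pts ?MY. G z}"
  proof (intro equalityI subsetI)
    fix z assume "z \<in> {(x, f x) | x. x \<in> pts M}"
    then obtain x where x: "z = (x, f x)" "x \<in> pts M" by auto
    then show "z \<in> {z \<in> pts ?MY. G z}"
      using f \<Lambda>_ev[OF x(2)] ev_desc ev_trace E[OF x(2)] by (auto simp: pts_direct_sum G_def ev_def)
  next
    fix z assume z: "z \<in> {z \<in> pts ?MY. G z}"
    obtain x y where xy: "z = (x, y)" "x \<in> pts M" "y \<in> pts Y" using z by (auto simp: pts_direct_sum)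
    have G: "G (x, y)" using z xy by simp
    have "\<Lambda> (x, y) i = ev x i" for i
    proof (cases "i < n")
      case True
      show ?thesis
        by (rule descending_power_sums_unique[OF _ ev_desc _ True]) (use G ev_trace in \<open>auto simp: G_def\<close>)
    qed (use ev_0 in \<open>simp add: \<Lambda>_def\<close>)
    then have "\<Lambda> (x, y) = ev x" by auto
    then have "\<kappa> i y = \<kappa> i (f x)" if "i < N" for i
      using G E[OF xy(2) that] that by (simp add: G_def ev_def)
    then have "y = f x" using Y f xy unfolding coordinates_def by blast
    then show "z \<in> {(x, f x) | x. x \<in> pts M}" using xy by blast
  qed
  ultimately show "semialgebraic_map M Y f"
    using f by (simp add: semialgebraic_map_def)
qed

subsection \<open>Orbits\<close>

text \<open>A unitary operator matching the eigenbases carries \<open>A\<close> to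
  \<open>A'\<close>. The Gram condition for indicator functions \<phi> says that the components of
  the two families in each eigenspace have equal inner products, so a unitary operator commuting
  with \<open>A'\<close> moves one family to the other.\<close>

lemma unitary_between_data:
  fixes b b' :: "'k::finite \<Rightarrow> 'w"
  assumes A: "selfadj A" "eigenbasis A l u" and A': "selfadj A'" "eigenbasis A' l u'"
    and gram: "\<And>\<phi> c d. (\<Sum>i<n. of_real (\<phi> (l i)) * (ip (b c) (u i) * cconj (ip (b d) (u i)))) =
      (\<Sum>i<n. of_real (\<phi> (l i)) * (ip (b' c) (u' i) * cconj (ip (b' d) (u' i))))"
  shows "\<exists>C. unitary C \<and> (\<forall>z. C (A z) = A' (C z)) \<and> (\<forall>c. C (b c) = b' c)"
proof -
  note u = eigenbasisD(1)[OF A(2)] and u' = eigenbasisD(1)[OF A'(2)]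
  obtain C where C: "unitary C" "\<And>i. i < n \<Longrightarrow> C (u i) = u' i"
    using unitary_between_bases[OF u u'] by blast
  note linC = unitary_lin[OF C(1)]
  have CA: "C (A z) = A' (C z)" for z
  proof -
    have "(\<lambda>z. C (A z)) = (\<lambda>z. A' (C z))"
    proof (rule lin_eqI[OF _ _ u])
      show "lin (\<lambda>z. C (A z))"
        by (rule linI) (simp_all add: lin_add[OF linC] lin_add[OF selfadj_lin[OF A(1)]]
            lin_scale[OF linC] lin_scale[OF selfadj_lin[OF A(1)]])
      show "lin (\<lambda>z. A' (C z))"
        by (rule linI) (simp_all add: lin_add[OF linC] lin_add[OF selfadj_lin[OF A'(1)]]
            lin_scale[OF linC] lin_scale[OF selfadj_lin[OF A'(1)]])
      fix i assume i: "i < n"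
      then show "C (A (u i)) = A' (C (u i))"
        using C(2) eigenbasisD(4)[OF A(2) i] eigenbasisD(4)[OF A'(2) i] by (simp add: lin_scale[OF linC])
    qed
    then show ?thesis by (rule fun_cong)
  qed
  \<comment> \<open>The component, in the eigenspace of \<mu>, of the vector with coordinates
    \<open>a c\<close> in the basis \<open>u'\<close>. Zero coefficients outside that eigenspace
    make it an eigenvector or zero.\<close>
  define comp where "comp a = (\<lambda>(\<mu>, c). \<Sum>i<n. smul (if l i = \<mu> then a c i else 0) (u' i))"
    for a :: "'k \<Rightarrow> nat \<Rightarrow> 'f"
  define S where "S = l ` {..<n} \<times> (UNIV :: 'k set)"
  have eig: "A' (comp a s) = smul (of_real (fst s)) (comp a s)" for a s
  proof -
    have "A' (comp a s) = (\<Sum>i<n. smul (if l i = fst s then a (snd s) i else 0) (A' (u' i)))"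
      by (simp add: comp_def case_prod_unfold lin_sum lin_scale selfadj_lin[OF A'(1)])
    also have "\<dots> = (\<Sum>i<n. smul (of_real (fst s)) (smul (if l i = fst s then a (snd s) i else 0) (u' i)))"
      by (intro sum.cong) (auto simp: eigenbasisD(4)[OF A'(2)] mult.commute)
    finally show ?thesis by (simp add: comp_def case_prod_unfold scale_sum_right)
  qed
  have ip_comp: "ip (comp a (\<mu>, c)) (comp a (\<nu>, d)) =
      (\<Sum>i<n. of_real (if l i = \<mu> \<and> l i = \<nu> then 1 else 0) * (a c i * cconj (a d i)))" for a \<mu> \<nu> c d
    unfolding parseval[OF u', of "comp a (\<mu>, c)" "comp a (\<nu>, d)"]
    by (intro sum.cong) (auto simp: comp_def orthonormal_coeff[OF u'])
  have sum_comp: "(\<Sum>\<mu>\<in>l ` {..<n}. comp a (\<mu>, c)) = (\<Sum>i<n. smul (a c i) (u' i))" for a c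
  proof -
    have "(\<Sum>\<mu>\<in>l ` {..<n}. comp a (\<mu>, c)) =
        (\<Sum>i<n. \<Sum>\<mu>\<in>l ` {..<n}. smul (if l i = \<mu> then a c i else 0) (u' i))"
      unfolding comp_def prod.case by (rule sum.swap)
    also have "\<dots> = (\<Sum>i<n. \<Sum>\<mu>\<in>l ` {..<n}. if l i = \<mu> then smul (a c i) (u' i) else 0)"
      by (intro sum.cong) auto
    finally show ?thesis by simp
  qed
  define x where "x = comp (\<lambda>c i. ip (b c) (u i))"
  define y where "y = comp (\<lambda>c i. ip (b' c) (u' i))"
  have "\<exists>D. unitary D \<and> (\<forall>z. D (A' z) = A' (D z)) \<and> (\<forall>s\<in>S. D (x s) = y s)"
  proof (rule commuting_unitary_exists[OF A'(1)])
    show "finite S" by (simp add: S_def)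
    show "A' (x s) = smul (of_real (fst s)) (x s)" "A' (y s) = smul (of_real (fst s)) (y s)" for s
      unfolding x_def y_def by (rule eig)+
    show "ip (x s) (x t) = ip (y s) (y t)" for s t
    proof -
      obtain \<mu> c \<nu> d where st: "s = (\<mu>, c)" "t = (\<nu>, d)" by (cases s, cases t) auto
      show ?thesis
        unfolding st x_def y_def ip_comp
        by (rule gram[of "\<lambda>r. if r = \<mu> \<and> r = \<nu> then 1 else 0"])
    qed
  qed
  then obtain D where D: "unitary D" "\<And>z. D (A' z) = A' (D z)" "\<And>s. s \<in> S \<Longrightarrow> D (x s) = y s" by blast
  have "D (C (b c)) = b' c" for c
  proof -
    have "C (b c) = (\<Sum>i<n. smul (ip (b c) (u i)) (u' i))"
      by (subst lin_expand[OF linC u]) (simp add: C(2))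
    also have "\<dots> = (\<Sum>\<mu>\<in>l ` {..<n}. x (\<mu>, c))" unfolding x_def by (rule sum_comp[symmetric])
    finally have "D (C (b c)) = (\<Sum>\<mu>\<in>l ` {..<n}. D (x (\<mu>, c)))"
      by (simp add: lin_sum[OF unitary_lin[OF D(1)]])
    also have "\<dots> = (\<Sum>\<mu>\<in>l ` {..<n}. y (\<mu>, c))"
      by (intro sum.cong refl D(3)) (simp add: S_def)
    also have "\<dots> = (\<Sum>i<n. smul (ip (b' c) (u' i)) (u' i))" unfolding y_def by (rule sum_comp)
    also have "\<dots> = b' c" by (rule orthonormal_expand[OF u', symmetric])
    finally show ?thesis .
  qed
  then show ?thesis
    using unitary_comp[OF D(1) C(1)] CA D(2) by (intro exI[of _ "D \<circ> C"]) simp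
qed

lemma diagonal_operator_exists:
  assumes "descending n l" "\<And>i. i \<ge> n \<Longrightarrow> l i = 0"
  shows "\<exists>A. selfadj A \<and> eigenbasis A l basis"
proof (intro exI conjI)
  let ?A = "\<lambda>x. \<Sum>i<n. smul (of_real (l i) * ip x (basis i)) (basis i)"
  have "lin ?A"
    by (rule linI) (simp_all add: ip_add ip_scale scale_left_distrib sum.distrib scale_sum_right mult_ac distrib_left)
  moreover have "ip (?A x) y = ip x (?A y)" for x y
    unfolding parseval[OF orthonormal_basis, of "?A x" y] parseval[OF orthonormal_basis, of x "?A y"]
    by (simp add: orthonormal_coeff[OF orthonormal_basis] mult_ac)
  ultimately show "selfadj ?A" by (simp add: selfadj_def)
  have "?A (basis i) = smul (of_real (l i)) (basis i)" if i: "i < n" for i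
  proof -
    have "?A (basis i) = (\<Sum>j<n. if j = i then smul (of_real (l j)) (basis j) else 0)"
      using orthonormal_ip[OF orthonormal_basis i] by (intro sum.cong) auto
    then show ?thesis using i by simp
  qed
  then show "eigenbasis ?A l basis"
    using assms orthonormal_basis by (simp add: eigenbasis_def)
qed

end

section \<open>Two vectors\<close>

definition to_complex :: "'a::real_or_complex \<Rightarrow> complex" where
  "to_complex z = Complex (fre z) (fim z)"

text \<open>The pair \<open>(x, z)\<close> encodes the matrix with rows \<open>(x, z)\<close> and \<open>(cnj z, - x)\<close>, twice the traceless part
  of the rank-one Gram matrix of \<open>(a, d)\<close>.\<close>

definition null_label :: "'a::real_or_complex \<Rightarrow> 'a \<Rightarrow> real \<times> complex" where
  "null_label a d = (sqnorm a - sqnorm d, 2 * to_complex (a * cconj d))"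

text \<open>The image of \<open>null_label\<close>; over the reals the off-diagonal entry is
  real.\<close>

definition label_space :: "'a::real_or_complex itself \<Rightarrow> (real \<times> complex) set" where
  "label_space _ = {(x, z). imag_unit = (0::'a) \<longrightarrow> Im z = 0}"

lemma cmod_to_complex: "(cmod (to_complex z))\<^sup>2 = sqnorm z"
  by (simp add: to_complex_def cmod_power2 sqnorm_def)

text \<open>This is \<open>(p - q)^2 + 4 * p * q = (p + q)^2\<close> for the two diagonal entries:
  the norm of a label is the trace of the rank-one Gram matrix.\<close>

lemma norm_null_label: "norm (null_label a d) = sqnorm a + sqnorm d"
proof -
  have "(norm (2 * to_complex (a * cconj d)))\<^sup>2 = 4 * (sqnorm a * sqnorm d)"
    by (simp add: norm_mult power_mult_distrib cmod_to_complex sqnorm_mult)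
  then have "norm (null_label a d) = sqrt ((sqnorm a + sqnorm d)\<^sup>2)"
    unfolding null_label_def norm_Pair by (simp add: power2_eq_square algebra_simps)
  then show ?thesis by simp
qed

lemma subspace_label_space: "subspace (label_space TYPE('a::real_or_complex))"
  by (auto simp: subspace_def label_space_def zero_prod_def)

text \<open>Taking \<open>a\<close> real, one needs \<open>sqnorm a = (t + x) / 2\<close>,
  \<open>sqnorm d = (t - x) / 2\<close> and \<open>a * cconj d\<close> equal to half of
  \<open>z\<close>, where \<open>t\<close> is the norm. If \<open>t + x = 0\<close>, then
  \<open>a = 0\<close>.\<close>

lemma null_label_surj:
  assumes "h \<in> label_space TYPE('a::real_or_complex)"
  shows "\<exists>a d :: 'a. null_label a d = h"
proof -
  obtain x z where h: "h = (x, z)" by (cases h)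
  define t where "t = norm h"
  have t2: "t\<^sup>2 = x\<^sup>2 + (cmod z)\<^sup>2" by (simp add: t_def h norm_Pair)
  have tx: "t + x \<ge> 0"
  proof -
    have "\<bar>x\<bar> \<le> t" unfolding t_def h norm_Pair by (intro real_le_rsqrt) simp
    then show ?thesis by linarith
  qed
  show ?thesis
  proof (cases "t + x = 0")
    case True
    then have "x = - t" by simp
    then have z0: "z = 0" using t2 by simp
    have "t \<ge> 0" by (simp add: t_def)
    then have "null_label 0 (of_real (sqrt t) :: 'a) = h"
      using z0 \<open>x = - t\<close> by (simp add: null_label_def h to_complex_def complex_eq_iff)
    then show ?thesis by blast
  next
    case False
    define s where "s = (t + x) / 2"
    have s: "s > 0" using False tx by (simp add: s_def)
    define y where "y = of_real (Re z) + of_real (Im z) * (imag_unit :: 'a)"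
    have y: "fre y = Re z" "fim y = Im z"
      unfolding y_def by (rule fre_unique, rule fim_unique) (use assms in \<open>simp add: h label_space_def\<close>)
    let ?a = "of_real (sqrt s) :: 'a" and ?d = "of_real (1 / (2 * sqrt s)) * cconj y"
    have "?a * cconj ?d = of_real (sqrt s * (1 / (2 * sqrt s))) * y"
      by (simp only: cconj_simps of_real_mult mult.assoc)
    also have "sqrt s * (1 / (2 * sqrt s)) = 1 / 2" using s by simp
    finally have ad: "?a * cconj ?d = of_real (1 / 2) * y" .
    have "sqnorm y = (cmod z)\<^sup>2" by (simp add: sqnorm_def y cmod_power2)
    then have "sqnorm y = (t - x) * (2 * s)" using t2 by (simp add: s_def power2_eq_square algebra_simps)
    then have d: "sqnorm ?d = (t - x) / 2"
      unfolding sqnorm_mult sqnorm_of_real sqnorm_cconj using s by (simp add: power_mult_distrib power_divide field_simps)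
    have a: "sqnorm ?a = s" using s by simp
    have "null_label ?a ?d = h"
      unfolding null_label_def ad a d h by (auto simp: s_def to_complex_def y complex_eq_iff field_simps simp del: of_real_divide)
    then show ?thesis by blast
  qed
qed

context inner_product_space
begin

text \<open>There are \<open>n\<close> differences, \<open>n\<close> real parts and
  \<open>n - 1\<close> traces, and over the complex numbers also \<open>n\<close> imaginary parts.
  For \<open>n = 0\<close> truncated subtraction gives 0.\<close>

definition pair_dim :: nat where
  "pair_dim = (if imag_unit = (0::'f) then 3 * n - 1 else 4 * n - 1)"

text \<open>The imaginary parts come last, so that the real case merely omits a final
  segment.\<close>

definition pair_invariant :: "'k::finite \<Rightarrow> 'k \<Rightarrow> nat \<Rightarrow> ('w \<Rightarrow> 'w) \<Rightarrow> ('k \<Rightarrow> 'w) \<Rightarrow> (nat \<Rightarrow> real) \<Rightarrow> real" where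
  "pair_invariant c d i A b l =
    (if i < n then fre (ip (newton_op smul l A i (b c)) (b c)) - fre (ip (newton_op smul l A i (b d)) (b d))
     else if i < 2 * n then 2 * fre (ip (newton_op smul l A (i - n) (b c)) (b d))
     else if i < 3 * n - 1 then trace_minus_gaps A b l (i - 2 * n)
     else 2 * fim (ip (newton_op smul l A (i - (3 * n - 1)) (b c)) (b d)))"

lemma pair_invariant_simps:
  "j < n \<Longrightarrow> pair_invariant c d j A b l =
    fre (ip (newton_op smul l A j (b c)) (b c)) - fre (ip (newton_op smul l A j (b d)) (b d))"
  "j < n \<Longrightarrow> pair_invariant c d (n + j) A b l = 2 * fre (ip (newton_op smul l A j (b c)) (b d))"
  "Suc j < n \<Longrightarrow> pair_invariant c d (2 * n + j) A b l = trace_minus_gaps A b l j"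
  "j < n \<Longrightarrow> pair_invariant c d (3 * n - 1 + j) A b l = 2 * fim (ip (newton_op smul l A j (b c)) (b d))"
proof -
  show "j < n \<Longrightarrow> pair_invariant c d j A b l =
    fre (ip (newton_op smul l A j (b c)) (b c)) - fre (ip (newton_op smul l A j (b d)) (b d))"
    "j < n \<Longrightarrow> pair_invariant c d (n + j) A b l = 2 * fre (ip (newton_op smul l A j (b c)) (b d))"
    by (simp_all add: pair_invariant_def)
  show "pair_invariant c d (2 * n + j) A b l = trace_minus_gaps A b l j" if "Suc j < n"
  proof -
    have "2 * n + j < 3 * n - 1" using that by linarith
    then show ?thesis by (simp add: pair_invariant_def)
  qed
  show "pair_invariant c d (3 * n - 1 + j) A b l = 2 * fim (ip (newton_op smul l A j (b c)) (b d))" if "j < n"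
  proof -
    have *: "\<not> 3 * n - 1 + j < n" "\<not> 3 * n - 1 + j < 2 * n" "\<not> 3 * n - 1 + j < 3 * n - 1"
      "3 * n - 1 + j - (3 * n - 1) = j"
      using that by linarith+
    show ?thesis unfolding pair_invariant_def by (simp only: * if_False)
  qed
qed

lemma invariant_expr_pair: "invariant_expr TYPE('z) (pair_invariant c d i)" for c d :: "'k::finite"
  unfolding invariant_expr_def
proof (intro allI impI)
  fix Q :: "('z \<Rightarrow> real) \<Rightarrow> bool" and A and b :: "'z \<Rightarrow> 'k \<Rightarrow> 'w" and l :: "'z \<Rightarrow> nat \<Rightarrow> real"
  assume *: "function_algebra Q" "\<forall>z. selfadj (A z)" "\<forall>v. QW Q (\<lambda>z. A z v)"
    "\<forall>c. QW Q (\<lambda>z. b z c)" "\<forall>i. Q (\<lambda>z. l z i)"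
  interpret function_algebra Q by (rule *)
  have 1: "Q (\<lambda>z. fre (ip (newton_op smul (l z) (A z) j (b z c')) (b z d')))"
    "Q (\<lambda>z. fim (ip (newton_op smul (l z) (A z) j (b z c')) (b z d')))" for j c' d'
    by (rule invariant_expr_newton_op; use * in blast)+
  have 2: "Q (\<lambda>z. trace_minus_gaps (A z) (b z) (l z) j)" for j
    by (rule invariant_exprD[where E = "\<lambda>A b l. trace_minus_gaps A b l j" and A = A and b = b and l = l,
          OF invariant_expr_trace_minus_gaps]) (use * in auto)
  consider "i < n" | "\<not> i < n" "i < 2 * n" | "\<not> i < n" "\<not> i < 2 * n" "i < 3 * n - 1"
    | "\<not> i < n" "\<not> i < 2 * n" "\<not> i < 3 * n - 1" by blast
  then show "Q (\<lambda>z. pair_invariant c d i (A z) (b z) (l z))"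
    unfolding pair_invariant_def
    by cases (simp_all only: if_True if_False, (rule diff 1 2 | rule mult, rule const)+)
qed

lemma pair_invariant_unitary:
  assumes "unitary C" "\<And>z. C (A z) = A' (C z)"
  shows "pair_invariant c d i A' (\<lambda>c. C (b c)) l = pair_invariant c d i A b l"
proof -
  have "ip (newton_op smul l A' j (C x)) (C y) = ip (newton_op smul l A j x) y" for j x y
    using newton_op_unitary[of C A A' l j x, OF assms] unitary_ip[OF assms(1)] by simp
  then show ?thesis
    by (simp add: pair_invariant_def trace_minus_gaps_def newton_trace_def)
qed

text \<open>On the right stands twice the traceless part of the Gram matrix of the two vectors for
  the form given by the Newton product.\<close>

lemma null_label_sum:
  assumes "selfadj A" "eigenbasis A l u"
  shows "(\<Sum>i<n. newton_coeff l j i *\<^sub>R null_label (ip x (u i)) (ip y (u i))) =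
    (fre (ip (newton_op smul l A j x) x) - fre (ip (newton_op smul l A j y) y),
     2 * to_complex (ip (newton_op smul l A j x) y))"
proof -
  note e = ip_newton_op_eigenbasis[OF assms]
  have 1: "fre (ip (newton_op smul l A j x) x) = (\<Sum>i<n. newton_coeff l j i * sqnorm (ip x (u i)))" for x
    unfolding e mult_cconj of_real_mult[symmetric] fre_fim_sum fre_fim_of_real ..
  have 2: "Re (2 * to_complex (ip (newton_op smul l A j x) y)) =
      (\<Sum>i<n. newton_coeff l j i * Re (2 * to_complex (ip x (u i) * cconj (ip y (u i)))))"
    "Im (2 * to_complex (ip (newton_op smul l A j x) y)) =
      (\<Sum>i<n. newton_coeff l j i * Im (2 * to_complex (ip x (u i) * cconj (ip y (u i)))))"
    unfolding e by (simp_all add: to_complex_def sum_distrib_left algebra_simps)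
  show ?thesis
  proof (rule prod_eqI)
    show "fst (\<Sum>i<n. newton_coeff l j i *\<^sub>R null_label (ip x (u i)) (ip y (u i))) =
        fst (fre (ip (newton_op smul l A j x) x) - fre (ip (newton_op smul l A j y) y),
          2 * to_complex (ip (newton_op smul l A j x) y))"
      by (simp add: fst_sum null_label_def 1 right_diff_distrib sum_subtractf)
    show "snd (\<Sum>i<n. newton_coeff l j i *\<^sub>R null_label (ip x (u i)) (ip y (u i))) =
        snd (fre (ip (newton_op smul l A j x) x) - fre (ip (newton_op smul l A j y) y),
          2 * to_complex (ip (newton_op smul l A j x) y))"
      unfolding snd_conv snd_sum by (rule complex_eqI; simp only: 2 Re_sum Im_sum snd_scaleR null_label_def snd_conv scaleR_complex.sel)
  qed
qed

lemma newton_trace_pair: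
  assumes "selfadj A" "eigenbasis A l u" and cd: "(UNIV :: 'k::finite set) = {c, d}" "c \<noteq> d"
  shows "newton_trace A b l j =
    (\<Sum>i<n. newton_coeff l j i * norm (null_label (ip (b c) (u i)) (ip (b d) (u i))))"
  unfolding newton_trace_eq[OF assms(1,2)] norm_null_label cd(1) using cd(2) by simp

lemma pair_invariants_iff:
  assumes A: "selfadj A" "eigenbasis A l u" and A': "selfadj A'" "eigenbasis A' l' u'"
    and cd: "(UNIV :: 'k::finite set) = {c, d}" "c \<noteq> d"
    and eq: "\<And>i. i < pair_dim \<Longrightarrow> pair_invariant c d i A b l = pair_invariant c d i A' b' l'"
    and j: "j < n"
  shows "(\<Sum>i<n. newton_coeff l j i *\<^sub>R null_label (ip (b c) (u i)) (ip (b d) (u i))) =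
      (\<Sum>i<n. newton_coeff l' j i *\<^sub>R null_label (ip (b' c) (u' i)) (ip (b' d) (u' i)))"
    "Suc j < n \<Longrightarrow> trace_minus_gaps A b l j = trace_minus_gaps A' b' l' j"
proof -
  have m: "3 * n - 1 \<le> pair_dim" by (auto simp: pair_dim_def)
  show "trace_minus_gaps A b l j = trace_minus_gaps A' b' l' j" if "Suc j < n"
  proof -
    have "2 * n + j < 3 * n - 1" using that by linarith
    then show ?thesis using eq[of "2 * n + j"] m that by (simp add: pair_invariant_simps)
  qed
  have 1: "fre (ip (newton_op smul l A j (b c)) (b c)) - fre (ip (newton_op smul l A j (b d)) (b d)) =
      fre (ip (newton_op smul l' A' j (b' c)) (b' c)) - fre (ip (newton_op smul l' A' j (b' d)) (b' d))"
    using eq[of j] m j by (simp add: pair_invariant_simps)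
  have 2: "fre (ip (newton_op smul l A j (b c)) (b d)) = fre (ip (newton_op smul l' A' j (b' c)) (b' d))"
    using eq[of "n + j"] m j by (simp add: pair_invariant_simps)
  have 3: "fim (ip (newton_op smul l A j (b c)) (b d)) = fim (ip (newton_op smul l' A' j (b' c)) (b' d))"
  proof (cases "imag_unit = (0::'f)")
    case True
    then show ?thesis by (simp add: fim_eq_0_if_real)
  next
    case False
    then have "3 * n - 1 + j < pair_dim" using j by (simp add: pair_dim_def)
    from eq[OF this] show ?thesis unfolding pair_invariant_simps(4)[OF j] by simp
  qed
  show "(\<Sum>i<n. newton_coeff l j i *\<^sub>R null_label (ip (b c) (u i)) (ip (b d) (u i))) =
      (\<Sum>i<n. newton_coeff l' j i *\<^sub>R null_label (ip (b' c) (u' i)) (ip (b' d) (u' i)))"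
    unfolding null_label_sum[OF A] null_label_sum[OF A'] using 1 2 3 by (simp add: to_complex_def)
qed

lemma eigenvalue_sum:
  assumes "selfadj A" "eigenbasis A l u" "trace_pow A 1 = 0"
  shows "(\<Sum>i<n. l i) = 0"
  using trace_pow_eq[OF assms(1,2), of 1] assms(3) by simp

lemma shift_eq_0:
  fixes l l' :: "nat \<Rightarrow> real"
  assumes "(\<Sum>i<n. l i) = 0" "(\<Sum>i<n. l' i) = 0" "\<And>i. i < n \<Longrightarrow> l' i = l i + c" "i < n"
  shows "l' i = l i"
proof -
  have "(\<Sum>i<n. l' i) = (\<Sum>i<n. l i) + real n * c" using assms(3) by (simp add: sum.distrib)
  then show ?thesis using assms by simp
qed

text \<open>Equal invariants are equal data of two labelled configurations, and as both traces
  vanish, the translation left open by uniqueness is trivial. The labels and their norms together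
  give the Gram sums that determine a connecting operator.\<close>

lemma pair_orbit:
  assumes A: "selfadj A" "trace_pow A 1 = 0" and A': "selfadj A'" "trace_pow A' 1 = 0"
    and cd: "(UNIV :: 'k::finite set) = {c, d}" "c \<noteq> d"
    and eq: "\<And>i. i < pair_dim \<Longrightarrow>
      pair_invariant c d i A b (eigenvalues A) = pair_invariant c d i A' b' (eigenvalues A')"
  shows "\<exists>C. unitary C \<and> (\<forall>z. C (A z) = A' (C z)) \<and> (\<forall>c. C (b c) = b' c)"
proof -
  obtain l u where e: "eigenbasis A l u" "eigenvalues A = l" using eigenbasis_eigenvalues[OF A(1)] by auto
  obtain l' u' where e': "eigenbasis A' l' u'" "eigenvalues A' = l'" using eigenbasis_eigenvalues[OF A'(1)] by auto
  let ?m = "\<lambda>i. null_label (ip (b c) (u i)) (ip (b d) (u i))"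
  let ?m' = "\<lambda>i. null_label (ip (b' c) (u' i)) (ip (b' d) (u' i))"
  note eq' = eq[unfolded e(2) e'(2)]
  have "\<exists>c. (\<forall>i<n. l' i = l i + c) \<and>
    (\<forall>\<phi>. (\<Sum>i<n. \<phi> (l i) *\<^sub>R ?m i) = (\<Sum>i<n. \<phi> (l i) *\<^sub>R ?m' i)) \<and>
    (\<forall>\<phi>. (\<Sum>i<n. \<phi> (l i) * norm (?m i)) = (\<Sum>i<n. \<phi> (l i) * norm (?m' i)))"
  proof (rule labelled_configuration_unique)
    show "descending n l" "descending n l'" using e e' eigenbasisD(2) by blast+
    fix j assume j: "j < n"
    show "(\<Sum>i<n. newton_coeff l j i *\<^sub>R ?m i) = (\<Sum>i<n. newton_coeff l' j i *\<^sub>R ?m' i)"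
      by (rule pair_invariants_iff(1)[OF A(1) e(1) A'(1) e'(1) cd _ j]) (rule eq')
  next
    fix j assume j: "Suc j < n"
    have "trace_minus_gaps A b l j = trace_minus_gaps A' b' l' j"
      by (rule pair_invariants_iff(2)[OF A(1) e(1) A'(1) e'(1) cd _ Suc_lessD[OF j] j]) (rule eq')
    then show "(\<Sum>i<n. newton_coeff l j i * norm (?m i)) - (\<Sum>i\<in>{j..<n}. l j - l i) =
        (\<Sum>i<n. newton_coeff l' j i * norm (?m' i)) - (\<Sum>i\<in>{j..<n}. l' j - l' i)"
      unfolding trace_minus_gaps_def newton_trace_pair[OF A(1) e(1) cd] newton_trace_pair[OF A'(1) e'(1) cd] .
  qed
  then obtain s where s: "\<And>i. i < n \<Longrightarrow> l' i = l i + s"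
    and V: "\<And>\<phi>. (\<Sum>i<n. \<phi> (l i) *\<^sub>R ?m i) = (\<Sum>i<n. \<phi> (l i) *\<^sub>R ?m' i)"
    and N: "\<And>\<phi>. (\<Sum>i<n. \<phi> (l i) * norm (?m i)) = (\<Sum>i<n. \<phi> (l i) * norm (?m' i))"
    by blast
  have "l' = l"
  proof
    fix i
    show "l' i = l i"
    proof (cases "i < n")
      case True
      show ?thesis
        by (rule shift_eq_0[OF eigenvalue_sum[OF A(1) e(1) A(2)] eigenvalue_sum[OF A'(1) e'(1) A'(2)] s True])
    next
      case False
      then show ?thesis using eigenbasisD(3)[OF e(1), of i] eigenbasisD(3)[OF e'(1), of i] by simp
    qed
  qed
  note e' = e'(1)[unfolded this]
  show ?thesis
  proof (rule unitary_between_data[OF A(1) e(1) A'(1) e'])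
    fix \<phi> :: "real \<Rightarrow> real" and p q :: 'k
    let ?g = "\<lambda>b u p q. \<Sum>i<n. of_real (\<phi> (l i)) * (ip (b p) (u i) * cconj (ip (b q) (u i)))"
    \<comment> \<open>\<open>F\<close> contains the difference and \<open>G\<close> the sum of the
      two diagonal Gram entries, the one from the labels, the other from their norms.\<close>
    have F: "(\<Sum>i<n. \<phi> (l i) * (sqnorm (ip (b c) (u i)) - sqnorm (ip (b d) (u i)))) =
        (\<Sum>i<n. \<phi> (l i) * (sqnorm (ip (b' c) (u' i)) - sqnorm (ip (b' d) (u' i))))"
      using arg_cong[OF V[of \<phi>], of fst] by (simp add: fst_sum null_label_def)
    have G: "(\<Sum>i<n. \<phi> (l i) * (sqnorm (ip (b c) (u i)) + sqnorm (ip (b d) (u i)))) =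
        (\<Sum>i<n. \<phi> (l i) * (sqnorm (ip (b' c) (u' i)) + sqnorm (ip (b' d) (u' i))))"
      using N[of \<phi>] by (simp add: norm_null_label)
    have self: "?g b u p p = of_real (\<Sum>i<n. \<phi> (l i) * sqnorm (ip (b p) (u i)))" for b u p
      by (simp add: mult_cconj)
    have cc: "?g b u c c = ?g b' u' c c"
      unfolding self using F G by (simp add: algebra_simps sum.distrib sum_subtractf del: of_real_sum of_real_mult)
    have dd: "?g b u d d = ?g b' u' d d"
      unfolding self using F G by (simp add: algebra_simps sum.distrib sum_subtractf del: of_real_sum of_real_mult)
    have Re: "(\<Sum>i<n. \<phi> (l i) * fre (ip (b c) (u i) * cconj (ip (b d) (u i)))) =
        (\<Sum>i<n. \<phi> (l i) * fre (ip (b' c) (u' i) * cconj (ip (b' d) (u' i))))"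
      using arg_cong[OF V[of \<phi>], of "\<lambda>v. Re (snd v) / 2"]
      by (simp add: snd_sum null_label_def to_complex_def sum_divide_distrib del: fre_fim_mult)
    have Im: "(\<Sum>i<n. \<phi> (l i) * fim (ip (b c) (u i) * cconj (ip (b d) (u i)))) =
        (\<Sum>i<n. \<phi> (l i) * fim (ip (b' c) (u' i) * cconj (ip (b' d) (u' i))))"
      using arg_cong[OF V[of \<phi>], of "\<lambda>v. Im (snd v) / 2"]
      by (simp add: snd_sum null_label_def to_complex_def sum_divide_distrib del: fre_fim_mult)
    have rm: "fre (of_real r * z) = r * fre z" "fim (of_real r * z) = r * fim z" for r and z :: 'f
      by simp_all
    have cd': "?g b u c d = ?g b' u' c d"
      by (rule field_eqI) (simp_all only: fre_fim_sum rm Re Im)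
    have sym: "?g b u p q = cconj (?g b u q p)" for b u p q
      by (simp add: mult.commute)
    have dc: "?g b u d c = ?g b' u' d c"
      unfolding sym[of _ d _ c] cd' ..
    have "p = c \<or> p = d" "q = c \<or> q = d" using cd(1) by auto
    then show "?g b u p q = ?g b' u' p q" using cc dd cd' dc by blast
  qed
qed

text \<open>The data of a configuration depend on differences of its points only. Translating the
  mean to 0 meets the trace condition, and the values 0 from \<open>n\<close> on match
  \<open>eigenbasis\<close>.\<close>

definition centered :: "(nat \<Rightarrow> real) \<Rightarrow> nat \<Rightarrow> real" where
  "centered l i = (if i < n then l i - (\<Sum>i<n. l i) / real n else 0)"

lemma centered_configuration:
  assumes "descending n l"
  shows "descending n (centered l)" "(\<Sum>i<n. centered l i) = 0" "i \<ge> n \<Longrightarrow> centered l i = 0"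
    "i < n \<Longrightarrow> j < n \<Longrightarrow> newton_coeff (centered l) j i = newton_coeff l j i"
    "i < n \<Longrightarrow> weight n (centered l) w i = weight n l w i"
    "j < n \<Longrightarrow> (\<Sum>i\<in>{j..<n}. centered l j - centered l i) = (\<Sum>i\<in>{j..<n}. l j - l i)"
proof -
  show "descending n (centered l)" using assms by (auto simp: descending_def centered_def)
  show "(\<Sum>i<n. centered l i) = 0"
    by (cases "n = 0") (simp_all add: centered_def sum_subtractf)
  show "i \<ge> n \<Longrightarrow> centered l i = 0" by (simp add: centered_def)
  show "i < n \<Longrightarrow> j < n \<Longrightarrow> newton_coeff (centered l) j i = newton_coeff l j i"
    by (auto simp: newton_coeff_def centered_def intro!: prod.cong)
  show "i < n \<Longrightarrow> weight n (centered l) w i = weight n l w i"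
    by (auto simp: weight_def centered_def intro!: prod.cong)
  show "j < n \<Longrightarrow> (\<Sum>i\<in>{j..<n}. centered l j - centered l i) = (\<Sum>i\<in>{j..<n}. l j - l i)"
    by (auto simp: centered_def intro!: sum.cong)
qed

lemma trace_eq_0:
  assumes "selfadj A" "eigenbasis A l u" "(\<Sum>i<n. l i) = 0"
  shows "trace_pow A 1 = 0"
  using trace_pow_eq[OF assms(1,2), of 1] assms(3) by simp

lemma pair_data_exist:
  assumes cd: "(UNIV :: 'k::finite set) = {c, d}" "c \<noteq> d"
  shows "\<exists>A b. selfadj A \<and> trace_pow A 1 = 0 \<and>
    (\<forall>i<pair_dim. pair_invariant c d i A b (eigenvalues A) = v i)"
proof (cases "n = 0")
  case True
  then have "pair_dim = 0" by (simp add: pair_dim_def)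
  then show ?thesis using selfadj_zero by (intro exI[of _ "\<lambda>_. 0"]) (auto simp: trace_pow_def)
next
  case False
  \<comment> \<open>The target label of index \<open>j\<close>, assembled from the blocks of
    coordinates; imaginary part 0 in the real case keeps it in \<open>label_space\<close>.\<close>
  define s where "s j = (v j, Complex (v (n + j)) (if imag_unit = (0::'f) then 0 else v (3 * n - 1 + j)))" for j
  define r where "r j = v (2 * n + j)" for j
  have "\<exists>l m. descending n l \<and> (\<forall>i<n. m i \<in> label_space TYPE('f)) \<and>
    (\<forall>j<n. (\<Sum>i<n. newton_coeff l j i *\<^sub>R m i) = s j) \<and>
    (\<forall>j. Suc j < n \<longrightarrow> (\<Sum>i<n. newton_coeff l j i * norm (m i)) - (\<Sum>i\<in>{j..<n}. l j - l i) = r j)"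
  proof (rule labelled_configuration_exists)
    show "s j \<in> label_space TYPE('f)" for j by (simp add: s_def label_space_def)
    show "(1, 0) \<in> label_space TYPE('f)" by (simp add: label_space_def)
    show "Real_Vector_Spaces.subspace (label_space TYPE('f))" by (rule subspace_label_space)
  qed (use False in \<open>simp_all add: zero_prod_def\<close>)
  then obtain l1 m where l1: "descending n l1" and m: "\<And>i. i < n \<Longrightarrow> m i \<in> label_space TYPE('f)"
    and s1: "\<And>j. j < n \<Longrightarrow> (\<Sum>i<n. newton_coeff l1 j i *\<^sub>R m i) = s j"
    and r1: "\<And>j. Suc j < n \<Longrightarrow>
      (\<Sum>i<n. newton_coeff l1 j i * norm (m i)) - (\<Sum>i\<in>{j..<n}. l1 j - l1 i) = r j"
    by blast
  define l where "l = centered l1"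
  note cc = centered_configuration[OF l1, folded l_def]
  obtain A where A: "selfadj A" "eigenbasis A l basis"
    using diagonal_operator_exists[OF cc(1,3)] by blast
  have "\<forall>i. \<exists>a e :: 'f. i < n \<longrightarrow> null_label a e = m i" using null_label_surj m by blast
  then obtain a e where ae: "\<And>i. i < n \<Longrightarrow> null_label (a i) (e i :: 'f) = m i" by metis
  define b where "b p = (if p = c then \<Sum>i<n. smul (a i) (basis i) else \<Sum>i<n. smul (e i) (basis i))" for p
  have lab: "null_label (ip (b c) (basis i)) (ip (b d) (basis i)) = m i" if "i < n" for i
    using that cd(2) ae by (simp add: b_def orthonormal_coeff[OF orthonormal_basis])
  have sj: "(fre (ip (newton_op smul l A j (b c)) (b c)) - fre (ip (newton_op smul l A j (b d)) (b d)),
     2 * to_complex (ip (newton_op smul l A j (b c)) (b d))) = s j" if j: "j < n" for j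
    unfolding null_label_sum[OF A, symmetric] s1[OF j, symmetric] using lab cc(4)[OF _ j] by simp
  have rj: "trace_minus_gaps A b l j = r j" if j: "Suc j < n" for j
    unfolding trace_minus_gaps_def newton_trace_pair[OF A cd] r1[OF j, symmetric]
    using lab cc(4)[of _ j] cc(6)[of j] j by simp
  have "pair_invariant c d i A b l = v i" if i: "i < pair_dim" for i
  proof -
    consider "i < n" | "n \<le> i" "i < 2 * n" | "2 * n \<le> i" "i < 3 * n - 1"
      | "3 * n - 1 \<le> i" "2 * n \<le> i" by linarith
    then show ?thesis
    proof cases
      case 1
      then show ?thesis using sj[of i] by (simp add: pair_invariant_simps s_def)
    next
      case 2
      then obtain j where "i = n + j" "j < n" by (metis add_less_cancel_left le_Suc_ex mult_2)
      then show ?thesis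
        using arg_cong[OF sj[of j], of "\<lambda>z. Re (snd z)"] by (simp add: pair_invariant_simps s_def to_complex_def)
    next
      case 3
      then obtain j where j: "i = 2 * n + j" using le_Suc_ex by blast
      then have "Suc j < n" using 3 by linarith
      then show ?thesis using rj[of j] j by (simp add: pair_invariant_simps r_def)
    next
      case 4
      have nz: "imag_unit \<noteq> (0::'f)" using i 4 by (auto simp: pair_dim_def split: if_splits)
      obtain j where j: "i = 3 * n - 1 + j" using 4 le_Suc_ex by blast
      then have "j < n" using i nz by (simp add: pair_dim_def)
      then show ?thesis
        using arg_cong[OF sj[of j], of "\<lambda>z. Im (snd z)"] nz pair_invariant_simps(4)[of j c d A b l] j
        by (simp add: s_def to_complex_def)
    qed
  qed
  then show ?thesis
    using A eigenvalues_unique[OF A] trace_eq_0[OF A cc(2)] by (intro exI[of _ A] exI[of _ b]) simp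
qed

theorem pair_quotient:
  fixes M :: "(('w \<Rightarrow> 'w) set \<times> ('f ^ 'k::finite \<Rightarrow> 'w)) real_space"
  assumes M: "M = rep_space smul ip" and k: "CARD('k) = 2"
  shows "\<exists>m f. semialgebraic_map M (coord_space m) f \<and>
    continuous_map (vs_topology M) (vs_topology (coord_space m)) f \<and>
    f ` pts M = pts (coord_space m) \<and> fibres_are_orbits M (O_group smul ip) act f"
proof -
  obtain c d :: 'k where cd: "(UNIV :: 'k set) = {c, d}" "c \<noteq> d" using k by (auto simp: card_2_iff)
  define I where "I i x = pair_invariant c d i (reduced (fst x)) (column (snd x)) (eigenvalues (reduced (fst x)))"
    for i and x :: "('w \<Rightarrow> 'w) set \<times> ('f ^ 'k \<Rightarrow> 'w)"
  define f where "f x i = (if i < pair_dim then I i x else 0)" for x i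
  have fM: "f ` pts M \<subseteq> pts (coord_space pair_dim)" by (auto simp: f_def coord_space_def)
  have idx: "2 * n + j < pair_dim \<and> pair_invariant c d (2 * n + j) = (\<lambda>A b l. trace_minus_gaps A b l j)"
    if "Suc j < n" for j
    using that by (auto simp: pair_dim_def pair_invariant_def fun_eq_iff)
  have props: "semialgebraic_map M (coord_space pair_dim) f"
    "continuous_map (vs_topology M) (vs_topology (coord_space pair_dim)) f"
    by (rule invariant_map_properties[where E = "pair_invariant c d" and \<rho> = "\<lambda>j. 2 * n + j",
          OF M coordinates_coord_space fM]; simp add: f_def I_def invariant_expr_pair idx)+
  have "pts (coord_space pair_dim) \<subseteq> f ` pts M"
  proof
    fix v assume v: "v \<in> pts (coord_space pair_dim)"
    obtain A and b :: "'k \<Rightarrow> 'w" where A: "selfadj A" "trace_pow A 1 = 0"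
      "\<And>i. i < pair_dim \<Longrightarrow> pair_invariant c d i A b (eigenvalues A) = v i"
      using pair_data_exist[OF cd, of v] by blast
    obtain x where x: "x \<in> pts M" "reduced (fst x) = A" "column (snd x) = b"
      using rep_point_exists[OF A(1,2), of b] M by blast
    have "f x = v" using v A(3) by (auto simp: f_def I_def x coord_space_def fun_eq_iff)
    then show "v \<in> f ` pts M" using x(1) by blast
  qed
  moreover have "fibres_are_orbits M (O_group smul ip) act f"
    unfolding fibres_are_orbits_def O_group_eq
  proof (intro ballI iffI)
    fix x y assume xy: "x \<in> pts M" "y \<in> pts M" and eq: "f x = f y"
    have "\<exists>C. unitary C \<and> (\<forall>z. C (reduced (fst x) z) = reduced (fst y) (C z)) \<and>
        (\<forall>c. C (column (snd x) c) = column (snd y) c)"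
    proof (rule pair_orbit[OF selfadj_reduced _ selfadj_reduced _ cd])
      show "trace_pow (reduced (fst x)) 1 = 0" "trace_pow (reduced (fst y)) 1 = 0"
        using xy unfolding M by (metis rep_space_cases)+
      fix i assume "i < pair_dim"
      then show "pair_invariant c d i (reduced (fst x)) (column (snd x)) (eigenvalues (reduced (fst x))) =
          pair_invariant c d i (reduced (fst y)) (column (snd y)) (eigenvalues (reduced (fst y)))"
        using fun_cong[OF eq, of i] by (simp add: f_def I_def)
    qed
    then show "\<exists>C\<in>{C. unitary C}. y = act C x"
      using rep_point_eq_act xy unfolding M by blast
  next
    fix x y assume xy: "x \<in> pts M" "y \<in> pts M" and "\<exists>C\<in>{C. unitary C}. y = act C x"
    then obtain C where C: "unitary C" "y = act C x" by blast
    note act = act_rep_space[OF C(1) xy(1)[unfolded M], folded C(2)]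
    have "I i y = I i x" for i
    proof -
      have "I i y = pair_invariant c d i (conjugate C (reduced (fst x))) (\<lambda>p. C (column (snd x) p)) (eigenvalues (reduced (fst x)))"
        unfolding I_def act(1) eigenvalues_conjugate[OF C(1) selfadj_reduced]
        by (rule arg_cong[where f = "\<lambda>b. pair_invariant c d i _ b _"]) (simp add: fun_eq_iff act(2))
      also have "\<dots> = I i x"
        unfolding I_def by (rule pair_invariant_unitary[OF C(1)]) (simp add: conjugate_apply C(1))
      finally show ?thesis .
    qed
    then show "f x = f y" by (simp add: f_def fun_eq_iff)
  qed
  ultimately show ?thesis using props fM by (intro exI[of _ pair_dim] exI[of _ f]) blast
qed

end

section \<open>One vector\<close>

context inner_product_space
begin

text \<open>A formula for the weight that is polynomial in all arguments and makes sense when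
  \<open>l\<close> is not the spectrum of \<open>A\<close>.\<close>

definition newton_weight :: "('w \<Rightarrow> 'w) \<Rightarrow> 'w \<Rightarrow> (nat \<Rightarrow> real) \<Rightarrow> nat \<Rightarrow> real" where
  "newton_weight A x l i = (- 1) ^ (n - 1 - i) * fre (ip (newton_op smul (omit i l) A (n - 1) x) x)"

text \<open>The blocks are traces, differences of weights and the two parts of the determinant, in
  the order of \<open>coord_field_coordinate\<close> with \<open>m = 2 * (n - 1)\<close>.\<close>

definition vector_invariant :: "'k::finite \<Rightarrow> nat \<Rightarrow> ('w \<Rightarrow> 'w) \<Rightarrow> ('k \<Rightarrow> 'w) \<Rightarrow> (nat \<Rightarrow> real) \<Rightarrow> real" where
  "vector_invariant c i A b l =
    (if i < n - 1 then trace_minus_gaps A b l i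
     else if i < 2 * (n - 1) then
       (\<Prod>q\<in>{Suc (i - (n - 1))..<n}. newton_weight A (b c) l q) - newton_weight A (b c) l (i - (n - 1))
     else if i = 2 * (n - 1) then fre (newton_det A l (b c)) else fim (newton_det A l (b c)))"

lemma vector_invariant_simps:
  "j < n - 1 \<Longrightarrow> vector_invariant c j A b l = trace_minus_gaps A b l j"
  "j < n - 1 \<Longrightarrow> vector_invariant c (n - 1 + j) A b l =
    (\<Prod>q\<in>{Suc j..<n}. newton_weight A (b c) l q) - newton_weight A (b c) l j"
  "vector_invariant c (2 * (n - 1)) A b l = fre (newton_det A l (b c))"
  "vector_invariant c (Suc (2 * (n - 1))) A b l = fim (newton_det A l (b c))"
proof -
  show "vector_invariant c (n - 1 + j) A b l =
      (\<Prod>q\<in>{Suc j..<n}. newton_weight A (b c) l q) - newton_weight A (b c) l j" if "j < n - 1"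
  proof -
    have *: "\<not> n - 1 + j < n - 1" "n - 1 + j < 2 * (n - 1)" "n - 1 + j - (n - 1) = j"
      using that by linarith+
    show ?thesis unfolding vector_invariant_def by (simp only: * if_True if_False)
  qed
qed (simp_all add: vector_invariant_def del: One_nat_def)

lemma invariant_expr_vector: "invariant_expr TYPE('z) (vector_invariant c i)" for c :: "'k::finite"
  unfolding invariant_expr_def
proof (intro allI impI)
  fix Q :: "('z \<Rightarrow> real) \<Rightarrow> bool" and A and b :: "'z \<Rightarrow> 'k \<Rightarrow> 'w" and l :: "'z \<Rightarrow> nat \<Rightarrow> real"
  assume *: "function_algebra Q" "\<forall>z. selfadj (A z)" "\<forall>v. QW Q (\<lambda>z. A z v)"
    "\<forall>c. QW Q (\<lambda>z. b z c)" "\<forall>i. Q (\<lambda>z. l z i)"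
  interpret function_algebra Q by (rule *)
  have A: "\<And>z. selfadj (A z)" "\<And>v. QW Q (\<lambda>z. A z v)" and b: "QW Q (\<lambda>z. b z c)" and l: "\<And>i. Q (\<lambda>z. l z i)"
    using * by auto
  have o: "Q (\<lambda>z. omit j (l z) q)" for j q
    unfolding omit_def using l by (cases "q < j") simp_all
  have w: "Q (\<lambda>z. newton_weight (A z) (b z c) (l z) j)" for j
    unfolding newton_weight_def
    using invariant_expr_newton_op(3)[where l = "\<lambda>z. omit j (l z)" and A = A and b = "\<lambda>z. b z c"
        and b' = "\<lambda>z. b z c" and j = "n - 1", OF *(1) A b b o]
    by (intro mult const)
  have t: "Q (\<lambda>z. trace_minus_gaps (A z) (b z) (l z) j)" for j
    by (rule invariant_exprD[where E = "\<lambda>A b l. trace_minus_gaps A b l j" and A = A and b = b and l = l,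
          OF invariant_expr_trace_minus_gaps]) (use * in auto)
  have d: "QF (\<lambda>z. newton_det (A z) (l z) (b z c))"
    unfolding newton_det_def matrix_det_def array_det_leibniz
  proof (rule QF_sum, rule QF_mult, rule QF_const, rule QF_prod)
    show "QF (\<lambda>z. ip (newton_op smul (l z) (A z) j (b z c)) (basis i))" for i j
      by (rule invariant_expr_newton_op(2)[where l = l and A = A and b = "\<lambda>z. b z c"
            and b' = "\<lambda>_. basis i", OF *(1) A b QW_const[OF *(1)] l])
  qed
  have e: "Q (\<lambda>z. (\<Prod>q\<in>{Suc j..<n}. newton_weight (A z) (b z c) (l z) q) - newton_weight (A z) (b z c) (l z) j)" for j
    by (rule diff, rule prod, rule w, rule w)
  consider "i < n - 1" | "\<not> i < n - 1" "i < 2 * (n - 1)" | "\<not> i < n - 1" "\<not> i < 2 * (n - 1)" "i = 2 * (n - 1)"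
    | "\<not> i < n - 1" "\<not> i < 2 * (n - 1)" "i \<noteq> 2 * (n - 1)" by blast
  then show "Q (\<lambda>z. vector_invariant c i (A z) (b z) (l z))"
    unfolding vector_invariant_def using t e d[unfolded QF_def] by cases (simp_all del: One_nat_def)
qed

lemma newton_weight_eq:
  assumes "selfadj A" "eigenbasis A l u" "i < n"
  shows "newton_weight A x l i = weight n l (\<lambda>i. sqnorm (ip x (u i))) i"
  unfolding newton_weight_def by (rule weight_eq_newton_op[OF assms, symmetric])

text \<open>The bound on \<open>i\<close> leaves out the determinant, which is multiplied by the
  determinant of \<open>C\<close>.\<close>

lemma vector_invariant_unitary:
  assumes C: "unitary C" "\<And>z. C (A z) = A' (C z)" and i: "i < 2 * (n - 1)"
  shows "vector_invariant c i A' (\<lambda>c. C (b c)) l = vector_invariant c i A b l"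
proof -
  have "ip (newton_op smul l A' j (C x)) (C y) = ip (newton_op smul l A j x) y" for l j x y
    using newton_op_unitary[of C A A' l j x, OF C] unitary_ip[OF C(1)] by simp
  then show ?thesis
    using i by (simp add: vector_invariant_def trace_minus_gaps_def newton_trace_def newton_weight_def)
qed

lemma newton_trace_single:
  assumes "selfadj A" "eigenbasis A l u" and c: "(UNIV :: 'k::finite set) = {c}"
  shows "newton_trace A b l j = (\<Sum>i<n. newton_coeff l j i * sqnorm (ip (b c) (u i)))"
  unfolding newton_trace_eq[OF assms(1,2)] c by simp

text \<open>The squared modulus of the Newton determinant is the full product of the weights; its
  phase is left to the determinant of the connecting operator.\<close>

lemma vector_orbit:
  assumes A: "selfadj A" "trace_pow A 1 = 0" and A': "selfadj A'" "trace_pow A' 1 = 0"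
    and c: "(UNIV :: 'k::finite set) = {c}" and n: "n > 0"
    and eq: "\<And>i. i < 2 * (n - 1) \<Longrightarrow>
      vector_invariant c i A b (eigenvalues A) = vector_invariant c i A' b' (eigenvalues A')"
    and det: "sqnorm (newton_det A (eigenvalues A) (b c)) = sqnorm (newton_det A' (eigenvalues A') (b' c))"
  shows "\<exists>C. unitary C \<and> (\<forall>z. C (A z) = A' (C z)) \<and> C (b c) = b' c"
proof -
  obtain l u where e: "eigenbasis A l u" "eigenvalues A = l" using eigenbasis_eigenvalues[OF A(1)] by auto
  obtain l' u' where e': "eigenbasis A' l' u'" "eigenvalues A' = l'" using eigenbasis_eigenvalues[OF A'(1)] by auto
  let ?w = "\<lambda>i. sqnorm (ip (b c) (u i))" and ?w' = "\<lambda>i. sqnorm (ip (b' c) (u' i))"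
  note eq' = eq[unfolded e(2) e'(2)]
  have "\<exists>s. (\<forall>i<n. l' i = l i + s) \<and> (\<forall>\<phi>. (\<Sum>i<n. \<phi> (l i) * ?w i) = (\<Sum>i<n. \<phi> (l i) * ?w' i))"
  proof (rule weighted_configuration_unique)
    show "descending n l" "descending n l'" using e e' eigenbasisD(2) by blast+
    show "(\<Prod>i<n. weight n l ?w i) = (\<Prod>i<n. weight n l' ?w' i)"
      using det unfolding e(2) e'(2) sqnorm_newton_det[OF A(1) e(1)] sqnorm_newton_det[OF A'(1) e'(1)] .
    fix j assume j: "Suc j < n"
    have ws: "newton_weight A (b c) l i = weight n l ?w i"
      "newton_weight A' (b' c) l' i = weight n l' ?w' i" if "i < n" for i
      by (rule newton_weight_eq[OF A(1) e(1) that], rule newton_weight_eq[OF A'(1) e'(1) that])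
    have "(\<Prod>q\<in>{Suc j..<n}. newton_weight A (b c) l q) - newton_weight A (b c) l j =
        (\<Prod>q\<in>{Suc j..<n}. newton_weight A' (b' c) l' q) - newton_weight A' (b' c) l' j"
    proof -
      have j': "j < n - 1" "n - 1 + j < 2 * (n - 1)" using j by linarith+
      show ?thesis using eq'[OF j'(2)] unfolding vector_invariant_simps(2)[OF j'(1)] .
    qed
    then show "(\<Prod>i\<in>{Suc j..<n}. weight n l ?w i) - weight n l ?w j =
        (\<Prod>i\<in>{Suc j..<n}. weight n l' ?w' i) - weight n l' ?w' j"
      using ws j by simp
    have "trace_minus_gaps A b l j = trace_minus_gaps A' b' l' j"
    proof -
      have j': "j < n - 1" "j < 2 * (n - 1)" using j by linarith+
      show ?thesis using eq'[OF j'(2)] unfolding vector_invariant_simps(1)[OF j'(1)] .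
    qed
    then show "(\<Sum>i<n. newton_coeff l j i * ?w i) - (\<Sum>i\<in>{j..<n}. l j - l i) =
        (\<Sum>i<n. newton_coeff l' j i * ?w' i) - (\<Sum>i\<in>{j..<n}. l' j - l' i)"
      unfolding trace_minus_gaps_def newton_trace_single[OF A(1) e(1) c] newton_trace_single[OF A'(1) e'(1) c] .
  qed (use n in auto)
  then obtain s where s: "\<And>i. i < n \<Longrightarrow> l' i = l i + s"
    and W: "\<And>\<phi>. (\<Sum>i<n. \<phi> (l i) * ?w i) = (\<Sum>i<n. \<phi> (l i) * ?w' i)" by blast
  have "l' = l"
  proof
    fix i
    show "l' i = l i"
    proof (cases "i < n")
      case True
      show ?thesis
        by (rule shift_eq_0[OF eigenvalue_sum[OF A(1) e(1) A(2)] eigenvalue_sum[OF A'(1) e'(1) A'(2)] s True])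
    next
      case False
      then show ?thesis using eigenbasisD(3)[OF e(1), of i] eigenbasisD(3)[OF e'(1), of i] by simp
    qed
  qed
  note e' = e'(1)[unfolded this]
  have "\<exists>C. unitary C \<and> (\<forall>z. C (A z) = A' (C z)) \<and> (\<forall>c. C (b c) = b' c)"
  proof (rule unitary_between_data[OF A(1) e(1) A'(1) e'])
    fix \<phi> :: "real \<Rightarrow> real" and p q :: 'k
    have "p = c" "q = c" using c by auto
    moreover have "(\<Sum>i<n. of_real (\<phi> (l i)) * (ip (b c) (u i) * cconj (ip (b c) (u i)))) =
        (of_real (\<Sum>i<n. \<phi> (l i) * sqnorm (ip (b c) (u i))) :: 'f)" for b and u :: "nat \<Rightarrow> 'w"
      by (simp add: mult_cconj)
    ultimately show "(\<Sum>i<n. of_real (\<phi> (l i)) * (ip (b p) (u i) * cconj (ip (b q) (u i)))) =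
        (\<Sum>i<n. of_real (\<phi> (l i)) * (ip (b' p) (u' i) * cconj (ip (b' q) (u' i))))"
      using W[of \<phi>] by metis
  qed
  then show ?thesis by blast
qed

text \<open>If the vector is not cyclic, some eigenvector of the operator is orthogonal to it; the
  reflections along this eigenvector stabilize the pair and have arbitrary determinants.\<close>

lemma stabilizer_of_noncyclic:
  assumes A: "selfadj A" and det: "newton_det A (eigenvalues A) x = 0" and z: "sqnorm z = 1"
  shows "\<exists>R. unitary R \<and> (\<forall>y. R (A y) = A (R y)) \<and> R x = x \<and> operator_det R = z"
proof -
  obtain l u where e: "eigenbasis A l u" "eigenvalues A = l" using eigenbasis_eigenvalues[OF A] by auto
  note u = eigenbasisD(1)[OF e(1)]
  have "(\<Prod>i<n. weight n l (\<lambda>i. sqnorm (ip x (u i))) i) = 0"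
    using det sqnorm_newton_det[OF A e(1), of x] by (simp add: e(2))
  then obtain i where i: "i < n" "weight n l (\<lambda>i. sqnorm (ip x (u i))) i = 0" by auto
  have ui0: "u i \<noteq> 0" using orthonormal_ip[OF u i(1) i(1)] by auto
  have "\<exists>w \<mu>. w \<noteq> 0 \<and> A w = smul (of_real \<mu>) w \<and> ip x w = 0"
  proof (cases "ip x (u i) = 0")
    case True
    then show ?thesis using ui0 eigenbasisD(4)[OF e(1) i(1)] by blast
  next
    case False
    then obtain q where q: "q < n" "q \<noteq> i" "l q = l i" using i(2) by (auto simp: weight_def)
    \<comment> \<open>A combination of two eigenvectors with the same eigenvalue, chosen orthogonal
      to \<open>x\<close>.\<close>
    define w where "w = smul (cconj (ip x (u q))) (u i) - smul (cconj (ip x (u i))) (u q)"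
    have "ip w (u q) = - cconj (ip x (u i))"
      using orthonormal_ip[OF u i(1) q(1)] orthonormal_ip[OF u q(1) q(1)] q(2)
      by (simp add: w_def ip_diff ip_scale)
    then have "w \<noteq> 0" using False by auto
    moreover have "A w = smul (of_real (l i)) w"
      using eigenbasisD(4)[OF e(1) i(1)] eigenbasisD(4)[OF e(1) q(1)] q(3)
      by (simp add: w_def lin_diff lin_scale selfadj_lin[OF A] scale_right_diff_distrib mult.commute)
    moreover have "ip x w = 0" by (simp add: w_def ip_diff_right ip_scale_right)
    ultimately show ?thesis by blast
  qed
  then obtain w \<mu> where w: "w \<noteq> 0" "A w = smul (of_real \<mu>) w" "ip x w = 0" by blast
  show ?thesis
    using det_reflection[OF w(1) z] reflection_commute[OF A w(2)] reflection_orthogonal[OF w(3)]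
    by (intro exI[of _ "reflection ((1 - z) / of_real (normsq w)) w"]) simp
qed

text \<open>The weights give the right modulus of the determinant. If it is nonzero, its phase is
  corrected by a reflection along a basis eigenvector, which commutes with the operator and so
  leaves the other invariants alone.\<close>

lemma vector_data_exist:
  assumes c: "(UNIV :: 'k::finite set) = {c}" and n: "n > 0"
  shows "\<exists>A b. selfadj A \<and> trace_pow A 1 = 0 \<and>
    (\<forall>i<2 * (n - 1). vector_invariant c i A b (eigenvalues A) = v i) \<and>
    newton_det A (eigenvalues A) (b c) = d"
proof -
  have "\<exists>l w. descending n l \<and> (\<forall>i<n. w i \<ge> 0) \<and> (\<Prod>i<n. weight n l w i) = sqnorm d \<and>
    (\<forall>j. Suc j < n \<longrightarrow> (\<Prod>i\<in>{Suc j..<n}. weight n l w i) - weight n l w j = v (n - 1 + j)) \<and>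
    (\<forall>j. Suc j < n \<longrightarrow> (\<Sum>i<n. newton_coeff l j i * w i) - (\<Sum>i\<in>{j..<n}. l j - l i) = v j)"
    by (rule weighted_configuration_exists[OF n]) simp
  then obtain l1 w where l1: "descending n l1" and w: "\<And>i. i < n \<Longrightarrow> w i \<ge> 0"
    and p1: "(\<Prod>i<n. weight n l1 w i) = sqnorm d"
    and e1: "\<And>j. Suc j < n \<Longrightarrow> (\<Prod>i\<in>{Suc j..<n}. weight n l1 w i) - weight n l1 w j = v (n - 1 + j)"
    and r1: "\<And>j. Suc j < n \<Longrightarrow>
      (\<Sum>i<n. newton_coeff l1 j i * w i) - (\<Sum>i\<in>{j..<n}. l1 j - l1 i) = v j"
    by blast
  define l where "l = centered l1"
  note cc = centered_configuration[OF l1, folded l_def]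
  obtain A where A: "selfadj A" "eigenbasis A l basis"
    using diagonal_operator_exists[OF cc(1,3)] by blast
  define x where "x = (\<Sum>i<n. smul (of_real (sqrt (w i))) (basis i))"
  have x: "sqnorm (ip x (basis i)) = w i" if "i < n" for i
    using that w by (simp add: x_def orthonormal_coeff[OF orthonormal_basis])
  have ws: "weight n l (\<lambda>i. sqnorm (ip x (basis i))) i = weight n l1 w i" if "i < n" for i
    using cc(5)[OF that, of w] x[OF that] by (simp add: weight_def)
  have sq: "sqnorm (newton_det A l x) = sqnorm d"
    unfolding sqnorm_newton_det[OF A] p1[symmetric] using ws by simp
  have base: "vector_invariant c i A (\<lambda>_. x) l = v i" if i: "i < 2 * (n - 1)" for i
  proof (cases "i < n - 1")
    case True
    then have j: "Suc i < n" by simp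
    have "trace_minus_gaps A (\<lambda>_ :: 'k. x) l i = v i"
      unfolding trace_minus_gaps_def newton_trace_single[OF A c] r1[OF j, symmetric]
      using x cc(4)[of _ i] cc(6)[of i] j by simp
    then show ?thesis using True by (simp add: vector_invariant_simps del: One_nat_def)
  next
    case False
    then obtain j where j: "i = n - 1 + j" by (metis le_Suc_ex not_less)
    then have j': "Suc j < n" "j < n - 1" using i by auto
    have "(\<Prod>q\<in>{Suc j..<n}. newton_weight A x l q) - newton_weight A x l j = v (n - 1 + j)"
      unfolding e1[OF j'(1), symmetric] using j' newton_weight_eq[OF A] ws by simp
    then show ?thesis unfolding j vector_invariant_simps(2)[OF j'(2)] .
  qed
  obtain R where R: "unitary R" "\<And>y. R (A y) = A (R y)" "operator_det R * newton_det A l x = d"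
  proof (cases "d = 0")
    case True
    then have "newton_det A l x = 0" using sq by simp
    then show ?thesis using True that[OF unitary_id] by simp
  next
    case False
    define z where "z = d / newton_det A l x"
    have nz: "newton_det A l x \<noteq> 0" using sq False by auto
    have "sqnorm z * sqnorm (newton_det A l x) = sqnorm d"
      unfolding sqnorm_mult[symmetric] using nz by (simp add: z_def)
    then have z: "sqnorm z = 1" using sq nz by auto
    have b0: "basis 0 \<noteq> 0" using orthonormal_ip[OF orthonormal_basis n n] by auto
    note dr = det_reflection[OF b0 z]
    show ?thesis
      by (rule that[OF dr(1) reflection_commute[OF A(1) eigenbasisD(4)[OF A(2) n], symmetric]])
        (use nz dr(2) in \<open>simp add: z_def\<close>)
  qed
  have "vector_invariant c i A (\<lambda>_. R x) l = v i" if "i < 2 * (n - 1)" for i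
    using vector_invariant_unitary[of R A A i c "\<lambda>_. x" l, OF R(1,2) that] base[OF that] by simp
  moreover have "newton_det A l (R x) = d"
    using newton_det_unitary[of R A A, OF R(1,2)] R(3) by simp
  ultimately show ?thesis
    using A eigenvalues_unique[OF A] trace_eq_0[OF A cc(2)] by (intro exI[of _ A] exI[of _ "\<lambda>_. R x"]) simp
qed

theorem vector_quotient:
  fixes M :: "(('w \<Rightarrow> 'w) set \<times> ('f ^ 'k::finite \<Rightarrow> 'w)) real_space"
  assumes M: "M = rep_space smul ip" and k: "CARD('k) = 1" and n: "n > 0"
  shows "\<exists>m f. semialgebraic_map M (coord_space m \<oplus>\<^sub>R (field_space :: 'f real_space)) f \<and>
    continuous_map (vs_topology M) (vs_topology (coord_space m \<oplus>\<^sub>R (field_space :: 'f real_space))) f \<and>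
    f ` pts M = pts (coord_space m \<oplus>\<^sub>R (field_space :: 'f real_space)) \<and>
    fibres_are_orbits M (SO_group smul ip) act f \<and>
    (\<forall>C\<in>O_group smul ip. \<forall>x\<in>pts M. \<forall>v l. f x = (v, l) \<longrightarrow> f (act C x) = (v, op_det smul C * l))"
proof -
  obtain c :: 'k where c: "(UNIV :: 'k set) = {c}" using k by (auto simp: card_1_singleton_iff)
  define m where "m = 2 * (n - 1)"
  let ?Y = "coord_space m \<oplus>\<^sub>R (field_space :: 'f real_space)"
  define I where "I i x = vector_invariant c i (reduced (fst x)) (column (snd x)) (eigenvalues (reduced (fst x)))"
    for i and x :: "('w \<Rightarrow> 'w) set \<times> ('f ^ 'k \<Rightarrow> 'w)"
  define D where "D x = newton_det (reduced (fst x)) (eigenvalues (reduced (fst x))) (column (snd x) c)"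
    for x :: "('w \<Rightarrow> 'w) set \<times> ('f ^ 'k \<Rightarrow> 'w)"
  define f where "f x = (\<lambda>i. if i < m then I i x else 0, D x)" for x
  have fM: "f ` pts M \<subseteq> pts ?Y" by (auto simp: f_def direct_sum_def coord_space_def field_space_def)
  have coord: "coord_field_coordinate m i (f x) =
      vector_invariant c i (reduced (fst x)) (column (snd x)) (eigenvalues (reduced (fst x)))"
    if "i < m + 2" for i x
  proof -
    have "i < m \<or> i = m \<or> i = Suc m" using that by linarith
    then consider "i < m" | "i = m" | "i = Suc m" by blast
    then show ?thesis
      by cases (simp_all add: coord_field_coordinate_def f_def I_def D_def m_def vector_invariant_simps del: One_nat_def)
  qed
  have idx: "j < m" "vector_invariant c j = (\<lambda>A b l. trace_minus_gaps A b l j)" if "Suc j < n" for j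
    using that by (auto simp: m_def vector_invariant_simps fun_eq_iff)
  have props: "semialgebraic_map M ?Y f" "continuous_map (vs_topology M) (vs_topology ?Y) f"
    by (rule invariant_map_properties[where E = "vector_invariant c" and \<rho> = "\<lambda>j. j",
          OF M coordinates_coord_field fM]; simp add: coord invariant_expr_vector idx less_SucI)+
  have "pts ?Y \<subseteq> f ` pts M"
  proof
    fix y assume y: "y \<in> pts ?Y"
    obtain v d where vd: "y = (v, d)" by (cases y)
    have v: "v \<in> pts (coord_space m)" using y vd by (simp add: direct_sum_def)
    obtain A and b :: "'k \<Rightarrow> 'w" where A: "selfadj A" "trace_pow A 1 = 0"
      "\<And>i. i < m \<Longrightarrow> vector_invariant c i A b (eigenvalues A) = v i"
      "newton_det A (eigenvalues A) (b c) = d"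
      using vector_data_exist[OF c n, of v d] unfolding m_def by blast
    obtain x where x: "x \<in> pts M" "reduced (fst x) = A" "column (snd x) = b"
      using rep_point_exists[OF A(1,2), of b] M by blast
    have "f x = y" using v A(3,4) by (auto simp: f_def I_def D_def vd x coord_space_def fun_eq_iff)
    then show "y \<in> f ` pts M" using x(1) by blast
  qed
  moreover have equiv: "f (act C x) = (fst (f x), operator_det C * snd (f x))"
    if C: "unitary C" and x: "x \<in> pts M" for C x
  proof -
    note act = act_rep_space[OF C x[unfolded M]]
    have col: "column (snd (act C x)) = (\<lambda>p. C (column (snd x) p))" using act(2) by auto
    have "I i (act C x) = I i x" if "i < m" for i
      unfolding I_def act(1) col eigenvalues_conjugate[OF C selfadj_reduced]
      using that unfolding m_def by (intro vector_invariant_unitary[OF C]) (simp_all add: conjugate_apply C)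
    moreover have "D (act C x) = operator_det C * D x"
      unfolding D_def act(1) col eigenvalues_conjugate[OF C selfadj_reduced]
      by (rule newton_det_unitary[OF C]) (simp add: conjugate_apply C)
    ultimately show ?thesis by (auto simp: f_def)
  qed
  moreover have "fibres_are_orbits M (SO_group smul ip) act f"
    unfolding fibres_are_orbits_def SO_group_def O_group_eq
  proof (intro ballI iffI)
    fix x y assume xy: "x \<in> pts M" "y \<in> pts M" and eq: "f x = f y"
    let ?A = "reduced (fst x)" and ?A' = "reduced (fst y)"
    have D: "D x = D y" using eq by (simp add: f_def)
    have "\<exists>C. unitary C \<and> (\<forall>z. C (?A z) = ?A' (C z)) \<and> C (column (snd x) c) = column (snd y) c"
    proof (rule vector_orbit[OF selfadj_reduced _ selfadj_reduced _ c n])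
      show "trace_pow ?A 1 = 0" "trace_pow ?A' 1 = 0"
        using xy unfolding M by (metis rep_space_cases)+
      show "sqnorm (newton_det ?A (eigenvalues ?A) (column (snd x) c)) =
          sqnorm (newton_det ?A' (eigenvalues ?A') (column (snd y) c))"
        using D by (simp add: D_def)
      fix i assume "i < 2 * (n - 1)"
      then have "i < m" by (simp add: m_def)
      then show "vector_invariant c i ?A (column (snd x)) (eigenvalues ?A) =
          vector_invariant c i ?A' (column (snd y)) (eigenvalues ?A')"
        using fun_cong[OF arg_cong[OF eq, of fst], of i] by (simp add: f_def I_def)
    qed
    then obtain C where C: "unitary C" "\<And>z. C (?A z) = ?A' (C z)" "C (column (snd x) c) = column (snd y) c"
      by blast
    have col: "C (column (snd x) p) = column (snd y) p" for p
    proof -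
      have "p = c" using c by auto
      then show ?thesis using C(3) by simp
    qed
    have yC: "y = act C x" by (rule rep_point_eq_act[OF C(1) xy[unfolded M] C(2) col])
    \<comment> \<open>For a cyclic vector this forces determinant 1; otherwise the stabilizer
      contains an operator of the inverse determinant, by which \<open>C\<close> is
      corrected.\<close>
    have DC: "D x = operator_det C * D x" using equiv[OF C(1) xy(1)] D by (simp add: f_def yC[symmetric])
    show "\<exists>C\<in>{C \<in> {C. unitary C}. op_det smul C = 1}. y = act C x"
    proof (cases "D x = 0")
      case False
      then have "op_det smul C = 1" using DC op_det_eq[OF unitary_lin[OF C(1)]] by simp
      then show ?thesis using C(1) yC by blast
    next
      case True
      have sC: "sqnorm (operator_det C) = 1" by (rule sqnorm_operator_det[OF C(1)])
      then obtain R where R: "unitary R" "\<And>z. R (?A z) = ?A (R z)"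
        "R (column (snd x) c) = column (snd x) c" "operator_det R = cconj (operator_det C)"
        using stabilizer_of_noncyclic[OF selfadj_reduced True[unfolded D_def], of "cconj (operator_det C)"]
        by auto
      have CR: "unitary (C \<circ> R)" by (rule unitary_comp[OF C(1) R(1)])
      have "y = act (C \<circ> R) x"
      proof (rule rep_point_eq_act[OF CR xy[unfolded M]])
        show "(C \<circ> R) (?A z) = ?A' ((C \<circ> R) z)" for z by (simp add: R(2) C(2))
        show "(C \<circ> R) (column (snd x) p) = column (snd y) p" for p
        proof -
          have "p = c" using c by auto
          then show ?thesis using C(3) R(3) by simp
        qed
      qed
      moreover have "op_det smul (C \<circ> R) = 1"
        using op_det_eq[OF unitary_lin[OF CR]] operator_det_comp[OF unitary_lin[OF C(1)], of R] R(4) sC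
        by (simp add: mult_cconj)
      ultimately show ?thesis using CR by blast
    qed
  next
    fix x y assume xy: "x \<in> pts M" "y \<in> pts M"
      and "\<exists>C\<in>{C \<in> {C. unitary C}. op_det smul C = 1}. y = act C x"
    then obtain C where C: "unitary C" "op_det smul C = 1" "y = act C x" by blast
    have "operator_det C = 1" using C(2) op_det_eq[OF unitary_lin[OF C(1)]] by simp
    then show "f x = f y" using equiv[OF C(1) xy(1)] C(3) by simp
  qed
  ultimately show ?thesis
    using props fM op_det_eq[OF unitary_lin]
    by (intro exI[of _ m] exI[of _ f]) (auto simp: O_group_eq)
qed

end

theorem theorem1p1:
  fixes smul :: "'f::real_or_complex \<Rightarrow> 'w::ab_group_add \<Rightarrow> 'w"
    and ip :: "'w \<Rightarrow> 'w \<Rightarrow> 'f"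
    and M :: "(('w \<Rightarrow> 'w) set \<times> ('f ^ 'k \<Rightarrow> 'w)) real_space"
  assumes W: "inner_product_space smul ip"
    and k: "CARD('k::finite) \<in> {1, 2}"
    and dim_W: "vector_space.dim smul UNIV \<ge> 2 - CARD('k)"
    and M: "M = rep_space smul ip"
  shows "(CARD('k) = 1 \<longrightarrow>
      (\<exists>m f. let Y = coord_space m \<oplus>\<^sub>R (field_space :: 'f real_space) in
        semialgebraic_map M Y f \<and>
        continuous_map (vs_topology M) (vs_topology Y) f \<and>
        f ` pts M = pts Y \<and>
        fibres_are_orbits M (SO_group smul ip) act f \<and>
        (\<forall>C\<in>O_group smul ip. \<forall>x\<in>pts M. \<forall>v l.
          f x = (v, l) \<longrightarrow> f (act C x) = (v, op_det smul C * l)))) \<and>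
    (CARD('k) = 2 \<longrightarrow>
      (\<exists>m f. let Y = coord_space m in
        semialgebraic_map M Y f \<and>
        continuous_map (vs_topology M) (vs_topology Y) f \<and>
        f ` pts M = pts Y \<and>
        fibres_are_orbits M (O_group smul ip) act f))"
proof -
  interpret inner_product_space smul ip by (rule W)
  \<comment> \<open>For one vector the bound on the dimension says that
    \<open>n > 0\<close>.\<close>
  show ?thesis
    unfolding Let_def
    using vector_quotient[OF M] pair_quotient[OF M] dim_W by auto
qed

end
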